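(* Let $\lambda$ be an uncountable cardinal, $\xi\le\lambda^+$ an ordinal, $\chi<\lambda^+$ an infinite regular cardinal and $\mu\le\lambda$ a cardinal, and suppose that $\square_\xi(\lambda^+,{<}\mu,{\sqsubseteq_\chi})$ holds. Suppose also that $2^\lambda=\lambda^+$ and that $\{\theta\in\mathrm{reg}(\lambda)\mid\mathcal D(\lambda,\theta)=\lambda\}$ is cofinal in $\mathrm{reg}(\lambda)$. Then there exist a $\square_\xi(\lambda^+,{<}\mu,{\sqsubseteq_\chi})$-sequence $\langle\mathcal C_\alpha\mid\alpha<\lambda^+\rangle$ with support $\Gamma$, a transversal $\langle C_\alpha\mid\alpha\in\Gamma\rangle$ for it, and a cofinal subset $\Theta\subseteq\mathrm{reg}(\lambda)$ such that for every $\theta\in\Theta$: (1) for every club $E\subseteq\lambda^+$ there exists $\alpha\in E^{\lambda^+}_\theta\cap\Gamma$ such that $\sup(\mathrm{nacc}(C)\cap E)=\alpha$ for all $C\in\mathcal C_\alpha$; (2) for every $\zeta<\lambda^+$ and every sequence $\langle A_i\mid i<\theta\rangle$ of cofinal subsets of $\lambda^+$, there exists $\alpha\in E^{\lambda^+}_\theta\cap\Gamma$ with $\min(C_\alpha)=\zeta$ such that $\sup(\mathrm{nacc}(C_\alpha)\cap A_i)=\alpha$ for all $i<\theta$.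
   Context: $\mathrm{reg}(\lambda)$ is the set of infinite regular cardinals below $\lambda$; $E^{\lambda^+}_\theta=\{\alpha<\lambda^+\mid\mathrm{cf}(\alpha)=\theta\}$; $\mathcal D(\lambda,\theta)=\mathrm{cf}([\lambda]^\theta,\supseteq)$ is the density of $[\lambda]^\theta$. For a set of ordinals $C$: $\mathrm{acc}(C)=\{\alpha\in C\mid\sup(C\cap\alpha)=\alpha>0\}$, $\mathrm{nacc}(C)=C\setminus\mathrm{acc}(C)$, $\mathrm{acc}^+(C)=\{\alpha<\sup(C)\mid\sup(C\cap\alpha)=\alpha>0\}$. $D\sqsubseteq C$ means $D=C\cap\beta$ for some $\beta$; $D\sqsubseteq_\chi C$ means $D\sqsubseteq C$ or ($\mathrm{otp}(C)<\chi$ and $\mathrm{nacc}(C)$ consists only of successor ordinals). With $\kappa=\lambda^+$, a $\square_\xi(\kappa,{<}\mu,{\sqsubseteq_\chi})$-sequence is $\langle\mathcal C_\alpha\mid\alpha<\kappa\rangle$ with $\mathcal C_0=\{\emptyset\}$, $\mathcal C_{\alpha+1}=\{\{\alpha\}\}$, and for limit $\alpha$, $\mathcal C_\alpha$ a nonempty collection of clubs in $\alpha$ each of order-type $\le\xi$, such that: $|\mathcal C_\alpha|<\mu$ and at most one element of $\mathcal C_\alpha$ has order-type $\xi$; for every $\alpha$, $C\in\mathcal C_\alpha$, $\bar\alpha\in\mathrm{acc}(C)$ there is $D\in\mathcal C_{\bar\alpha}$ with $D\sqsubseteq_\chi C$; for every cofinal $A\subseteq\kappa$ there is $\alpha\in\mathrm{acc}^+(A)$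 with $A\cap\alpha\notin\mathcal C_\alpha$; letting the support be $\Gamma=\{\alpha\in\mathrm{acc}(\kappa)\mid\forall C\in\mathcal C_\alpha\forall\bar\alpha\in\mathrm{acc}(C)[C\cap\bar\alpha\in\mathcal C_{\bar\alpha}]\}$, for limit $\alpha\notin\Gamma$, $\mathcal C_\alpha=\{e_\alpha\}$ with $\mathrm{otp}(e_\alpha)=\mathrm{cf}(\alpha)$; and all $\alpha<\kappa$ of countable cofinality lie in $\Gamma$. A transversal is a sequence $\langle C_\alpha\mid\alpha\in\Gamma\rangle$ with $C_\alpha\in\mathcal C_\alpha$. *)

theory Defs
  imports Main
begin

unbundle cardinal_syntax

text \<open>
  Ordinals are rendered with the well-orders of Main.  If \<open>r\<close> is a well-order, the elements of
  \<open>Field r\<close> stand for the ordinals below the order type of \<open>r\<close>, the ordinal \<open>a\<close> being identified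
  with its set of predecessors \<open>underS r a\<close>; suprema and minima are \<open>wo_rel.supr r\<close> and
  \<open>wo_rel.minim r\<close> (in particular \<open>wo_rel.supr r {}\<close> is the least element).  Ordinals and cardinals
  that need not lie below \<open>r\<close> are given as well-orders, respectively cardinal orders, up to \<open>=o\<close>.
\<close>

definition ord_seg :: "'a rel \<Rightarrow> 'a \<Rightarrow> 'a rel" where
  "ord_seg r a = Restr r (underS r a)"

abbreviation ozero :: "'a rel \<Rightarrow> 'a" where
  "ozero r \<equiv> wo_rel.minim r (Field r)"

abbreviation osuc :: "'a rel \<Rightarrow> 'a \<Rightarrow> 'a" where
  "osuc r a \<equiv> wo_rel.suc r {a}"

abbreviation otp :: "'a rel \<Rightarrow> 'a set \<Rightarrow> 'a rel" where
  "otp r C \<equiv> Restr r C"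


text \<open>The cofinality of an arbitrary reflexive relation \<open>le\<close> on \<open>P\<close>.  For \<open>P = underS r a\<close> this is
  the usual cofinality of an ordinal: 0 at zero and 1 at successors.\<close>

definition cofinal_in :: "'b rel \<Rightarrow> 'b set \<Rightarrow> 'b set \<Rightarrow> bool" where
  "cofinal_in le P A \<longleftrightarrow> A \<subseteq> P \<and> (\<forall>p\<in>P. \<exists>a\<in>A. (p, a) \<in> le)"

definition cofinality :: "'b rel \<Rightarrow> 'b set \<Rightarrow> 'b rel" where
  "cofinality le P =
     card_of (SOME A. cofinal_in le P A \<and> (\<forall>B. cofinal_in le P B \<longrightarrow> |A| \<le>o |B| ))"

lemma cofinality_attained:
  assumes "\<And>p. p \<in> P \<Longrightarrow> (p, p) \<in> le"
  obtains A where "cofinal_in le P A" "cofinality le P = |A|"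
    "\<And>B. cofinal_in le P B \<Longrightarrow> |A| \<le>o |B|"
proof -
  let ?R = "{ |B| | B. cofinal_in le P B}"
  have "cofinal_in le P P"
    using assms by (auto simp: cofinal_in_def)
  then have "?R \<noteq> {}" by blast
  moreover have "\<forall>r\<in>?R. Card_order r"
    using card_of_Card_order by blast
  ultimately have "\<exists>r\<in>?R. \<forall>r'\<in>?R. r \<le>o r'"
    by (rule exists_minim_Card_order)
  then have ex: "\<exists>A. cofinal_in le P A \<and> (\<forall>B. cofinal_in le P B \<longrightarrow> |A| \<le>o |B| )" by blast
  show thesis
    using someI_ex[OF ex] that unfolding cofinality_def by blast
qed

abbreviation cf :: "'a rel \<Rightarrow> 'a \<Rightarrow> 'a rel" where
  "cf r a \<equiv> cofinality r (underS r a)"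

definition cof_points :: "'a rel \<Rightarrow> 'b rel \<Rightarrow> 'a set" where
  "cof_points r t = {a \<in> Field r. cf r a =o t}"

definition reg :: "'l rel \<Rightarrow> 'l set" where
  "reg lam = {t \<in> Field lam. Cinfinite (ord_seg lam t) \<and> regularCard (ord_seg lam t)}"

definition subsets_of_size :: "'l rel \<Rightarrow> 'b rel \<Rightarrow> 'l set set" where
  "subsets_of_size lam t = {X. X \<subseteq> Field lam \<and> |X| =o t}"

definition density :: "'l rel \<Rightarrow> 'b rel \<Rightarrow> 'l set rel" where
  "density lam t = cofinality {(X, Y). X \<supseteq> Y} (subsets_of_size lam t)"


definition acc :: "'a rel \<Rightarrow> 'a set \<Rightarrow> 'a set" where
  "acc r C = {a \<in> C. wo_rel.supr r (C \<inter> underS r a) = a \<and> a \<noteq> ozero r}"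

definition nacc :: "'a rel \<Rightarrow> 'a set \<Rightarrow> 'a set" where
  "nacc r C = C - acc r C"

text \<open>\<open>a < sup C\<close> is written as \<open>a < c\<close> for some \<open>c \<in> C\<close>, so that sets \<open>C\<close> that are unbounded
  in \<open>r\<close> are covered as well.\<close>

definition acc_plus :: "'a rel \<Rightarrow> 'a set \<Rightarrow> 'a set" where
  "acc_plus r C =
     {a. (\<exists>c\<in>C. a \<in> underS r c) \<and> wo_rel.supr r (C \<inter> underS r a) = a \<and> a \<noteq> ozero r}"

text \<open>Clubs in \<open>S\<close>, where \<open>S\<close> is either \<open>Field r\<close> or \<open>underS r a\<close> for a limit \<open>a\<close>.\<close>

definition club_in :: "'a rel \<Rightarrow> 'a set \<Rightarrow> 'a set \<Rightarrow> bool" where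
  "club_in r S C \<longleftrightarrow> cofinal_in r S C \<and>
     (\<forall>a\<in>S. wo_rel.supr r (C \<inter> underS r a) = a \<and> a \<noteq> ozero r \<longrightarrow> a \<in> C)"

text \<open>The first disjunct accounts for \<open>C = C \<inter> \<beta>\<close> with \<open>\<beta>\<close> at or above the order type of \<open>r\<close>.\<close>

definition initial_part :: "'a rel \<Rightarrow> 'a set \<Rightarrow> 'a set \<Rightarrow> bool" where
  "initial_part r D C \<longleftrightarrow> D = C \<or> (\<exists>b\<in>Field r. D = C \<inter> underS r b)"

definition initial_part_mod :: "'a rel \<Rightarrow> 'c rel \<Rightarrow> 'a set \<Rightarrow> 'a set \<Rightarrow> bool" where
  "initial_part_mod r chi D C \<longleftrightarrow> initial_part r D C \<or>
     (otp r C <o chi \<and> (\<forall>a\<in>nacc r C. \<exists>b\<in>Field r. a = osuc r b))"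


text \<open>Below \<open>k\<close> is the cardinal \<open>\<lambda>\<^sup>+\<close>; \<open>acc k (Field k)\<close> is the set of limit ordinals below it.\<close>

definition support :: "'k rel \<Rightarrow> ('k \<Rightarrow> 'k set set) \<Rightarrow> 'k set" where
  "support k Cs = {a \<in> acc k (Field k). \<forall>C\<in>Cs a. \<forall>b\<in>acc k C. C \<inter> underS k b \<in> Cs b}"

definition square_seq ::
  "'k rel \<Rightarrow> 'x rel \<Rightarrow> 'm rel \<Rightarrow> 'c rel \<Rightarrow> ('k \<Rightarrow> 'k set set) \<Rightarrow> bool" where
  "square_seq k xi mu chi Cs \<longleftrightarrow>
     Cs (ozero k) = {{}} \<and>
     (\<forall>a\<in>Field k. Cs (osuc k a) = {{a}}) \<and>
     (\<forall>a\<in>acc k (Field k).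
        Cs a \<noteq> {} \<and>
        (\<forall>C\<in>Cs a. club_in k (underS k a) C \<and> otp k C \<le>o xi) \<and>
        |Cs a| <o mu \<and>
        (\<forall>C\<in>Cs a. \<forall>D\<in>Cs a. otp k C =o xi \<and> otp k D =o xi \<longrightarrow> C = D)) \<and>
     (\<forall>a\<in>Field k. \<forall>C\<in>Cs a. \<forall>b\<in>acc k C. \<exists>D\<in>Cs b. initial_part_mod k chi D C) \<and>
     (\<forall>A. cofinal_in k (Field k) A \<longrightarrow> (\<exists>a\<in>acc_plus k A. A \<inter> underS k a \<notin> Cs a)) \<and>
     (\<forall>a\<in>acc k (Field k) - support k Cs. \<exists>e. Cs a = {e} \<and> otp k e =o cf k a) \<and>
     cof_points k natLeq \<subseteq> support k Cs"

definition transversal :: "'k rel \<Rightarrow> ('k \<Rightarrow> 'k set set) \<Rightarrow> ('k \<Rightarrow> 'k set) \<Rightarrow> bool" where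
  "transversal k Cs T \<longleftrightarrow> (\<forall>a\<in>support k Cs. T a \<in> Cs a)"

end

theory Submission
  imports Defs
begin

text \<open>Write \<open>\<kappa> = \<lambda>\<^sup>+\<close>, and let \<open>\<Gamma>\<close> be the support of the given sequence \<open>\<C>\<close>.  All changes made to \<open>\<C>\<close> are of
  the form \<open>C \<mapsto> P C\<close> for \<open>C \<in> \<C>\<^sub>\<alpha>\<close>, \<open>\<alpha> \<in> \<Gamma>\<close>, where \<open>P\<close> keeps clubs, creates no new accumulation points
  and commutes with restriction to accumulation points.  Such a change preserves the square sequence:
  a thread of the new sequence gives a tree of height \<open>\<kappa>\<close> with levels of size less than \<open>\<lambda>\<close>, and a
  cofinal branch of this tree is a thread of the old sequence.

  Part (1) is obtained by adding to each \<open>C\<close> the points \<open>max (E \<inter> c)\<close> for \<open>c \<in> nacc C\<close>, where \<open>E\<close> is a suitable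
  club.  If no \<open>E\<close> worked for \<open>\<theta>\<close>, there would be a decreasing sequence of \<open>\<lambda>\<close> clubs witnessing this; at a
  suitable \<open>\<alpha>\<close> of cofinality \<open>\<theta>\<close> infinitely many of them fail for the same \<open>C \<in> \<C>\<^sub>\<alpha>\<close> from the same point
  on, and the added points then form an infinite decreasing sequence of ordinals.

  For part (2) one adds further points to the gaps of \<open>C\<close>.  The bounded subsets of \<open>\<kappa>\<close> have codes below
  \<open>\<kappa>\<close> since \<open>2\<^sup>\<lambda> = \<kappa>\<close>, and density reduces the \<open>\<lambda>\<close> many codes available at a point of \<open>C\<close> to \<open>\<theta>\<close> many, so
  that a diagonal argument of length \<open>\<lambda>\<close> in the style of Shelah's proof of diamond finds the right one.
  By club guessing there is \<open>\<epsilon> < \<kappa>\<close> such that \<open>min (C \<setminus> \<epsilon>)\<close> takes \<open>\<kappa>\<close> many values each of which still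
  guesses clubs; this ordinal tells every \<open>C\<close> which \<open>\<theta>\<close> and \<open>\<zeta>\<close> it has to serve.\<close>

section \<open>Closed unbounded sets in a successor cardinal\<close>

text \<open>Although points are added, the order type of a club cannot grow, because the
  accumulation points of the new club are among those of the old one. Hence \<xi> remains a bound,
  and a new club of type \<xi> comes from an old one of type \<xi>. Outside \<Gamma> nothing is
  changed: there the second alternative of coherence modulo \<chi> holds, which speaks of the larger
  club only. Points of countable cofinality lie in \<Gamma>, so every unbounded set has limit points
  in \<Gamma>; this is what allows a new thread to be pulled back. The set \<Theta> consists of the
  \<theta> of density \<lambda> for which \<Gamma> meets every club in a point of cofinality
  \<theta>. This can be in doubt only for \<theta> below \<chi>. As \<lambda> may be singular, the
  pigeonhole steps ask only for a fibre larger than a fixed cardinal below \<lambda>: \<omega> for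
  part (1) and \<theta> for part (2).\<close>

text \<open>Extending the order of \<open>\<kappa>\<close> to a well-order of the whole type makes the theory of the class
  \<open>wellorder\<close> available; \<open>\<kappa>\<close> becomes the initial segment \<open>F\<close> below.\<close>

lemma ex_wellorder_extending:
  fixes k :: "'k rel"
  assumes "Well_order k"
  obtains le lt where "class.wellorder le lt"
    "\<And>a b. a \<in> Field k \<Longrightarrow> lt b a \<longleftrightarrow> b \<in> underS k a"
proof -
  obtain w :: "'k rel" where "Well_order w \<and> Field w = UNIV"
    using well_ordering by (rule exE)
  then have w: "Well_order w" "Field w = UNIV" by blast+
  define F where "F = Field k"
  \<comment> \<open>Points of \<open>F\<close> come first, in the order of \<open>k\<close>; the
    other points of the type follow, in the order of \<open>w\<close>.\<close>
  define lt where "lt = (\<lambda>a b. if a \<in> F \<and> b \<in> F then (a, b) \<in> k \<and> a \<noteq> b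
     else if a \<in> F then True else if b \<in> F then False else (a, b) \<in> w \<and> a \<noteq> b)"
  define le where "le = (\<lambda>a b. lt a b \<or> a = b)"
  interpret k: wo_rel k using assms by (simp add: wo_rel_def)
  interpret w: wo_rel w using w(1) unfolding wo_rel_def .
  have tr: "lt a c" if "lt a b" "lt b c" for a b c
    using that transD[OF k.TRANS, of a b c] transD[OF w.TRANS, of a b c]
      antisymD[OF k.ANTISYM, of a b] antisymD[OF w.ANTISYM, of a b] unfolding lt_def
    by (auto split: if_splits)
  have irr: "\<not> lt a a" for a by (auto simp: lt_def)
  have tot: "lt a b \<or> a = b \<or> lt b a" for a b
    using k.TOTALS w.TOTALS w(2) by (auto simp: lt_def F_def)
  have least: "\<exists>m. P m \<and> (\<forall>y. P y \<longrightarrow> le m y)" if "P x" for P and x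
  proof (cases "\<exists>x\<in>F. P x")
    case True
    then have "k.isMinim {x\<in>F. P x} (k.minim {x\<in>F. P x})"
      by (intro k.minim_isMinim) (auto simp: F_def)
    then show ?thesis unfolding k.isMinim_def le_def lt_def by (intro exI[of _ "k.minim {x\<in>F. P x}"]) auto
  next
    case False
    then have "w.isMinim {x. P x} (w.minim {x. P x})"
      using that by (intro w.minim_isMinim) (auto simp: w)
    then show ?thesis using False unfolding w.isMinim_def le_def lt_def
      by (intro exI[of _ "w.minim {x. P x}"]) auto
  qed
  have "class.wellorder le lt"
  proof unfold_locales
    fix a b c
    show "lt a b = (le a b \<and> \<not> le b a)" using tr irr unfolding le_def by blast
    show "le a a" by (simp add: le_def)
    show "le a b \<Longrightarrow> le b c \<Longrightarrow> le a c" using tr unfolding le_def by blast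
    show "le a b \<Longrightarrow> le b a \<Longrightarrow> a = b" using tr irr unfolding le_def by blast
    show "le a b \<or> le b a" using tot unfolding le_def by blast
  next
    fix P and a :: 'k
    assume step: "\<And>x. (\<And>y. lt y x \<Longrightarrow> P y) \<Longrightarrow> P x"
    show "P a"
    proof (rule ccontr)
      assume "\<not> P a"
      then obtain m where "\<not> P m" "\<forall>y. \<not> P y \<longrightarrow> le m y" using least[of "\<lambda>x. \<not> P x"] by blast
      then show False using step[of m] irr tr unfolding le_def by blast
    qed
  qed
  moreover have "lt b a \<longleftrightarrow> b \<in> underS k a" if "a \<in> Field k" for a b
    using that unfolding lt_def F_def underS_def by (auto simp: Field_def)
  ultimately show thesis by (rule that)
qed

text \<open>The set \<open>F\<close> stands for \<open>\<lambda>\<^sup>+\<close>: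
  \<open>small\<close> bounds its initial segments and \<open>bdd\<close> expresses its regularity.
  No regularity of \<lambda> is assumed.\<close>

locale succ_card = wellorder le lt
  for le :: "'k \<Rightarrow> 'k \<Rightarrow> bool" (infix "\<preceq>" 50) and lt (infix "\<prec>" 50) +
  fixes F :: "'k set" and lam :: "'l rel"
  assumes F_down: "a \<in> F \<Longrightarrow> b \<prec> a \<Longrightarrow> b \<in> F"
    and lam_card: "Card_order lam" and lam_uncountable: "natLeq <o lam"
    and small: "a \<in> F \<Longrightarrow> |{b. b \<prec> a}| \<le>o lam"
    and bdd: "X \<subseteq> F \<Longrightarrow> |X| \<le>o lam \<Longrightarrow> \<exists>b\<in>F. \<forall>x\<in>X. x \<prec> b"
begin

abbreviation below :: "'k \<Rightarrow> 'k set" where "below a \<equiv> {b. b \<prec> a}"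

text \<open>The first conjunct excludes zero, for which the second one holds vacuously. The point
  \<open>a\<close> need not belong to \<open>A\<close>.\<close>

definition limpt :: "'k set \<Rightarrow> 'k \<Rightarrow> bool" where
  "limpt A a \<longleftrightarrow> (\<exists>b. b \<prec> a) \<and> (\<forall>b. b \<prec> a \<longrightarrow> (\<exists>c\<in>A. b \<prec> c \<and> c \<prec> a))"

definition Acc :: "'k set \<Rightarrow> 'k set" where "Acc C = {a \<in> C. limpt C a}"

definition club :: "'k set \<Rightarrow> 'k \<Rightarrow> bool" where
  "club C a \<longleftrightarrow> C \<subseteq> below a \<and> limpt C a \<and> (\<forall>b. b \<prec> a \<and> limpt C b \<longrightarrow> b \<in> C)"

definition Club :: "'k set \<Rightarrow> bool" where
  "Club E \<longleftrightarrow> E \<subseteq> F \<and> (\<forall>b\<in>F. \<exists>e\<in>E. b \<prec> e) \<and> (\<forall>a\<in>F. limpt E a \<longrightarrow> a \<in> E)"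

text \<open>Every club contains such a set of closure points, so that intersections and diagonal
  intersections of clubs reduce to pointwise bounds for functions.\<close>

definition Cl :: "('k \<Rightarrow> 'k) \<Rightarrow> 'k set" where
  "Cl g = {e \<in> F. limpt UNIV e \<and> (\<forall>b. b \<prec> e \<longrightarrow> g b \<prec> e)}"

definition minel :: "'k set \<Rightarrow> 'k" where "minel X = (THE m. m \<in> X \<and> (\<forall>y\<in>X. m \<preceq> y))"

lemma ex_minel: "x \<in> X \<Longrightarrow> \<exists>m. m \<in> X \<and> (\<forall>y\<in>X. m \<preceq> y)"
proof (induction x rule: less_induct)
  case (less x)
  show ?case
  proof (cases "\<exists>y\<in>X. y \<prec> x")
    case True then show ?thesis using less by blast
  next
    case False then show ?thesis using less.prems not_less by blast
  qed
qed

lemma minel_eqI: "m \<in> X \<Longrightarrow> (\<And>y. y \<in> X \<Longrightarrow> m \<preceq> y) \<Longrightarrow> minel X = m"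
  unfolding minel_def by (rule the_equality) (auto intro: order.antisym)

lemma minel_in: "X \<noteq> {} \<Longrightarrow> minel X \<in> X"
  using ex_minel minel_eqI by (metis ex_in_conv)

lemma minel_le: "y \<in> X \<Longrightarrow> minel X \<preceq> y"
  using ex_minel minel_eqI by metis

lemma limpt_mono: "limpt A a \<Longrightarrow> A \<inter> below a \<subseteq> B \<Longrightarrow> limpt B a"
  unfolding limpt_def by blast

lemma limpt_Int_below: "a \<preceq> b \<Longrightarrow> limpt (A \<inter> below b) a \<longleftrightarrow> limpt A a"
  unfolding limpt_def by (metis Int_iff mem_Collect_eq less_le_trans)

lemma limptD: "limpt A a \<Longrightarrow> b \<prec> a \<Longrightarrow> \<exists>c\<in>A. b \<prec> c \<and> c \<prec> a"
  by (simp add: limpt_def)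

lemma limpt_ne: "limpt A a \<Longrightarrow> \<exists>c\<in>A. c \<prec> a"
  unfolding limpt_def by blast

lemma lam_Cinfinite: "Cinfinite lam"
  using lam_card lam_uncountable natLeq_ordLeq_cinfinite cinfinite_mono natLeq_cinfinite
  by (metis ordLess_imp_ordLeq)

lemma countable_le_lam: "|range (f :: nat \<Rightarrow> 'x)| \<le>o lam"
proof -
  have "|range f| \<le>o |UNIV :: nat set|" by (rule card_of_image)
  also have "|UNIV :: nat set| =o natLeq" by (rule card_of_nat)
  also have "natLeq \<le>o lam" using lam_uncountable ordLess_imp_ordLeq by blast
  finally show ?thesis .
qed

lemma finite_le_lam: "finite X \<Longrightarrow> |X| \<le>o lam"
  using lam_Cinfinite by (metis card_of_Well_order cinfinite_def Field_card_of finite_ordLess_infinite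
      ordLess_imp_ordLeq card_order_on_well_order_on)

lemma bdd_image:
  assumes "|I| \<le>o lam" "\<And>i. i \<in> I \<Longrightarrow> g i \<in> F"
  shows "\<exists>b\<in>F. \<forall>i\<in>I. g i \<prec> b"
  using bdd[of "g ` I"] assms(2) ordLeq_transitive[OF card_of_image assms(1)] by blast

lemma ex_greater: "a \<in> F \<Longrightarrow> \<exists>b\<in>F. a \<prec> b"
  using bdd[of "{a}"] finite_le_lam[of "{a}"] by auto

lemma F_le: "a \<in> F \<Longrightarrow> b \<preceq> a \<Longrightarrow> b \<in> F"
  using F_down le_less by blast

lemma small_le: "a \<in> F \<Longrightarrow> |{b. b \<preceq> a}| \<le>o lam"
proof -
  assume "a \<in> F"
  then obtain b where b: "b \<in> F" "a \<prec> b" using ex_greater by blast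
  have "{c. c \<preceq> a} \<subseteq> below b" using b by (auto intro: le_less_trans)
  then show ?thesis by (rule ordLeq_transitive[OF card_of_mono1 small[OF b(1)]])
qed

lemma ex_least_upper:
  assumes "X \<subseteq> F" "|X| \<le>o lam"
  obtains s where "s \<in> F" "\<And>x. x \<in> X \<Longrightarrow> x \<prec> s" "\<And>b. b \<prec> s \<Longrightarrow> \<exists>x\<in>X. b \<preceq> x"
proof -
  let ?U = "{b\<in>F. \<forall>x\<in>X. x \<prec> b}"
  have ne: "?U \<noteq> {}" using bdd[OF assms] by blast
  have 1: "minel ?U \<in> ?U" by (rule minel_in[OF ne])
  have "\<exists>x\<in>X. b \<preceq> x" if "b \<prec> minel ?U" for b
  proof (rule ccontr)
    assume "\<not> ?thesis"
    then have "b \<in> ?U" using that 1 F_down by (auto simp: not_le)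
    then have "minel ?U \<preceq> b" by (rule minel_le)
    then show False using that by order
  qed
  then show thesis using 1 that by blast
qed

lemma ex_sup_limpt:
  assumes "X \<subseteq> F" "|X| \<le>o lam" "X \<noteq> {}" "\<And>x. x \<in> X \<Longrightarrow> \<exists>y\<in>X. x \<prec> y"
  obtains s where "s \<in> F" "\<And>x. x \<in> X \<Longrightarrow> x \<prec> s" "limpt X s"
proof -
  obtain s where s: "s \<in> F" "\<And>x. x \<in> X \<Longrightarrow> x \<prec> s" "\<And>b. b \<prec> s \<Longrightarrow> \<exists>x\<in>X. b \<preceq> x"
    using ex_least_upper[OF assms(1,2)] by blast
  have "limpt X s"
    unfolding limpt_def using s assms(3,4) by (meson le_less_trans ex_in_conv)
  then show thesis using s that by blast
qed

text \<open>Bounding the values at all \<open>x\<close> up to \<open>b\<close> makes this the step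
  of a climb whose limit is closed under \<open>g\<close>, without any monotonicity of
  \<open>g\<close>.\<close>

definition bnd :: "('k \<Rightarrow> 'k) \<Rightarrow> 'k \<Rightarrow> 'k" where
  "bnd g b = (SOME c. c \<in> F \<and> b \<prec> c \<and> (\<forall>x. x \<preceq> b \<longrightarrow> g x \<prec> c))"

lemma bnd:
  assumes "\<forall>x\<in>F. g x \<in> F" "b \<in> F"
  shows "bnd g b \<in> F" "b \<prec> bnd g b" "x \<preceq> b \<Longrightarrow> g x \<prec> bnd g b"
proof -
  let ?X = "insert b (g ` {x. x \<preceq> b})"
  have "|g ` {x. x \<preceq> b}| \<le>o lam" by (rule ordLeq_transitive[OF card_of_image small_le[OF assms(2)]])
  then have "|?X| \<le>o lam"
    using Un_Cinfinite_bound[OF finite_le_lam[of "{b}"] _ lam_Cinfinite] by simp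
  moreover have "?X \<subseteq> F" using assms F_le by auto
  ultimately have "\<exists>c. c \<in> F \<and> b \<prec> c \<and> (\<forall>x. x \<preceq> b \<longrightarrow> g x \<prec> c)" using bdd[of ?X] by auto
  from someI_ex[OF this]
  show "bnd g b \<in> F" "b \<prec> bnd g b" "x \<preceq> b \<Longrightarrow> g x \<prec> bnd g b" by (auto simp: bnd_def)
qed

lemma Cl_unbounded:
  assumes g: "\<forall>x\<in>F. g x \<in> F" and b: "b \<in> F"
  obtains e where "e \<in> Cl g" "b \<prec> e"
proof -
  define s where "s n = (bnd g ^^ n) b" for n
  have sF: "s n \<in> F" for n by (induction n) (auto simp: s_def b bnd[OF g])
  have s_less: "s n \<prec> s (Suc n)" for n using bnd(2)[OF g sF[of n]] by (simp add: s_def)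
  have "\<exists>e. e \<in> F \<and> (\<forall>x\<in>range s. x \<prec> e) \<and> limpt (range s) e"
    by (rule ex_sup_limpt[of "range s"]) (use sF s_less countable_le_lam in blast)+
  then obtain e where e: "e \<in> F" "\<And>n. s n \<prec> e" "limpt (range s) e" by auto
  have "g x \<prec> e" if x: "x \<prec> e" for x
  proof -
    obtain n where n: "x \<prec> s n" using limptD[OF e(3) x] by blast
    then have "g x \<prec> s (Suc n)" using bnd(3)[OF g sF[of n], of x] n by (simp add: s_def)
    then show ?thesis using e(2)[of "Suc n"] by order
  qed
  then have "e \<in> Cl g" using e limpt_mono[OF e(3)] by (auto simp: Cl_def)
  then show thesis using that e(2)[of 0] by (simp add: s_def)
qed

lemma Cl_subset_F: "Cl g \<subseteq> F"
  by (auto simp: Cl_def)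

lemma Club_Cl:
  assumes g: "\<forall>x\<in>F. g x \<in> F"
  shows "Club (Cl g)"
  unfolding Club_def
proof (intro conjI ballI impI)
  show "Cl g \<subseteq> F" by (auto simp: Cl_def)
  show "\<exists>e\<in>Cl g. b \<prec> e" if "b \<in> F" for b by (rule Cl_unbounded[OF g that]) blast+
  fix a assume a: "a \<in> F" "limpt (Cl g) a"
  have "g b \<prec> a" if "b \<prec> a" for b
  proof -
    obtain c where "c \<in> Cl g" "b \<prec> c" "c \<prec> a" using limptD[OF a(2) \<open>b \<prec> a\<close>] by blast
    then show ?thesis by (auto simp: Cl_def intro: less_trans)
  qed
  then show "a \<in> Cl g" using a limpt_mono[OF a(2)] by (auto simp: Cl_def)
qed

lemma Cl_subset_Club:
  assumes "Club E"
  obtains g where "\<forall>x\<in>F. g x \<in> F" "Cl g \<subseteq> E" "\<And>e. e \<in> Cl g \<Longrightarrow> limpt E e"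
proof -
  have "\<exists>g. \<forall>x\<in>F. g x \<in> E \<and> x \<prec> g x" using assms unfolding Club_def by metis
  then obtain g where g: "\<And>x. x \<in> F \<Longrightarrow> g x \<in> E" "\<And>x. x \<in> F \<Longrightarrow> x \<prec> g x" by blast
  have E: "E \<subseteq> F" using assms by (simp add: Club_def)
  have lim: "limpt E e" if "e \<in> Cl g" for e
    using that g E F_down unfolding Cl_def limpt_def by blast
  have "Cl g \<subseteq> E" using lim assms unfolding Club_def Cl_def by blast
  show thesis by (rule that[of g]) (use g E lim \<open>Cl g \<subseteq> E\<close> in blast)+
qed

lemma Cl_common:
  assumes g: "\<forall>i\<in>I. \<forall>x\<in>F. g i x \<in> F" and I: "|I| \<le>o lam"
  shows "\<exists>h. (\<forall>x\<in>F. h x \<in> F) \<and> (\<forall>i\<in>I. Cl h \<subseteq> Cl (g i))"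
proof -
  have "\<exists>b\<in>F. \<forall>i\<in>I. g i x \<prec> b" if "x \<in> F" for x
    using bdd_image[OF I, of "\<lambda>i. g i x"] g that by blast
  then obtain h where h: "\<forall>x\<in>F. h x \<in> F" "\<And>x i. x \<in> F \<Longrightarrow> i \<in> I \<Longrightarrow> g i x \<prec> h x"
    using bchoice[of F "\<lambda>x b. b \<in> F \<and> (\<forall>i\<in>I. g i x \<prec> b)"] by blast
  have "Cl h \<subseteq> Cl (g i)" if "i \<in> I" for i
    using h that F_down unfolding Cl_def by (blast intro: less_trans)
  then show ?thesis using h(1) by blast
qed

text \<open>The value \<open>h x\<close> is chosen above the at most \<lambda> values
  \<open>g i y\<close> with \<open>i\<close> and \<open>y\<close> at most \<open>x\<close>. For
  \<open>i\<close> and \<open>b\<close> below a closure point \<open>e\<close> of \<open>h\<close>,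
  the value of \<open>h\<close> at the larger of the two separates \<open>g i b\<close> from
  \<open>e\<close>.\<close>

lemma Cl_diagonal:
  assumes g: "\<forall>i\<in>F. \<forall>x\<in>F. g i x \<in> F"
  shows "\<exists>h. (\<forall>x\<in>F. h x \<in> F) \<and> (\<forall>e\<in>Cl h. \<forall>i. i \<prec> e \<longrightarrow> e \<in> Cl (g i))"
proof -
  have "\<exists>b\<in>F. \<forall>i. i \<preceq> x \<longrightarrow> (\<forall>y. y \<preceq> x \<longrightarrow> g i y \<prec> b)" if x: "x \<in> F" for x
  proof -
    let ?X = "(\<lambda>(i,y). g i y) ` ({i. i \<preceq> x} \<times> {i. i \<preceq> x})"
    have "|{i. i \<preceq> x} \<times> {i. i \<preceq> x}| \<le>o lam"
      using card_of_Times_ordLeq_infinite_Field[of lam] lam_Cinfinite small_le[OF x]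
      by (simp add: cinfinite_def)
    then have "|?X| \<le>o lam" by (rule ordLeq_transitive[OF card_of_image])
    moreover have "?X \<subseteq> F" using g F_le[OF x] by auto
    ultimately have "\<exists>b\<in>F. \<forall>z\<in>?X. z \<prec> b" by (intro bdd)
    then obtain b where "b \<in> F" "\<forall>z\<in>?X. z \<prec> b" by blast
    then show ?thesis by (intro bexI[of _ b]) auto
  qed
  then have "\<exists>h. \<forall>x\<in>F. h x \<in> F \<and> (\<forall>i. i \<preceq> x \<longrightarrow> (\<forall>y. y \<preceq> x \<longrightarrow> g i y \<prec> h x))"
    by (intro bchoice ballI) (simp add: Bex_def)
  then obtain h where h: "\<forall>x\<in>F. h x \<in> F"
    "\<And>x i y. x \<in> F \<Longrightarrow> i \<preceq> x \<Longrightarrow> y \<preceq> x \<Longrightarrow> g i y \<prec> h x" by blast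
  have "e \<in> Cl (g i)" if e: "e \<in> Cl h" and i: "i \<prec> e" for i e
  proof -
    have "g i b \<prec> e" if b: "b \<prec> e" for b
    proof -
      define m where "m = (if i \<preceq> b then b else i)"
      have "m \<prec> e" "i \<preceq> m" "b \<preceq> m" using b i by (auto simp: m_def)
      moreover from this have "m \<in> F" using e F_down by (auto simp: Cl_def)
      ultimately have "g i b \<prec> h m" "h m \<prec> e" using h(2) e by (auto simp: Cl_def)
      then show ?thesis by order
    qed
    then show ?thesis using e by (auto simp: Cl_def)
  qed
  then show ?thesis using h(1) by blast
qed

lemma Club_Inter:
  assumes "\<And>i. i \<in> I \<Longrightarrow> Club (E i)" "|I| \<le>o lam"
  shows "Club (F \<inter> (\<Inter>i\<in>I. E i))"
proof -
  have "\<forall>i\<in>I. \<exists>g. (\<forall>x\<in>F. g x \<in> F) \<and> Cl g \<subseteq> E i"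
  proof
    fix i assume "i \<in> I"
    obtain g where "\<forall>x\<in>F. g x \<in> F" "Cl g \<subseteq> E i"
      by (rule Cl_subset_Club[OF assms(1)[OF \<open>i \<in> I\<close>]])
    then show "\<exists>g. (\<forall>x\<in>F. g x \<in> F) \<and> Cl g \<subseteq> E i" by blast
  qed
  then have "\<exists>g. \<forall>i\<in>I. (\<forall>x\<in>F. g i x \<in> F) \<and> Cl (g i) \<subseteq> E i" by (rule bchoice)
  then obtain g where g: "\<forall>i\<in>I. \<forall>x\<in>F. g i x \<in> F" "\<And>i. i \<in> I \<Longrightarrow> Cl (g i) \<subseteq> E i" by blast
  obtain h where h: "\<forall>x\<in>F. h x \<in> F" "\<forall>i\<in>I. Cl h \<subseteq> Cl (g i)"
    using Cl_common[OF g(1) assms(2)] by blast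
  have sub: "Cl h \<subseteq> F \<inter> (\<Inter>i\<in>I. E i)" using h(2) g(2) Cl_subset_F[of h] by blast
  show ?thesis unfolding Club_def
  proof (intro conjI ballI impI)
    show "F \<inter> (\<Inter>i\<in>I. E i) \<subseteq> F" by blast
    show "\<exists>e\<in>F \<inter> (\<Inter>i\<in>I. E i). b \<prec> e" if "b \<in> F" for b
      by (rule Cl_unbounded[OF h(1) that]) (use sub in blast)+
    fix a assume a: "a \<in> F" "limpt (F \<inter> (\<Inter>i\<in>I. E i)) a"
    then have "a \<in> E i" if "i \<in> I" for i
      using assms(1)[OF that] limpt_mono[OF a(2), of "E i"] that unfolding Club_def by blast
    then show "a \<in> F \<inter> (\<Inter>i\<in>I. E i)" using a by blast
  qed
qed

end

section \<open>Trees with few nodes on each level\<close>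

context succ_card
begin

definition unbounded :: "'k set \<Rightarrow> bool" where
  "unbounded S \<longleftrightarrow> S \<subseteq> F \<and> (\<forall>b\<in>F. \<exists>s\<in>S. b \<prec> s)"

lemma sup_limpt:
  assumes "X \<noteq> {}" "\<And>x. x \<in> X \<Longrightarrow> x \<prec> u" "\<And>x. x \<in> X \<Longrightarrow> \<exists>y\<in>X. x \<prec> y"
  obtains s where "s \<preceq> u" "\<And>x. x \<in> X \<Longrightarrow> x \<prec> s" "limpt X s"
proof -
  let ?U = "{s. \<forall>x\<in>X. x \<prec> s}"
  have "u \<in> ?U" using assms(2) by blast
  then have 1: "minel ?U \<in> ?U" "minel ?U \<preceq> u" using minel_in[of ?U] minel_le[of u ?U] by blast+
  have "limpt X (minel ?U)"
    unfolding limpt_def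
  proof (intro conjI allI impI)
    show "\<exists>b. b \<prec> minel ?U" using 1(1) assms(1) by blast
    fix b assume b: "b \<prec> minel ?U"
    then have "b \<notin> ?U" using minel_le[of b ?U] not_less by blast
    then obtain x where "x \<in> X" "b \<preceq> x" by (auto simp: not_less)
    then obtain y where "y \<in> X" "b \<prec> y" using assms(3) le_less_trans by blast
    then show "\<exists>c\<in>X. b \<prec> c \<and> c \<prec> minel ?U" using 1(1) by blast
  qed
  then show thesis using that 1 by blast
qed

text \<open>If there is no cofinal branch, then every node with extensions on all levels splits into two
  such nodes.  So a fixed node on a level above \<open>\<lambda>\<close> many splitting levels is left at each of them by
  a different node of its own level, which makes that level too large.\<close>

lemma branch:
  assumes S: "unbounded S"
    and ne: "\<And>a. a \<in> S \<Longrightarrow> L a \<noteq> {}" and few: "\<And>a. a \<in> S \<Longrightarrow> |L a| <o lam"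
    and sub: "\<And>a C. a \<in> S \<Longrightarrow> C \<in> L a \<Longrightarrow> C \<subseteq> below a"
    and coh: "\<And>a b C. a \<in> S \<Longrightarrow> b \<in> S \<Longrightarrow> b \<prec> a \<Longrightarrow> C \<in> L a \<Longrightarrow> C \<inter> below b \<in> L b"
  obtains B where "\<And>a. a \<in> S \<Longrightarrow> B \<inter> below a \<in> L a"
proof -
  define big where "big a x \<longleftrightarrow> x \<in> L a \<and> (\<forall>b\<in>S. a \<prec> b \<longrightarrow> (\<exists>y\<in>L b. y \<inter> below a = x))" for a x
  have SF: "S \<subseteq> F" using S by (simp add: unbounded_def)
  have few_le: "|L a| \<le>o lam" if "a \<in> S" for a using few[OF that] ordLess_imp_ordLeq by blast
  have shrink: "x \<inter> below a \<inter> below b = x \<inter> below b" if "b \<preceq> a" for x a b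
    using that by (auto intro: less_le_trans)
  have self: "x \<inter> below a = x" if "a \<in> S" "x \<in> L a" for x a using sub[OF that] by blast
  have coh': "C \<inter> below b \<in> L b" if "a \<in> S" "b \<in> S" "b \<preceq> a" "C \<in> L a" for a b C
    using coh that self le_less by metis
  \<comment> \<open>Level \<open>b\<close> has fewer than \<lambda> nodes, so one level
    \<open>c\<close> lies above all levels at which its nodes that are not \<open>big\<close> have
    died out.\<close>
  have level: "\<exists>c\<in>S. b \<prec> c \<and> (\<forall>y\<in>L b. \<not> big b y \<longrightarrow> (\<forall>w\<in>L c. w \<inter> below b \<noteq> y))" if b: "b \<in> S" for b
  proof -
    have "\<forall>y\<in>{y \<in> L b. \<not> big b y}. \<exists>c. c \<in> S \<and> b \<prec> c \<and> (\<forall>w\<in>L c. w \<inter> below b \<noteq> y)"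
      by (auto simp: big_def)
    from bchoice[OF this] obtain c
      where c: "\<forall>y\<in>{y \<in> L b. \<not> big b y}. c y \<in> S \<and> b \<prec> c y \<and> (\<forall>w\<in>L (c y). w \<inter> below b \<noteq> y)" ..
    have "\<exists>d\<in>F. \<forall>y\<in>{y \<in> L b. \<not> big b y}. c y \<prec> d"
    proof (rule bdd_image)
      have "|{y \<in> L b. \<not> big b y}| \<le>o |L b|" by (rule card_of_mono1) blast
      then show "|{y \<in> L b. \<not> big b y}| \<le>o lam" using few_le[OF b] by (rule ordLeq_transitive)
      show "c y \<in> F" if "y \<in> {y \<in> L b. \<not> big b y}" for y using c that SF by blast
    qed
    then obtain d where d: "d \<in> F" "\<And>y. y \<in> L b \<Longrightarrow> \<not> big b y \<Longrightarrow> c y \<prec> d" by auto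
    define m where "m = (if d \<prec> b then b else d)"
    have m: "m \<in> F" "b \<preceq> m" "d \<preceq> m" using d(1) b SF by (auto simp: m_def not_less less_imp_le)
    then obtain s where s: "s \<in> S" "m \<prec> s" using S unfolding unbounded_def by blast
    show ?thesis
    proof (intro bexI[of _ s] conjI ballI impI)
      show "b \<prec> s" using m s by order
      fix y w assume y: "y \<in> L b" "\<not> big b y" and w: "w \<in> L s"
      have cy: "c y \<in> S" "b \<prec> c y" "\<forall>w\<in>L (c y). w \<inter> below b \<noteq> y" using c y by auto
      have cs: "c y \<preceq> s" using d(2)[OF y] m s by order
      have "w \<inter> below (c y) \<in> L (c y)" using coh'[OF s(1) cy(1) cs w] .
      then have "w \<inter> below (c y) \<inter> below b \<noteq> y" using cy(3) by blast
      then show "w \<inter> below b \<noteq> y" using shrink[of b "c y" w] cy(2) by (simp add: less_imp_le)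
    qed (use s in auto)
  qed
  have ext: "\<exists>y. big b y \<and> y \<inter> below a = x" if a: "a \<in> S" and b: "b \<in> S" and ab: "a \<preceq> b" and x: "big a x" for a b x
  proof (cases "a = b")
    case True then show ?thesis using x self[OF a] by (auto simp: big_def)
  next
    case False
    obtain c where c: "c \<in> S" "b \<prec> c" "\<forall>y\<in>L b. \<not> big b y \<longrightarrow> (\<forall>w\<in>L c. w \<inter> below b \<noteq> y)"
      using level[OF b] by blast
    have "a \<prec> c" using ab c by order
    then obtain w where w: "w \<in> L c" "w \<inter> below a = x" using x c unfolding big_def by blast
    have "w \<inter> below b \<in> L b" using coh[OF c(1) b c(2) w(1)] .
    then have "big b (w \<inter> below b)" using c(3) w(1) by blast
    then show ?thesis using w shrink[OF ab, of w] by (intro exI[of _ "w \<inter> below b"]) simp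
  qed
  have some: "\<exists>x. big a x" if a: "a \<in> S" for a
  proof -
    obtain c where c: "c \<in> S" "a \<prec> c" "\<forall>y\<in>L a. \<not> big a y \<longrightarrow> (\<forall>w\<in>L c. w \<inter> below a \<noteq> y)"
      using level[OF a] by blast
    obtain w where w: "w \<in> L c" using ne[OF c(1)] by blast
    show ?thesis using coh[OF c(1) a c(2) w] c(3) w by blast
  qed
  have down: "big b (y \<inter> below b)" if a: "a \<in> S" and b: "b \<in> S" and ba: "b \<preceq> a" and y: "big a y" for a b y
    unfolding big_def
  proof (intro conjI ballI impI)
    have yL: "y \<in> L a" using y by (simp add: big_def)
    show "y \<inter> below b \<in> L b" using coh'[OF a b ba yL] .
    fix c assume c: "c \<in> S" "b \<prec> c"
    show "\<exists>w\<in>L c. w \<inter> below b = y \<inter> below b"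
    proof (cases "c \<preceq> a")
      case True
      then show ?thesis using coh'[OF a c(1) True yL] shrink[of b c y] c(2)
        by (intro bexI[of _ "y \<inter> below c"]) (simp_all add: less_imp_le)
    next
      case False
      then obtain w where "w \<in> L c" "w \<inter> below a = y" using y c(1) unfolding big_def by (auto simp: not_le)
      then show ?thesis using shrink[OF ba, of w] by (intro bexI[of _ w]) simp_all
    qed
  qed
  \<comment> \<open>This says that the \<open>big\<close> nodes above \<open>x\<close> do not split.
    If it holds for some \<open>big\<close> node, the union of its extensions is the branch;
    otherwise every \<open>big\<close> node splits.\<close>
  define solo where "solo a x \<longleftrightarrow> (\<forall>b\<in>S. a \<preceq> b \<longrightarrow>
      (\<forall>y y'. big b y \<longrightarrow> big b y' \<longrightarrow> y \<inter> below a = x \<longrightarrow> y' \<inter> below a = x \<longrightarrow> y = y'))" for a x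
  show thesis
  proof (cases "\<exists>a\<in>S. \<exists>x. big a x \<and> solo a x")
    case True
    then obtain a x where a: "a \<in> S" and x: "big a x" and solo: "solo a x" by blast
    have uni: "y = y'" if "b \<in> S" "a \<preceq> b" "big b y" "big b y'" "y \<inter> below a = x" "y' \<inter> below a = x" for b y y'
      using solo that unfolding solo_def by blast
    have "\<forall>b\<in>{b\<in>S. a \<preceq> b}. \<exists>y. big b y \<and> y \<inter> below a = x" using ext[OF a _ _ x] by blast
    then have "\<exists>Y. \<forall>b\<in>{b\<in>S. a \<preceq> b}. big b (Y b) \<and> Y b \<inter> below a = x" by (rule bchoice)
    then obtain Y where Y: "\<And>b. b \<in> S \<Longrightarrow> a \<preceq> b \<Longrightarrow> big b (Y b)" "\<And>b. b \<in> S \<Longrightarrow> a \<preceq> b \<Longrightarrow> Y b \<inter> below a = x"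
      by blast
    have YY: "Y c \<inter> below b = Y b" if "b \<in> S" "c \<in> S" "a \<preceq> b" "b \<preceq> c" for b c
    proof -
      have ac: "a \<preceq> c" using that by order
      have "big b (Y c \<inter> below b)" by (rule down[OF that(2,1,4) Y(1)[OF that(2) ac]])
      moreover have "Y c \<inter> below b \<inter> below a = x" using shrink[OF that(3)] Y(2)[OF that(2) ac] by simp
      ultimately show ?thesis using uni[OF that(1,3) _ Y(1)[OF that(1,3)]] Y(2)[OF that(1,3)] by blast
    qed
    define B where "B = (\<Union>b\<in>{b\<in>S. a \<preceq> b}. Y b)"
    have B: "B \<inter> below b = Y b" if b: "b \<in> S" "a \<preceq> b" for b
    proof
      show "Y b \<subseteq> B \<inter> below b" using b sub[OF b(1)] Y(1)[OF b] by (auto simp: B_def big_def)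
      show "B \<inter> below b \<subseteq> Y b"
      proof
        fix z assume "z \<in> B \<inter> below b"
        then obtain c where c: "c \<in> S" "a \<preceq> c" "z \<in> Y c" "z \<prec> b" by (auto simp: B_def)
        show "z \<in> Y b"
        proof (cases "b \<preceq> c")
          case True then show ?thesis using YY[OF b(1) c(1) b(2)] c by blast
        next
          case False
          then have "c \<preceq> b" by order
          then show ?thesis using YY[OF c(1) b(1) c(2)] c(3) by blast
        qed
      qed
    qed
    have "B \<inter> below c \<in> L c" if c: "c \<in> S" for c
    proof (cases "a \<preceq> c")
      case True then show ?thesis using B[OF c True] Y(1)[OF c True] by (simp add: big_def)
    next
      case False
      then have ca: "c \<preceq> a" by order
      then have "B \<inter> below c = Y a \<inter> below c" using B[OF a] shrink[OF ca, of B] by simp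
      then show ?thesis using coh'[OF a c ca] Y(1)[OF a] by (simp add: big_def)
    qed
    then show thesis by (rule that)
  next
    case False
    \<comment> \<open>As level \<open>a\<close> has fewer than \<lambda> nodes, one height
      \<open>h a\<close> lies above a splitting of each of its \<open>big\<close> nodes.\<close>
    have "\<exists>h\<in>F. \<forall>x\<in>{x \<in> L a. big a x}. \<exists>b\<in>S. \<exists>y y'. a \<preceq> b \<and> b \<prec> h \<and> big b y \<and> big b y' \<and>
       y \<inter> below a = x \<and> y' \<inter> below a = x \<and> y \<noteq> y'" if a: "a \<in> S" for a
    proof -
      have "\<forall>x\<in>{x \<in> L a. big a x}. \<exists>b. b \<in> S \<and> (\<exists>y y'. a \<preceq> b \<and> big b y \<and> big b y' \<and>
         y \<inter> below a = x \<and> y' \<inter> below a = x \<and> y \<noteq> y')"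
        using False a unfolding solo_def by blast
      from bchoice[OF this] obtain b where b: "\<forall>x\<in>{x \<in> L a. big a x}. b x \<in> S \<and> (\<exists>y y'. a \<preceq> b x \<and> big (b x) y \<and> big (b x) y' \<and>
         y \<inter> below a = x \<and> y' \<inter> below a = x \<and> y \<noteq> y')" by blast
      have "\<exists>d\<in>F. \<forall>x\<in>{x \<in> L a. big a x}. b x \<prec> d"
      proof (rule bdd_image)
        have "|{x \<in> L a. big a x}| \<le>o |L a|" by (rule card_of_mono1) blast
        then show "|{x \<in> L a. big a x}| \<le>o lam" using few_le[OF a] by (rule ordLeq_transitive)
        show "b y \<in> F" if "y \<in> {x \<in> L a. big a x}" for y using b that SF by blast
      qed
      then show ?thesis using b by meson
    qed
    then have "\<exists>h. \<forall>a\<in>S. h a \<in> F \<and> (\<forall>x\<in>{x \<in> L a. big a x}. \<exists>b\<in>S. \<exists>y y'. a \<preceq> b \<and> b \<prec> h a \<and> big b y \<and> big b y' \<and>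
       y \<inter> below a = x \<and> y' \<inter> below a = x \<and> y \<noteq> y')"
      by (intro bchoice ballI) (simp add: Bex_def)
    then obtain h where hh: "\<forall>a\<in>S. h a \<in> F \<and> (\<forall>x\<in>{x \<in> L a. big a x}. \<exists>b\<in>S. \<exists>y y'. a \<preceq> b \<and> b \<prec> h a \<and> big b y \<and> big b y' \<and>
       y \<inter> below a = x \<and> y' \<inter> below a = x \<and> y \<noteq> y')" ..
    have h: "\<And>a. a \<in> S \<Longrightarrow> h a \<in> F" "\<And>a x. a \<in> S \<Longrightarrow> big a x \<Longrightarrow> \<exists>b\<in>S. \<exists>y y'. a \<preceq> b \<and> b \<prec> h a \<and> big b y \<and> big b y' \<and>
       y \<inter> below a = x \<and> y' \<inter> below a = x \<and> y \<noteq> y'" using hh by (simp_all add: big_def)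
    define s where "s b = minel {s \<in> S. b \<prec> s}" for b
    have s: "s b \<in> S" "b \<prec> s b" if "b \<in> F" for b
      using minel_in[of "{s \<in> S. b \<prec> s}"] S that by (auto simp: s_def unbounded_def)
    have hsF: "\<forall>b\<in>F. h (s b) \<in> F" using h(1) s(1) by blast
    let ?D = "Cl (\<lambda>b. h (s b))"
    have DF: "?D \<subseteq> F" by (auto simp: Cl_def)
    have "\<not> |?D| \<le>o lam"
    proof
      assume "|?D| \<le>o lam"
      then obtain b where "b \<in> F" "\<forall>x\<in>?D. x \<prec> b" using bdd[OF DF] by blast
      moreover obtain e where "e \<in> ?D" "b \<prec> e" by (rule Cl_unbounded[OF hsF \<open>b \<in> F\<close>])
      ultimately show False by force
    qed
    then have "lam \<le>o |?D|"
      using lam_card ordLeq_total[of lam "|?D|"] card_of_Well_order card_order_on_well_order_on by blast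
    then have "|Field lam| \<le>o |?D|" using lam_card card_of_Field_ordIso ordIso_ordLeq_trans by blast
    \<comment> \<open>Only \<lambda> of the closure points are kept. They are then bounded, and one
      level \<open>t\<close> lies above them all.\<close>
    then obtain f where f: "inj_on f (Field lam)" "f ` Field lam \<subseteq> ?D" using card_of_ordLeq by metis
    have "|f ` Field lam| \<le>o lam"
      using ordLeq_ordIso_trans[OF card_of_image card_of_Field_ordIso[OF lam_card]] .
    then obtain e0 where e0: "e0 \<in> F" "\<forall>x\<in>f ` Field lam. x \<prec> e0" using bdd[of "f ` Field lam"] f DF by blast
    obtain e1 where e1: "e1 \<in> ?D" "e0 \<prec> e1" by (rule Cl_unbounded[OF hsF e0(1)])
    have "e1 \<in> F" using e1 DF by blast
    then obtain t where t: "t \<in> S" "e1 \<prec> t" using S unfolding unbounded_def by blast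
    obtain x where x: "big t x" using some[OF t(1)] by blast
    let ?X = "f ` Field lam"
    have "\<exists>w. w \<in> L t \<and> w \<inter> below (s e) = x \<inter> below (s e) \<and> w \<inter> below (h (s e)) \<noteq> x \<inter> below (h (s e))"
      if e: "e \<in> ?X" for e
    proof -
      have "e \<in> F" using e f DF by blast
      have "e \<prec> e1" using e e0 e1 by (blast intro: less_trans)
      then have he: "h (s e) \<prec> e1" using e1 by (simp add: Cl_def)
      have se: "s e \<in> S" using s \<open>e \<in> F\<close> by blast
      have "s e \<prec> h (s e)"
      proof -
        obtain x where "big (s e) x" using some[OF se] by blast
        then obtain b where "s e \<preceq> b" "b \<prec> h (s e)" using h(2)[OF se] by blast
        then show ?thesis by order
      qed
      then have "s e \<preceq> t" using he t by order
      have "big (s e) (x \<inter> below (s e))" by (rule down[OF t(1) se \<open>s e \<preceq> t\<close> x])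
      from h(2)[OF se this] obtain b y y' where b: "b \<in> S" "s e \<preceq> b" "b \<prec> h (s e)" "big b y" "big b y'" "y \<inter> below (s e) = x \<inter> below (s e)"
        "y' \<inter> below (s e) = x \<inter> below (s e)" "y \<noteq> y'" by blast
      \<comment> \<open>Two different nodes of level \<open>b\<close> cannot both be
        \<open>x \<inter> below b\<close>. One of them, \<open>v\<close>, leaves \<open>x\<close>
        between \<open>s e\<close> and \<open>h (s e)\<close>, and some \<open>w\<close> on level
        \<open>t\<close> extends it.\<close>
      have "y = y \<inter> below b" "y' = y' \<inter> below b" using self[OF b(1)] b(4,5) by (auto simp: big_def)
      then have "y \<inter> below b \<noteq> x \<inter> below b \<or> y' \<inter> below b \<noteq> x \<inter> below b" using b(8) by metis
      then obtain v where v: "big b v" "v \<inter> below (s e) = x \<inter> below (s e)" "v \<inter> below b \<noteq> x \<inter> below b"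
        using b(4-7) by blast
      have bt: "b \<preceq> t" using b he t by order
      obtain w where w: "big t w" "w \<inter> below b = v" using ext[OF b(1) t(1) bt v(1)] by blast
      have "w \<inter> below (s e) = x \<inter> below (s e)" using w v(2) shrink[OF b(2), of w] by simp
      moreover have "w \<inter> below b \<noteq> x \<inter> below b" using w v by auto
      then have "w \<inter> below (h (s e)) \<noteq> x \<inter> below (h (s e))"
        using shrink[of b "h (s e)" w] shrink[of b "h (s e)" x] b(3) less_imp_le by metis
      ultimately show ?thesis using w(1) by (auto simp: big_def)
    qed
    then have "\<exists>w. \<forall>e\<in>?X. w e \<in> L t \<and> w e \<inter> below (s e) = x \<inter> below (s e) \<and> w e \<inter> below (h (s e)) \<noteq> x \<inter> below (h (s e))"
      by (intro bchoice ballI)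
    then obtain w where w: "\<And>e. e \<in> ?X \<Longrightarrow> w e \<in> L t" "\<And>e. e \<in> ?X \<Longrightarrow> w e \<inter> below (s e) = x \<inter> below (s e)"
        "\<And>e. e \<in> ?X \<Longrightarrow> w e \<inter> below (h (s e)) \<noteq> x \<inter> below (h (s e))" by blast
    \<comment> \<open>As \<open>e'\<close> is a closure point, \<open>h (s e)\<close> lies below it.
      By that height \<open>w e\<close> has left \<open>x\<close>, while \<open>w e'\<close> still
      follows it.\<close>
    have neq: "w e \<noteq> w e'" if "e \<in> ?X" "e' \<in> ?X" "e \<prec> e'" for e e'
    proof -
      have e: "e \<in> ?D" "e' \<in> ?D" using that f by blast+
      then have "e' \<in> F" using DF by blast
      have "h (s e) \<prec> e'" using e that(3) by (simp add: Cl_def)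
      then have "h (s e) \<preceq> s e'" using s(2)[OF \<open>e' \<in> F\<close>] by order
      then have "w e' \<inter> below (h (s e)) = x \<inter> below (h (s e))"
        using w(2)[OF that(2)] shrink[of "h (s e)" "s e'"] by metis
      then show ?thesis using w(3)[OF that(1)] by metis
    qed
    have "inj_on (w \<circ> f) (Field lam)"
    proof (rule comp_inj_on[OF f(1)], rule inj_onI)
      fix u v assume uv: "u \<in> ?X" "v \<in> ?X" "w u = w v"
      show "u = v" using neq[OF uv(1,2)] neq[OF uv(2,1)] uv(3) by (cases rule: linorder_cases[of u v]) auto
    qed
    moreover have "(w \<circ> f) ` Field lam \<subseteq> L t" using w(1) by auto
    ultimately have "|Field lam| \<le>o |L t|" using card_of_ordLeq by blast
    then have "lam \<le>o |L t|" using lam_card card_of_Field_ordIso ordIso_ordLeq_trans ordIso_symmetric by metis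
    then show thesis using few[OF t(1)] not_ordLess_ordLeq by blast
  qed
qed

end

section \<open>Coherent sequences and transformations of clubs\<close>

context succ_card
begin

definition Nacc :: "'k set \<Rightarrow> 'k set" where "Nacc C = C - Acc C"

definition coherent :: "('k \<Rightarrow> 'k set set) \<Rightarrow> 'k set \<Rightarrow> bool" where
  "coherent Cs G \<longleftrightarrow> G \<subseteq> F \<and> (\<forall>a\<in>G. Cs a \<noteq> {} \<and> |Cs a| <o lam \<and>
     (\<forall>C\<in>Cs a. club C a \<and> (\<forall>b\<in>Acc C. b \<in> G \<and> C \<inter> below b \<in> Cs b)))"

text \<open>A limit point of \<open>A\<close> outside \<open>G\<close> already counts as a failure,
  so what is excluded are threads with all their limit points in \<open>G\<close>.\<close>

definition threadless :: "('k \<Rightarrow> 'k set set) \<Rightarrow> 'k set \<Rightarrow> bool" where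
  "threadless Cs G \<longleftrightarrow> (\<forall>A. unbounded A \<longrightarrow> (\<exists>a\<in>F. limpt A a \<and> (a \<in> G \<longrightarrow> A \<inter> below a \<notin> Cs a)))"

text \<open>The point put into the gap below \<open>c\<close> depends only on \<open>c\<close> and
  \<open>C \<inter> below c\<close>, which makes \<open>extend y\<close> commute with restriction.
  The values \<open>y D c\<close> are sets so that a gap may also stay as it is.\<close>

definition extend :: "('k set \<Rightarrow> 'k \<Rightarrow> 'k set) \<Rightarrow> 'k set \<Rightarrow> 'k set" where
  "extend y C = C \<union> {z. \<exists>c\<in>Nacc C. z \<in> y (C \<inter> below c) c}"

definition gap_filler :: "('k set \<Rightarrow> 'k \<Rightarrow> 'k set) \<Rightarrow> bool" where
  "gap_filler y \<longleftrightarrow> (\<forall>D c z. z \<in> y D c \<longrightarrow> z \<prec> c \<and> (\<forall>d\<in>D. d \<prec> z)) \<and>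
     (\<forall>D c z z'. z \<in> y D c \<longrightarrow> z' \<in> y D c \<longrightarrow> z = z')"

text \<open>Commutation is asked for only at accumulation points of \<open>P C\<close>: the
  transformation \<open>cut\<close> below leaves short initial segments alone, while it removes them
  from longer clubs.\<close>

definition conservative :: "('k set \<Rightarrow> 'k set) \<Rightarrow> bool" where
  "conservative P \<longleftrightarrow> (\<forall>a\<in>F. \<forall>C. club C a \<longrightarrow> club (P C) a \<and> Acc (P C) \<subseteq> Acc C \<and>
     (\<forall>b\<in>Acc (P C). P C \<inter> below b = P (C \<inter> below b)))"

lemma clubD:
  assumes "club C a"
  shows "C \<subseteq> below a" "limpt C a" "b \<prec> a \<Longrightarrow> limpt C b \<Longrightarrow> b \<in> C"
  using assms by (auto simp: club_def)

lemma Acc_below: "Acc (C \<inter> below b) = Acc C \<inter> below b"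
  unfolding Acc_def using limpt_Int_below by (auto simp: less_imp_le)

lemma Nacc_below: "Nacc (C \<inter> below b) = Nacc C \<inter> below b"
  unfolding Nacc_def by (auto simp: Acc_below)

text \<open>The levels \<open>L a\<close> form a tree whose cofinal branch has clubs of the sequence
  as initial segments. A limit point of the branch is an accumulation point of such a club further
  up, so the branch would be a thread with all its limit points in \<open>G\<close>.\<close>

lemma threadless_no_branch:
  assumes coh: "coherent Cs G" and thr: "threadless Cs G"
    and S: "unbounded S" "S \<subseteq> G"
    and L: "\<And>a. a \<in> S \<Longrightarrow> L a \<subseteq> Cs a" "\<And>a. a \<in> S \<Longrightarrow> L a \<noteq> {}"
    and down: "\<And>a b C. a \<in> S \<Longrightarrow> b \<in> S \<Longrightarrow> b \<prec> a \<Longrightarrow> C \<in> L a \<Longrightarrow> C \<inter> below b \<in> L b"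
  shows False
proof -
  have C: "club C a" "\<And>b. b \<in> Acc C \<Longrightarrow> b \<in> G \<and> C \<inter> below b \<in> Cs b" "|Cs a| <o lam" if "a \<in> S" "C \<in> L a" for a C
    using coh S(2) L(1)[OF that(1)] that unfolding coherent_def by blast+
  obtain B where B: "\<And>a. a \<in> S \<Longrightarrow> B \<inter> below a \<in> L a"
  proof (rule branch[OF S(1) L(2)])
    fix a assume a: "a \<in> S"
    then have "|Cs a| <o lam" using coh S(2) unfolding coherent_def by blast
    with card_of_mono1[OF L(1)[OF a]] show "|L a| <o lam" by (rule ordLeq_ordLess_trans)
  qed (use C clubD(1) down in blast)+
  let ?A = "B \<inter> F"
  have SF: "S \<subseteq> F" using S by (simp add: unbounded_def)
  have A: "?A \<inter> below a = B \<inter> below a" if "a \<in> F" for a using F_down that by blast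
  have "unbounded ?A"
    unfolding unbounded_def
  proof (intro conjI ballI)
    fix b assume "b \<in> F"
    then obtain s where s: "s \<in> S" "b \<prec> s" using S(1) unfolding unbounded_def by blast
    then have "limpt (B \<inter> below s) s" using C(1) B clubD(2) by blast
    then obtain c where "c \<in> B \<inter> below s" "b \<prec> c" using limptD s by blast
    then show "\<exists>c\<in>B \<inter> F. b \<prec> c" using s SF F_down by blast
  qed auto
  then obtain a where a: "a \<in> F" "limpt ?A a" "a \<in> G \<Longrightarrow> ?A \<inter> below a \<notin> Cs a"
    using thr unfolding threadless_def by blast
  then obtain s where s: "s \<in> S" "a \<prec> s" using S(1) unfolding unbounded_def by blast
  have D: "club (B \<inter> below s) s" using C(1)[OF s(1) B[OF s(1)]] .
  have "limpt (B \<inter> below s) a" 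
    by (rule limpt_mono[OF a(2)]) (use s(2) in \<open>auto intro: less_trans\<close>)
  then have "a \<in> Acc (B \<inter> below s)" using clubD(3)[OF D s(2)] by (simp add: Acc_def)
  then have "a \<in> G" "B \<inter> below s \<inter> below a \<in> Cs a" using C(2)[OF s(1) B[OF s(1)]] by blast+
  moreover have "B \<inter> below s \<inter> below a = B \<inter> below a" using s(2) by (auto intro: less_trans)
  ultimately show False using a(3) A[OF a(1)] by simp
qed

text \<open>Suppose \<open>bad b\<close> is unbounded. The clubs at its points show that for each
  \<open>e\<close> in \<open>E\<close> above \<open>b\<close> some \<open>D\<close> in
  \<open>Cs e\<close> has all points of \<open>E\<close> between \<open>b\<close> and
  \<open>e\<close> as accumulation points, and these \<open>D\<close> form a tree excluded by
  \<open>threadless_no_branch\<close>. So \<open>bad b\<close> has a bound, which becomes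
  \<open>g b\<close>.\<close>

lemma threadless_escape:
  assumes coh: "coherent Cs G" and thr: "threadless Cs G" and E: "Club E"
  shows "\<exists>g. (\<forall>x\<in>F. g x \<in> F) \<and> (\<forall>a\<in>G \<inter> Cl g. \<forall>C\<in>Cs a. limpt (E - Acc C) a)"
proof -
  define bad where "bad b = {a\<in>G. b \<prec> a \<and> (\<exists>C\<in>Cs a. \<forall>e\<in>E. b \<prec> e \<longrightarrow> e \<prec> a \<longrightarrow> e \<in> Acc C)}" for b
  have GF: "G \<subseteq> F" using coh by (simp add: coherent_def)
  have "\<exists>d. d \<in> F \<and> (\<forall>a\<in>bad b. a \<preceq> d)" if b: "b \<in> F" for b
  proof (rule ccontr)
    assume "\<not> ?thesis"
    then have unb: "\<exists>a\<in>bad b. d \<prec> a" if "d \<in> F" for d using that by (auto simp: not_le)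
    let ?S = "{e\<in>E. b \<prec> e}"
    let ?L = "\<lambda>e. {D \<in> Cs e. \<forall>e'\<in>E. b \<prec> e' \<longrightarrow> e' \<prec> e \<longrightarrow> e' \<in> Acc D}"
    have ne: "e \<in> G \<and> ?L e \<noteq> {}" if e: "e \<in> ?S" for e
    proof -
      have "e \<in> F" using e E by (auto simp: Club_def)
      then obtain a C where a: "a \<in> G" "e \<prec> a" "C \<in> Cs a" "\<forall>e\<in>E. b \<prec> e \<longrightarrow> e \<prec> a \<longrightarrow> e \<in> Acc C"
        using unb unfolding bad_def by blast
      then have "e \<in> Acc C" using e by blast
      then have "e \<in> G" "C \<inter> below e \<in> Cs e" using coh a unfolding coherent_def by blast+
      moreover have "\<forall>e'\<in>E. b \<prec> e' \<longrightarrow> e' \<prec> e \<longrightarrow> e' \<in> Acc (C \<inter> below e)"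
        using a by (auto simp: Acc_below intro: less_trans)
      ultimately show ?thesis by blast
    qed
    show False
    proof (rule threadless_no_branch[OF coh thr, of ?S ?L])
      show "unbounded ?S" unfolding unbounded_def
      proof (intro conjI ballI)
        show "?S \<subseteq> F" using E by (auto simp: Club_def)
        fix x assume x: "x \<in> F"
        define m where "m = (if x \<prec> b then b else x)"
        have "m \<in> F" "x \<preceq> m" "b \<preceq> m" using x b by (auto simp: m_def not_less less_imp_le)
        then obtain e where "e \<in> E" "m \<prec> e" using E unfolding Club_def by blast
        then show "\<exists>s\<in>?S. x \<prec> s" using \<open>x \<preceq> m\<close> \<open>b \<preceq> m\<close>
          by (intro bexI[of _ e]) (auto intro: le_less_trans)
      qed
      show "?S \<subseteq> G" using ne by blast
      fix e assume e: "e \<in> ?S"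
      show "?L e \<subseteq> Cs e" by blast
      show "?L e \<noteq> {}" using ne e by blast
    next
      fix e e' C assume e: "e \<in> ?S" "e' \<in> ?S" "e' \<prec> e" "C \<in> ?L e"
      then have "e' \<in> Acc C" by blast
      then have "C \<inter> below e' \<in> Cs e'" using coh e ne unfolding coherent_def by blast
      moreover have "\<forall>x\<in>E. b \<prec> x \<longrightarrow> x \<prec> e' \<longrightarrow> x \<in> Acc (C \<inter> below e')"
        using e by (auto simp: Acc_below intro: less_trans)
      ultimately show "C \<inter> below e' \<in> ?L e'" by blast
    qed
  qed
  then have "\<exists>g. \<forall>b\<in>F. g b \<in> F \<and> (\<forall>a\<in>bad b. a \<preceq> g b)" by (intro bchoice ballI) blast
  then obtain g where g: "\<forall>b\<in>F. g b \<in> F \<and> (\<forall>a\<in>bad b. a \<preceq> g b)" ..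
  have "limpt (E - Acc C) a" if a: "a \<in> G" "a \<in> Cl g" and C: "C \<in> Cs a" for a C
    unfolding limpt_def
  proof (intro conjI allI impI)
    have "limpt UNIV a" using a by (simp add: Cl_def)
    then show "\<exists>b. b \<prec> a" by (simp add: limpt_def)
    fix b assume b: "b \<prec> a"
    then have "b \<in> F" using a GF F_down by blast
    have "g b \<prec> a" using a b by (simp add: Cl_def)
    then have "a \<notin> bad b" using g \<open>b \<in> F\<close> not_le by blast
    then show "\<exists>c\<in>E - Acc C. b \<prec> c \<and> c \<prec> a" using a(1) b C unfolding bad_def by blast
  qed
  then show ?thesis using g by blast
qed

text \<open>A gap receives at most one point. Between two added points there is thus a point of
  \<open>C\<close>, namely the upper end of the gap of the smaller one.\<close>

lemma extend_limpt:
  assumes y: "gap_filler y" and l: "limpt (extend y C) b"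
  shows "limpt C b"
  unfolding limpt_def
proof (intro conjI allI impI)
  show "\<exists>x. x \<prec> b" using l by (simp add: limpt_def)
  fix x assume "x \<prec> b"
  then obtain d where d: "d \<in> extend y C" "x \<prec> d" "d \<prec> b" using limptD[OF l] by blast
  obtain d' where d': "d' \<in> extend y C" "d \<prec> d'" "d' \<prec> b" using limptD[OF l d(3)] by blast
  show "\<exists>c\<in>C. x \<prec> c \<and> c \<prec> b"
  proof (rule ccontr)
    assume no: "\<not> ?thesis"
    have "d \<notin> C" using no d by blast
    have "x \<prec> d'" using d d' by order
    then have "d' \<notin> C" using no d' by blast
    obtain c where c: "c \<in> C" "d \<in> y (C \<inter> below c) c" using d \<open>d \<notin> C\<close> by (auto simp: extend_def Nacc_def)
    obtain c' where c': "c' \<in> C" "d' \<in> y (C \<inter> below c') c'" using d' \<open>d' \<notin> C\<close> by (auto simp: extend_def Nacc_def)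
    have dc: "d \<prec> c" "\<And>e. e \<in> C \<Longrightarrow> e \<prec> c \<Longrightarrow> e \<prec> d" using y c(2) unfolding gap_filler_def by blast+
    have dc': "d' \<prec> c'" "\<And>e. e \<in> C \<Longrightarrow> e \<prec> c' \<Longrightarrow> e \<prec> d'" using y c'(2) unfolding gap_filler_def by blast+
    have "c \<noteq> c'" using y c c' d'(2) unfolding gap_filler_def by (metis less_irrefl)
    then consider "c \<prec> c'" | "c' \<prec> c" by (meson linorder_cases)
    then show False
    proof cases
      case 1
      then have "c \<prec> d'" using dc'(2) c by blast
      then have "x \<prec> c" "c \<prec> b" using dc(1) d d' by order+
      then show False using no c by blast
    next
      case 2
      then have "c' \<prec> d" using dc(2) c' by blast
      then show False using dc'(1) d'(2) by order
    qed
  qed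
qed

lemma Nacc_subset_extend:
  assumes y: "gap_filler y"
  shows "Nacc C \<subseteq> Nacc (extend y C)" 
proof
  fix c assume "c \<in> Nacc C"
  then have c: "c \<in> C" "\<not> limpt C c" by (auto simp: Nacc_def Acc_def)
  then have "\<not> limpt (extend y C) c" using extend_limpt[OF y, of C c] by blast
  then show "c \<in> Nacc (extend y C)" using c by (simp add: Nacc_def Acc_def extend_def)
qed

lemma gap_Nacc_extend:
  assumes y: "gap_filler y" and C: "club C a" and c: "c \<in> Nacc C" and z: "z \<in> y (C \<inter> below c) c"
  shows "z \<in> Nacc (extend y C)"
proof -
  have zc: "z \<prec> c" "\<And>e. e \<in> C \<Longrightarrow> e \<prec> c \<Longrightarrow> e \<prec> z" using y z unfolding gap_filler_def by blast+
  then have "z \<notin> C" by blast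
  moreover have "z \<prec> a" using zc(1) c clubD(1)[OF C] by (auto simp: Nacc_def intro: less_trans)
  ultimately have "\<not> limpt C z" using clubD(3)[OF C] by blast
  then have "\<not> limpt (extend y C) z" using extend_limpt[OF y, of C z] by blast
  then show "z \<in> Nacc (extend y C)" using c z by (auto simp: Nacc_def Acc_def extend_def)
qed

lemma conservative_extend:
  assumes y: "gap_filler y"
  shows "conservative (extend y)"
  unfolding conservative_def
proof (intro ballI allI impI conjI)
  fix a C assume C: "club C a"
  note ca = clubD[OF C]
  have sub: "C \<subseteq> extend y C" by (auto simp: extend_def)
  have cls: "b \<in> C" if "b \<prec> a" "limpt (extend y C) b" for b
    using ca(3)[OF that(1) extend_limpt[OF y that(2)]] .
  show "club (extend y C) a"
    unfolding club_def
  proof (intro conjI allI impI)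
    show "extend y C \<subseteq> below a"
      using ca(1) y unfolding extend_def gap_filler_def Nacc_def by (blast intro: less_trans)
    show "limpt (extend y C) a" using limpt_mono[OF ca(2)] sub by blast
  qed (use cls sub in blast)
  show acc: "Acc (extend y C) \<subseteq> Acc C"
  proof
    fix b assume "b \<in> Acc (extend y C)"
    then have b: "b \<in> extend y C" "limpt (extend y C) b" by (auto simp: Acc_def)
    then have "b \<notin> Nacc (extend y C)" by (auto simp: Nacc_def Acc_def)
    then have "b \<in> C" using gap_Nacc_extend[OF y C, of _ b] b(1) by (auto simp: extend_def)
    then show "b \<in> Acc C" using extend_limpt[OF y b(2)] by (simp add: Acc_def)
  qed
  fix b assume "b \<in> Acc (extend y C)"
  then have b: "b \<in> C" "limpt C b" using acc by (auto simp: Acc_def)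
  \<comment> \<open>The point added below \<open>c\<close> lies above all points of \<open>C\<close>
    below \<open>c\<close>, so no gap reaches across the point \<open>b\<close> of
    \<open>C\<close>.\<close>
  have *: "c \<prec> b" if "c \<in> Nacc C" "z \<in> y (C \<inter> below c) c" "z \<prec> b" for c z
  proof (rule ccontr)
    assume "\<not> c \<prec> b"
    then have "b \<prec> c" using that(1) b by (auto simp: Nacc_def Acc_def not_less le_less)
    then have "b \<prec> z" using y that(2) b unfolding gap_filler_def by blast
    then show False using that(3) by order
  qed
  have eq: "C \<inter> below b \<inter> below c = C \<inter> below c" if "c \<prec> b" for c using that by (auto intro: less_trans)
  have up: "z \<prec> b" if "z \<in> y (C \<inter> below c) c" "c \<prec> b" for c z
    using y that unfolding gap_filler_def by (blast intro: less_trans)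
  show "extend y C \<inter> below b = extend y (C \<inter> below b)"
  proof (intro subset_antisym subsetI)
    fix z assume z: "z \<in> extend y C \<inter> below b"
    show "z \<in> extend y (C \<inter> below b)"
    proof (cases "z \<in> C")
      case True then show ?thesis using z by (simp add: extend_def)
    next
      case False
      then obtain c where c: "c \<in> Nacc C" "z \<in> y (C \<inter> below c) c" using z by (auto simp: extend_def)
      then have "c \<prec> b" using * z by blast
      then show ?thesis using c eq unfolding extend_def Nacc_below by auto
    qed
  next
    fix z assume "z \<in> extend y (C \<inter> below b)"
    then consider "z \<in> C" "z \<prec> b" | c where "c \<in> Nacc C" "c \<prec> b" "z \<in> y (C \<inter> below b \<inter> below c) c"
      unfolding extend_def Nacc_below by blast
    then show "z \<in> extend y C \<inter> below b"
    proof cases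
      case 1 then show ?thesis by (simp add: extend_def)
    next
      case 2
      then have "z \<in> y (C \<inter> below c) c" using eq by simp
      then show ?thesis using 2(1) up[OF _ 2(2)] by (auto simp: extend_def)
    qed
  qed
qed

lemma conservative_comp:
  assumes "conservative P" "conservative Q"
  shows "conservative (P \<circ> Q)"
  unfolding conservative_def
proof (intro ballI allI impI conjI)
  fix a C assume a: "a \<in> F" and C: "club C a"
  have Q: "club (Q C) a" "Acc (Q C) \<subseteq> Acc C" "\<And>b. b \<in> Acc (Q C) \<Longrightarrow> Q C \<inter> below b = Q (C \<inter> below b)"
    using assms(2) a C unfolding conservative_def by blast+
  then have P: "club (P (Q C)) a" "Acc (P (Q C)) \<subseteq> Acc (Q C)"
    "\<And>b. b \<in> Acc (P (Q C)) \<Longrightarrow> P (Q C) \<inter> below b = P (Q C \<inter> below b)"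
    using assms(1) a unfolding conservative_def by blast+
  show "club ((P \<circ> Q) C) a" "Acc ((P \<circ> Q) C) \<subseteq> Acc C" using P(1,2) Q(2) by auto
  fix b assume "b \<in> Acc ((P \<circ> Q) C)"
  then have "b \<in> Acc (P (Q C))" by simp
  moreover from this have "b \<in> Acc (Q C)" using P(2) by blast
  ultimately show "(P \<circ> Q) C \<inter> below b = (P \<circ> Q) (C \<inter> below b)" using P(3) Q(3) by simp
qed

end

section \<open>Wide club guessing\<close>

text \<open>The value \<open>undefined\<close> hides all but the earlier values from
  \<open>H\<close>, which makes the equation solvable for arbitrary \<open>H\<close>.\<close>

lemma underS_recursion:
  assumes "Well_order r"
  shows "\<exists>f. \<forall>i. f i = H i (\<lambda>j. if j \<in> underS r i then f j else undefined)"
proof -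
  have WF: "wf (r - Id)" using assms by (simp add: well_order_on_def)
  define f where "f = wfrec (r - Id) (\<lambda>g i. H i g)"
  have "f i = H i (\<lambda>j. if j \<in> underS r i then f j else undefined)" for i
  proof -
    have "cut f (r - Id) i = (\<lambda>j. if j \<in> underS r i then f j else undefined)"
      by (rule ext) (auto simp: cut_def underS_def)
    then show ?thesis using wfrec[OF WF, of "\<lambda>g i. H i g" i] by (simp add: f_def)
  qed
  then show ?thesis by blast
qed

context succ_card
begin

lemma ex_infinite_bound:
  fixes A :: "'a set" and B :: "'b set"
  assumes "|A| <o lam" "|B| <o lam"
  obtains Z :: "(('a + 'b) + nat) set" where "infinite Z" "|Z| <o lam" "|A| \<le>o |Z|" "|B| \<le>o |Z|"
proof -
  let ?Z = "(A <+> B) <+> (UNIV :: nat set)"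
  have inf: "\<not> finite (Field lam)" using lam_Cinfinite by (simp add: cinfinite_def)
  have N: "|UNIV :: nat set| <o lam" using card_of_nat lam_uncountable ordIso_ordLess_trans by blast
  have AB: "|A <+> B| <o lam" by (rule card_of_Plus_ordLess_infinite_Field[OF inf lam_card assms])
  have "|?Z| <o lam" by (rule card_of_Plus_ordLess_infinite_Field[OF inf lam_card AB N])
  moreover have "infinite ?Z" by (simp add: finite_Plus_iff)
  moreover have "|A| \<le>o |?Z|" by (rule ordLeq_transitive[OF card_of_Plus1 card_of_Plus1])
  moreover have "|B| \<le>o |?Z|" by (rule ordLeq_transitive[OF card_of_Plus2 card_of_Plus1])
  ultimately show thesis by (intro that[of ?Z])
qed

lemma Times_less_lam:
  fixes A :: "'a set" and B :: "'b set"
  assumes "|A| <o lam" "|B| <o lam"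
  shows "|A \<times> B| <o lam"
proof -
  obtain Z :: "(('a + 'b) + nat) set" where Z: "infinite Z" "|Z| <o lam" "|A| \<le>o |Z|" "|B| \<le>o |Z|"
    by (rule ex_infinite_bound[OF assms])
  have "|A \<times> B| \<le>o |Z|"
    by (rule card_of_Times_ordLeq_infinite_Field[OF _ Z(3,4) card_of_Card_order]) (simp add: Z(1) Field_card_of)
  then show ?thesis using Z(2) by (rule ordLeq_ordLess_trans)
qed

text \<open>As \<lambda> may be singular, a fibre of size \<lambda> need not exist. If all fibres
  had size at most \<open>t\<close>, they would cover \<open>Field lam\<close> by fewer than
  \<lambda> points, since \<open>Y\<close> and \<open>t\<close> are both below \<lambda>.\<close>

lemma large_fibre:
  fixes Y :: "'b set" and t :: "'c rel"
  assumes Y: "|Y| <o lam" and f: "f ` Field lam \<subseteq> Y" and t: "Card_order t" "t <o lam"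
  obtains y where "y \<in> Y" "\<not> |{i \<in> Field lam. f i = y}| \<le>o t"
proof (rule ccontr)
  assume "\<not> thesis"
  then have small: "\<forall>y\<in>Y. |{i \<in> Field lam. f i = y}| \<le>o t" using that by blast
  have tF: "t =o |Field t|" using card_of_Field_ordIso[OF t(1)] ordIso_symmetric by blast
  have "|Field t| <o lam" using card_of_Field_ordIso[OF t(1)] t(2) by (rule ordIso_ordLess_trans)
  with Y obtain Z :: "(('b + 'c) + nat) set" where Z: "infinite Z" "|Z| <o lam" "|Y| \<le>o |Z|" "|Field t| \<le>o |Z|"
    by (rule ex_infinite_bound)
  have "\<forall>y\<in>Y. |{i \<in> Field lam. f i = y}| \<le>o |Z|"
    using small ordLeq_transitive[OF ordLeq_ordIso_trans[OF _ tF] Z(4)] by blast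
  then have "|\<Union>y\<in>Y. {i \<in> Field lam. f i = y}| \<le>o |Z|"
    using Z by (intro card_of_UNION_ordLeq_infinite)
  moreover have "(\<Union>y\<in>Y. {i \<in> Field lam. f i = y}) = Field lam" using f by auto
  ultimately have "|Field lam| \<le>o |Z|" by simp
  then have "lam \<le>o |Z|"
    using card_of_Field_ordIso[OF lam_card] ordIso_symmetric ordIso_ordLeq_trans by blast
  then show False using Z(2) not_ordLess_ordLeq by blast
qed

text \<open>Induction on the bound \<open>x\<close>: the value at the least index is a smaller bound
  for the values at the remaining ones.\<close>

lemma finite_descent:
  assumes "I \<subseteq> Field lam" "\<And>i. i \<in> I \<Longrightarrow> d i \<prec> x"
    "\<And>i j. i \<in> I \<Longrightarrow> j \<in> I \<Longrightarrow> i \<in> underS lam j \<Longrightarrow> d j \<prec> d i"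
  shows "finite I"
  using assms
proof (induction x arbitrary: I rule: less_induct)
  case (less x)
  interpret L: wo_rel lam using lam_card by (simp add: wo_rel_def card_order_on_well_order_on)
  show ?case
  proof (cases "I = {}")
    case False
    then have m: "L.isMinim I (L.minim I)" using less.prems(1) L.minim_isMinim by blast
    let ?m = "L.minim I"
    have mI: "?m \<in> I" using m by (simp add: L.isMinim_def)
    have "finite (I - {?m})"
    proof (rule less.IH)
      show "d ?m \<prec> x" using less.prems(2) mI .
      show "I - {?m} \<subseteq> Field lam" using less.prems(1) by blast
      show "d i \<prec> d ?m" if "i \<in> I - {?m}" for i
        using less.prems(3)[OF mI, of i] m that by (auto simp: L.isMinim_def underS_def)
      show "d j \<prec> d i" if "i \<in> I - {?m}" "j \<in> I - {?m}" "i \<in> underS lam j" for i j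
        using less.prems(3) that by blast
    qed
    then show ?thesis by simp
  qed simp
qed

definition cofp :: "'k \<Rightarrow> 'x rel \<Rightarrow> bool" where
  "cofp a t \<longleftrightarrow> (\<exists>c\<subseteq>below a. limpt c a \<and> |c| =o t) \<and> (\<forall>B\<subseteq>below a. limpt B a \<longrightarrow> t \<le>o |B| )"

text \<open>This is \<open>max (E \<inter> c)\<close>, or nothing if that maximum does not exist or
  is not above \<open>D\<close>.\<close>

definition clubfill :: "'k set \<Rightarrow> 'k set \<Rightarrow> 'k \<Rightarrow> 'k set" where
  "clubfill E D c = {z \<in> E. z \<prec> c \<and> (\<forall>e\<in>E. e \<prec> c \<longrightarrow> e \<preceq> z) \<and> (\<forall>d\<in>D. d \<prec> z)}"

lemma gap_filler_clubfill: "gap_filler (clubfill E)"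
  unfolding gap_filler_def clubfill_def by (auto intro: order.antisym)

text \<open>A maximum of \<open>E \<inter> c\<close> that lies in the smaller set \<open>E'\<close>
  is also the maximum of \<open>E' \<inter> c\<close>. This allows the clubs found for different
  cofinalities to be replaced by their intersection.\<close>

lemma clubfill_mono:
  assumes C: "club C a" and E: "E' \<subseteq> E" and z: "z \<in> Nacc (extend (clubfill E) C)" "z \<in> E'"
  shows "z \<in> Nacc (extend (clubfill E') C)"
proof (cases "z \<in> C")
  case True
  have "z \<notin> Acc C" using z(1) limpt_mono[of C z "extend (clubfill E) C"]
    by (auto simp: Nacc_def Acc_def extend_def)
  then show ?thesis using True Nacc_subset_extend[OF gap_filler_clubfill] by (auto simp: Nacc_def)
next
  case False
  then obtain c where c: "c \<in> Nacc C" "z \<in> clubfill E (C \<inter> below c) c"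
    using z by (auto simp: extend_def Nacc_def)
  then have "z \<in> clubfill E' (C \<inter> below c) c" using E z(2) by (auto simp: clubfill_def)
  then show ?thesis by (rule gap_Nacc_extend[OF gap_filler_clubfill C c(1)])
qed

lemma Club_F: "Club F"
  using ex_greater by (auto simp: Club_def)

lemma Club_max_or_limit:
  assumes E: "Club E" and e: "e \<in> E" "e \<prec> c" and c: "c \<in> F"
  obtains z where "z \<in> E" "z \<prec> c" "\<forall>e\<in>E. e \<prec> c \<longrightarrow> e \<preceq> z" | "limpt E c" "c \<in> E"
proof (cases "\<exists>z\<in>E. z \<prec> c \<and> (\<forall>e\<in>E. e \<prec> c \<longrightarrow> e \<preceq> z)")
  case True then show thesis using that by blast
next
  case False
  let ?X = "E \<inter> below c"
  obtain s where s: "s \<preceq> c" "\<And>x. x \<in> ?X \<Longrightarrow> x \<prec> s" "limpt ?X s"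
  proof (rule sup_limpt[of ?X c])
    show "?X \<noteq> {}" using e by blast
    show "\<exists>y\<in>?X. x \<prec> y" if "x \<in> ?X" for x using False that by (auto simp: not_le)
  qed auto
  have "limpt E s" using limpt_mono[OF s(3)] by blast
  moreover have "s \<in> F" using s(1) c F_le by blast
  ultimately have "s \<in> E" using E by (simp add: Club_def)
  then have "s = c" using s(1,2) by (metis Int_iff mem_Collect_eq less_irrefl le_less)
  then show thesis using that(2) \<open>limpt E s\<close> \<open>s \<in> E\<close> by blast
qed

text \<open>The guess concerns all clubs in \<open>Cs a\<close> at once. The sequence of
  counterexamples has length \<lambda> and not \<omega>, because the failing club and the point from
  which on it fails vary with the counterexample. There are fewer than \<lambda> such pairs, so one
  of them recurs infinitely often.\<close>

lemma wide_club_guessing: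
  assumes coh: "coherent Cs G" and thr: "threadless Cs G" and t: "Card_order t" "t <o lam"
    and stat: "\<And>g. \<forall>x\<in>F. g x \<in> F \<Longrightarrow> \<exists>a\<in>G \<inter> Cl g. cofp a t"
  shows "\<exists>E. Club E \<and> (\<forall>D. Club D \<longrightarrow>
     (\<exists>a\<in>G. cofp a t \<and> (\<forall>C\<in>Cs a. limpt (Nacc (extend (clubfill E) C) \<inter> D) a)))"
proof (rule ccontr)
  assume contra: "\<not> ?thesis"
  interpret L: wo_rel lam using lam_card by (simp add: wo_rel_def card_order_on_well_order_on)
  define P where "P E D \<longleftrightarrow> Club D \<and> (\<forall>a\<in>G. cofp a t \<longrightarrow>
    (\<exists>C\<in>Cs a. \<not> limpt (Nacc (extend (clubfill E) C) \<inter> D) a))" for E D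
  have "\<forall>E. \<exists>D. (Club E \<longrightarrow> P E D) \<and> Club D"
  proof (rule allI)
    fix E show "\<exists>D. (Club E \<longrightarrow> P E D) \<and> Club D"
    proof (cases "Club E")
      case True
      then have "\<not> (\<forall>D. Club D \<longrightarrow> (\<exists>a\<in>G. cofp a t \<and> (\<forall>C\<in>Cs a. limpt (Nacc (extend (clubfill E) C) \<inter> D) a)))"
        using contra by blast
      then show ?thesis unfolding P_def by blast
    next
      case False then show ?thesis using Club_F by blast
    qed
  qed
  from choice[OF this] obtain W where W: "\<And>E. Club E \<Longrightarrow> P E (W E)" "\<And>E. Club (W E)" by blast
  from underS_recursion[OF L.WELL, of "\<lambda>i f. F \<inter> (\<Inter>j\<in>underS lam i. W (f j))"]
  obtain Ei where Ei: "\<forall>i. Ei i = F \<inter> (\<Inter>j\<in>underS lam i. W (if j \<in> underS lam i then Ei j else undefined))" ..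
  have Ei: "Ei i = F \<inter> (\<Inter>j\<in>underS lam i. W (Ei j))" for i using Ei[rule_format, of i] by simp
  have clubE: "Club (Ei i)" if "i \<in> Field lam" for i
  proof (subst Ei, rule Club_Inter)
    show "|underS lam i| \<le>o lam" using card_of_underS[OF lam_card that] ordLess_imp_ordLeq by blast
  qed (rule W)
  have EW: "Ei j \<subseteq> W (Ei i)" if "i \<in> underS lam j" for i j using that by (subst Ei[of j]) blast
  have EE: "Ei j \<subseteq> Ei i" if "i \<in> underS lam j" for i j
  proof -
    have "underS lam i \<subseteq> underS lam j" using that L.TRANS L.ANTISYM
      unfolding underS_def trans_def antisym_def by blast
    then show ?thesis by (subst (1 2) Ei) blast
  qed
  define E where "E = F \<inter> (\<Inter>i\<in>Field lam. Ei i)"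
  have lamF: "|Field lam| \<le>o lam" using card_of_Field_ordIso[OF lam_card] ordIso_imp_ordLeq by blast
  have "Club E" unfolding E_def by (rule Club_Inter[OF clubE lamF])
  from threadless_escape[OF coh thr \<open>Club E\<close>]
  obtain g where g: "\<forall>x\<in>F. g x \<in> F" "\<forall>a\<in>G \<inter> Cl g. \<forall>C\<in>Cs a. limpt (E - Acc C) a" by blast
  obtain a where a: "a \<in> G" "a \<in> Cl g" "cofp a t" using stat[OF g(1)] by blast
  obtain c where c: "c \<subseteq> below a" "limpt c a" "|c| =o t" using a(3) by (auto simp: cofp_def)
  have aF: "a \<in> F" using a(2) by (simp add: Cl_def)
  have Csa: "|Cs a| <o lam" "\<And>C. C \<in> Cs a \<Longrightarrow> club C a" using coh a(1) by (auto simp: coherent_def)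
  let ?X = "\<lambda>i C. Nacc (extend (clubfill (Ei i)) C) \<inter> W (Ei i)"
  \<comment> \<open>The bound for the failure is moved up into the cofinal set \<open>c\<close> of
    size \<open>t\<close>; this keeps the number of pairs below \<lambda>.\<close>
  have "\<exists>p\<in>Cs a \<times> c. \<forall>z\<in>?X i (fst p). snd p \<prec> z \<longrightarrow> \<not> z \<prec> a" if i: "i \<in> Field lam" for i
  proof -
    obtain C where C: "C \<in> Cs a" "\<not> limpt (?X i C) a"
      using W(1)[OF clubE[OF i]] a unfolding P_def by blast
    obtain b where b: "b \<prec> a" "\<forall>z\<in>?X i C. b \<prec> z \<longrightarrow> \<not> z \<prec> a"
      using C(2) c(2) unfolding limpt_def by blast
    obtain r where "r \<in> c" "b \<prec> r" using limptD[OF c(2) b(1)] by blast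
    then show ?thesis using C(1) b(2) by (intro bexI[of _ "(C, r)"]) (auto intro: less_trans)
  qed
  then have "\<exists>p. \<forall>i\<in>Field lam. p i \<in> Cs a \<times> c \<and> (\<forall>z\<in>?X i (fst (p i)). snd (p i) \<prec> z \<longrightarrow> \<not> z \<prec> a)"
    by (intro bchoice ballI) (simp only: Bex_def)
  then obtain p where p: "\<forall>i\<in>Field lam. p i \<in> Cs a \<times> c \<and> (\<forall>z\<in>?X i (fst (p i)). snd (p i) \<prec> z \<longrightarrow> \<not> z \<prec> a)" ..
  have "|c| <o lam" using c(3) t(2) by (rule ordIso_ordLess_trans)
  then have few: "|Cs a \<times> c| <o lam" by (rule Times_less_lam[OF Csa(1)])
  have pp: "p ` Field lam \<subseteq> Cs a \<times> c" using p by blast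
  obtain q where q: "q \<in> Cs a \<times> c" "\<not> |{i \<in> Field lam. p i = q}| \<le>o natLeq"
    by (rule large_fibre[OF few pp natLeq_Card_order lam_uncountable])
  define I where "I = {i \<in> Field lam. p i = q}"
  have "infinite I"
    using q(2) finite_iff_ordLess_natLeq ordLess_imp_ordLeq unfolding I_def by blast
  obtain C r where Cr: "q = (C, r)" by (cases q)
  have C: "C \<in> Cs a" "r \<in> c" using q(1) Cr by auto
  have IF: "i \<in> Field lam" if "i \<in> I" for i using that by (simp add: I_def)
  have miss: "\<not> z \<prec> a" if "i \<in> I" "z \<in> ?X i C" "r \<prec> z" for i z using p that Cr by (auto simp: I_def)
  have clubC: "club C a" using Csa(2)[OF C(1)] .
  have "r \<prec> a" using C(2) c(1) by blast
  \<comment> \<open>This \<open>e\<close> belongs to all the clubs \<open>Ei i\<close>, but not to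
    \<open>Acc C\<close>. So the maxima of the sets \<open>Ei i\<close> below the next point
    \<open>d\<close> of \<open>C\<close> are at least \<open>e\<close>, and none of the points from
    \<open>e\<close> to \<open>d\<close> is an accumulation point of \<open>C\<close>.\<close>
  then obtain e where e: "e \<in> E" "e \<notin> Acc C" "r \<prec> e" "e \<prec> a"
    using g(2) a(1,2) C(1) limptD[of "E - Acc C" a r] by blast
  have eE: "e \<in> Ei i" if "i \<in> I" for i using e(1) IF[OF that] by (simp add: E_def)
  let ?Y = "{x \<in> C. e \<prec> x}"
  define d where "d = minel ?Y"
  have "?Y \<noteq> {}" using limptD[OF clubD(2)[OF clubC] e(4)] by blast
  then have d: "d \<in> C" "e \<prec> d" "\<And>x. x \<in> C \<Longrightarrow> e \<prec> x \<Longrightarrow> d \<preceq> x"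
    using minel_in[of ?Y] minel_le[of _ ?Y] by (auto simp: d_def)
  have da: "d \<prec> a" using d(1) clubD(1)[OF clubC] by blast
  then have dF: "d \<in> F" using aF F_down by blast
  have dN: "d \<in> Nacc C"
    using d limptD[of C d e] unfolding Nacc_def Acc_def by (auto simp: not_le[symmetric])
  define mx where "mx i z \<longleftrightarrow> z \<in> Ei i \<and> z \<prec> d \<and> (\<forall>e\<in>Ei i. e \<prec> d \<longrightarrow> e \<preceq> z)" for i z
  \<comment> \<open>Without a maximum, \<open>d\<close> is a limit point of \<open>Ei i\<close> and
    belongs to it, so \<open>d\<close> itself serves as the value.\<close>
  define dd where "dd i = (if \<exists>z. mx i z then SOME z. mx i z else d)" for i
  have mx: "mx i (dd i) \<or> (dd i = d \<and> limpt (Ei i) d \<and> d \<in> Ei i)" if i: "i \<in> I" for i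
  proof (cases "\<exists>z. mx i z")
    case True then show ?thesis using someI_ex[OF True] by (simp add: dd_def)
  next
    case False
    then show ?thesis
      by (rule_tac Club_max_or_limit[OF clubE[OF IF[OF i]] eE[OF i] d(2) dF]) (auto simp: dd_def mx_def)
  qed
  have e_le: "e \<preceq> dd i" "dd i \<preceq> d" if i: "i \<in> I" for i
    using mx[OF i] eE[OF i] d(2) by (auto simp: mx_def less_imp_le)
  have dd_nacc: "dd i \<in> Nacc (extend (clubfill (Ei i)) C)" if i: "i \<in> I" for i
  proof (cases "dd i \<in> C")
    case True
    have "dd i \<in> Nacc C"
    proof (cases "dd i = d")
      case False
      then have "dd i \<prec> d" using e_le(2)[OF i] by order
      then have "\<not> e \<prec> dd i" using d(3)[OF True] not_le by blast
      then have "dd i = e" using e_le(1)[OF i] by order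
      then show ?thesis using True e(2) by (simp add: Nacc_def)
    qed (use dN in simp)
    then show ?thesis using Nacc_subset_extend[OF gap_filler_clubfill] by blast
  next
    case False
    then have m: "mx i (dd i)" using mx[OF i] d(1) by metis
    have "x \<prec> dd i" if "x \<in> C" "x \<prec> d" for x
    proof -
      have "\<not> e \<prec> x" using d(3)[OF that(1)] that(2) not_le by blast
      moreover have "x \<noteq> dd i" using that False by blast
      ultimately show ?thesis using e_le(1)[OF i] by order
    qed
    then have "dd i \<in> clubfill (Ei i) (C \<inter> below d) d" using m by (auto simp: mx_def clubfill_def)
    then show ?thesis by (rule gap_Nacc_extend[OF gap_filler_clubfill clubC dN])
  qed
  have ddW: "dd i \<notin> W (Ei i)" if i: "i \<in> I" for i
  proof
    assume "dd i \<in> W (Ei i)"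
    then have "dd i \<in> ?X i C" using dd_nacc[OF i] by blast
    moreover have "r \<prec> dd i" "dd i \<prec> a" using e_le[OF i] e(3) da by order+
    ultimately show False using miss[OF i] by blast
  qed
  have "finite I"
  proof (rule finite_descent)
    show "I \<subseteq> Field lam" using IF by blast
    show "dd i \<prec> a" if "i \<in> I" for i using e_le(2)[OF that] da by order
    \<comment> \<open>If there were no maximum for \<open>j\<close>, then \<open>d\<close> would be
      a limit point of \<open>Ei j\<close>, hence of \<open>Ei i\<close>, and
      \<open>dd i = d\<close> would be in \<open>W (Ei i)\<close>. So \<open>dd j\<close> is a
      maximum. It lies in \<open>W (Ei i)\<close> and \<open>dd i\<close> does not, whence they
      differ.\<close>
    fix i j assume i: "i \<in> I" and j: "j \<in> I" and ij: "i \<in> underS lam j"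
    have jd: "mx j (dd j)"
    proof (rule ccontr)
      assume "\<not> mx j (dd j)"
      then have l: "limpt (Ei j) d" "d \<in> Ei j" using mx[OF j] by blast+
      have "\<not> mx i (dd i)"
      proof
        assume m: "mx i (dd i)"
        then have "dd i \<prec> d" by (simp add: mx_def)
        then obtain z where "z \<in> Ei j" "dd i \<prec> z" "z \<prec> d" using limptD[OF l(1)] by blast
        moreover from this have "z \<preceq> dd i" using m EE[OF ij] by (auto simp: mx_def)
        ultimately show False by order
      qed
      then have "dd i = d" using mx[OF i] by blast
      then show False using ddW[OF i] l(2) EW[OF ij] by auto
    qed
    then have jW: "dd j \<in> W (Ei i)" "dd j \<in> Ei i" "dd j \<prec> d" using EW[OF ij] EE[OF ij] by (auto simp: mx_def)
    then have "dd j \<preceq> dd i" using mx[OF i] by (auto simp: mx_def)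
    moreover have "dd j \<noteq> dd i" using jW(1) ddW[OF i] by metis
    ultimately show "dd j \<prec> dd i" by order
  qed
  then show False using \<open>infinite I\<close> by simp
qed

text \<open>The club for a single index is asked to guess \<open>D\<close> intersected with all the
  clubs. By \<open>clubfill_mono\<close> the points so guessed are also present when the
  intersection is used for filling.\<close>

lemma wide_club_guessing_simultaneous:
  assumes coh: "coherent Cs G" and thr: "threadless Cs G" and I: "|I| \<le>o lam"
    and t: "\<And>i. i \<in> I \<Longrightarrow> Card_order (t i)" "\<And>i. i \<in> I \<Longrightarrow> t i <o lam"
    and stat: "\<And>i g. i \<in> I \<Longrightarrow> \<forall>x\<in>F. g x \<in> F \<Longrightarrow> \<exists>a\<in>G \<inter> Cl g. cofp a (t i)"
  shows "\<exists>E. \<forall>i\<in>I. \<forall>D. Club D \<longrightarrow>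
     (\<exists>a\<in>G. cofp a (t i) \<and> (\<forall>C\<in>Cs a. limpt (Nacc (extend (clubfill E) C) \<inter> D) a))"
proof -
  have "\<forall>i\<in>I. \<exists>E. Club E \<and> (\<forall>D. Club D \<longrightarrow>
     (\<exists>a\<in>G. cofp a (t i) \<and> (\<forall>C\<in>Cs a. limpt (Nacc (extend (clubfill E) C) \<inter> D) a)))"
    by (rule ballI, rule wide_club_guessing[OF coh thr t stat]) auto
  from bchoice[OF this] obtain E where E: "\<forall>i\<in>I. Club (E i) \<and> (\<forall>D. Club D \<longrightarrow>
     (\<exists>a\<in>G. cofp a (t i) \<and> (\<forall>C\<in>Cs a. limpt (Nacc (extend (clubfill (E i)) C) \<inter> D) a)))" ..
  let ?E = "F \<inter> (\<Inter>i\<in>I. E i)"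
  have clubE: "Club ?E" using Club_Inter[of I E] E I by blast
  show ?thesis
  proof (intro exI[of _ ?E] ballI allI impI)
    fix i D assume i: "i \<in> I" and D: "Club D"
    have "Club (F \<inter> (\<Inter>X\<in>{D, ?E}. X))"
      by (rule Club_Inter) (use D clubE in \<open>auto intro: finite_le_lam\<close>)
    then obtain a where a: "a \<in> G" "cofp a (t i)"
      "\<And>C. C \<in> Cs a \<Longrightarrow> limpt (Nacc (extend (clubfill (E i)) C) \<inter> (F \<inter> (\<Inter>X\<in>{D, ?E}. X))) a"
      using E i by blast
    have "limpt (Nacc (extend (clubfill ?E) C) \<inter> D) a" if C: "C \<in> Cs a" for C
    proof (rule limpt_mono[OF a(3)[OF C]], rule subsetI)
      fix z assume "z \<in> Nacc (extend (clubfill (E i)) C) \<inter> (F \<inter> (\<Inter>X\<in>{D, ?E}. X)) \<inter> below a"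
      then have z: "z \<in> Nacc (extend (clubfill (E i)) C)" "z \<in> ?E" "z \<in> D" by auto
      have "club C a" using coh a(1) C by (simp add: coherent_def)
      then have "z \<in> Nacc (extend (clubfill ?E) C)"
        by (rule clubfill_mono[OF _ _ z(1,2)]) (use i in blast)
      then show "z \<in> Nacc (extend (clubfill ?E) C) \<inter> D" using z(3) by blast
    qed
    then show "\<exists>a\<in>G. cofp a (t i) \<and> (\<forall>C\<in>Cs a. limpt (Nacc (extend (clubfill ?E) C) \<inter> D) a)"
      using a(1,2) by blast
  qed
qed

end

section \<open>Injective choices and dense families\<close>

lemma injective_choice:
  assumes r: "Card_order r" and P: "\<forall>i\<in>Field r. r \<le>o |P i|"
  shows "\<exists>f. inj_on f (Field r) \<and> (\<forall>i\<in>Field r. f i \<in> P i)"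
proof -
  have wo: "Well_order r" using r card_order_on_well_order_on by blast
  from underS_recursion[OF wo, of "\<lambda>i g. SOME x. x \<in> P i - g ` underS r i"]
  obtain f where f: "\<forall>i. f i = (SOME x. x \<in> P i - (\<lambda>j. if j \<in> underS r i then f j else undefined) ` underS r i)" ..
  have f: "f i = (SOME x. x \<in> P i - f ` underS r i)" for i using f[rule_format, of i] by simp
  have fP: "f i \<in> P i - f ` underS r i" if i: "i \<in> Field r" for i
  proof -
    have "|f ` underS r i| <o r"
      using card_of_image card_of_underS[OF r i] by (rule ordLeq_ordLess_trans)
    then have "\<not> r \<le>o |f ` underS r i|" using not_ordLess_ordLeq by blast
    then have "\<not> P i \<subseteq> f ` underS r i" using P i card_of_mono1 ordLeq_transitive by blast
    then have "\<exists>x. x \<in> P i - f ` underS r i" by blast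
    from someI_ex[OF this] show ?thesis using f[of i] by simp
  qed
  have "inj_on f (Field r)"
  proof (rule inj_onI)
    fix i j assume ij: "i \<in> Field r" "j \<in> Field r" "f i = f j"
    have "i = j \<or> i \<in> underS r j \<or> j \<in> underS r i"
      using wo ij unfolding well_order_on_def linear_order_on_def total_on_def underS_def by auto
    moreover have "i \<notin> underS r j" using fP[OF ij(2)] ij(3) by (metis DiffE imageI)
    moreover have "j \<notin> underS r i" using fP[OF ij(1)] ij(3) by (metis DiffE imageI)
    ultimately show "i = j" by blast
  qed
  then show ?thesis using fP by blast
qed

lemma Card_order_fibres:
  assumes t: "Cinfinite t"
  shows "\<exists>p. p ` Field t \<subseteq> Field t \<and> (\<forall>i\<in>Field t. t \<le>o |{s \<in> Field t. p s = i}| )"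
proof -
  have inf: "infinite (Field t)" using t by (simp add: cinfinite_def)
  have "|Field t| =o |Field t \<times> Field t|"
    using card_of_Times_same_infinite[OF inf] ordIso_symmetric by blast
  then obtain h where h: "bij_betw h (Field t) (Field t \<times> Field t)" using card_of_ordIso by blast
  have "t \<le>o |{s \<in> Field t. fst (h s) = i}|" if i: "i \<in> Field t" for i
  proof -
    have "Field t \<subseteq> (snd \<circ> h) ` {s \<in> Field t. fst (h s) = i}"
    proof
      fix j assume "j \<in> Field t"
      then have "(i, j) \<in> h ` Field t" using h i by (simp add: bij_betw_def)
      then obtain s where "s \<in> Field t" "h s = (i, j)" by auto
      then show "j \<in> (snd \<circ> h) ` {s \<in> Field t. fst (h s) = i}" by force
    qed
    then have "|Field t| \<le>o |{s \<in> Field t. fst (h s) = i}|" by (rule surj_imp_ordLeq)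
    then show ?thesis
      using t card_of_Field_ordIso[of t] ordIso_symmetric ordIso_ordLeq_trans by blast
  qed
  moreover have "fst (h s) \<in> Field t" if "s \<in> Field t" for s
    using h that by (auto simp: bij_betw_def dest!: equalityD1 )
  ultimately show ?thesis by (intro exI[of _ "fst \<circ> h"]) auto
qed

lemma Restr_underS_inj:
  assumes "Well_order t" "s \<in> Field t" "s' \<in> Field t"
    "Restr t (underS t s) =o Restr t (underS t s')"
  shows "s = s'"
proof -
  interpret wo_rel t using assms by (simp add: wo_rel_def)
  have *: False if "u \<in> underS u'" "Restr t (underS u) =o Restr t (underS u')" for u u'
  proof -
    have "underS u \<subseteq> underS u'" using that(1) TRANS ANTISYM
      unfolding underS_def trans_def antisym_def by blast
    moreover have "u \<notin> underS u" by (simp add: underS_def)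
    ultimately have "underS u \<subset> underS u'" using that(1) by blast
    then have "Restr t (underS u) <o Restr t (underS u')"
      using ofilter_subset_ordLess[OF WELL underS_ofilter underS_ofilter] by blast
    then show False using that(2) not_ordLess_ordIso by blast
  qed
  have "s = s' \<or> s \<in> underS s' \<or> s' \<in> underS s"
    using TOTALS assms(2,3) unfolding underS_def by blast
  then show ?thesis using * assms(4) ordIso_symmetric by blast
qed

context succ_card
begin

lemma cofp_bdd:
  assumes a: "cofp a t" and B: "B \<subseteq> below a" "|B| <o t"
  obtains b where "b \<prec> a" "\<forall>x\<in>B. x \<preceq> b"
proof -
  have "\<not> limpt B a" using a B not_ordLess_ordLeq unfolding cofp_def by blast
  moreover have "\<exists>b. b \<prec> a" using a unfolding cofp_def limpt_def by blast
  ultimately obtain b where b: "b \<prec> a" "\<forall>c\<in>B. b \<prec> c \<longrightarrow> \<not> c \<prec> a" unfolding limpt_def by blast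
  then have "\<forall>x\<in>B. x \<preceq> b" using B(1) not_le by blast
  then show thesis using b that by blast
qed

definition ord_on :: "'k set \<Rightarrow> 'k rel" where
  "ord_on B = {(x, y). x \<in> B \<and> y \<in> B \<and> x \<preceq> y}"

lemma Field_ord_on: "Field (ord_on B) = B"
  by (auto simp: ord_on_def Field_def)

lemma Well_order_ord_on: "Well_order (ord_on B)"
proof -
  have "wf {(x, y). x \<prec> y}" unfolding wf_def using less_induct by auto
  moreover have "ord_on B - Id \<subseteq> {(x, y). x \<prec> y}" by (auto simp: ord_on_def le_less)
  ultimately have "wf (ord_on B - Id)" by (rule wf_subset)
  then show ?thesis
    unfolding well_order_on_def linear_order_on_def partial_order_on_def preorder_on_def
      refl_on_def total_on_def trans_def antisym_def Field_ord_on
    by (auto simp: ord_on_def intro: order_trans)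
qed

lemma Restr_ord_on: "Restr (ord_on B) C = ord_on (B \<inter> C)"
  by (auto simp: ord_on_def)

lemma underS_ord_on: "b \<in> B \<Longrightarrow> underS (ord_on B) b = B \<inter> below b"
  by (auto simp: ord_on_def underS_def)

lemma ord_on_iso_Card_order:
  assumes t: "Card_order t" and B: "t \<le>o |B|" and small: "\<And>b. b \<in> B \<Longrightarrow> |B \<inter> below b| <o t"
  shows "ord_on B =o t"
proof -
  have wt: "Well_order t" using t card_order_on_well_order_on by blast
  have "|B| \<le>o ord_on B"
    using card_of_least[of B "ord_on B"] Well_order_ord_on[of B] by (simp add: Field_ord_on)
  then have 1: "t \<le>o ord_on B" using B ordLeq_transitive by blast
  have "\<not> t <o ord_on B"
  proof
    assume "t <o ord_on B"
    then obtain b where b: "b \<in> Field (ord_on B)" "t =o Restr (ord_on B) (underS (ord_on B) b)"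
      using ordLess_iff_ordIso_Restr[OF Well_order_ord_on wt] by blast
    have bB: "b \<in> B" using b(1) by (simp add: Field_ord_on)
    have "t =o ord_on (B \<inter> below b)" using b(2) by (simp add: Restr_ord_on underS_ord_on[OF bB])
    then have "|Field t| =o |B \<inter> below b|" using card_of_cong Field_ord_on by metis
    then have "t =o |B \<inter> below b|"
      using card_of_Field_ordIso[OF t] ordIso_symmetric ordIso_transitive by blast
    then show False using small[OF bB] not_ordLess_ordIso ordIso_symmetric by blast
  qed
  then show ?thesis using 1 ordLeq_iff_ordLess_or_ordIso ordIso_symmetric by blast
qed

text \<open>The value \<open>pick (R \<inter> below c)\<close> depends on the position of \<open>c\<close> within its block of \<open>R\<close>, where two
  points are in the same block if fewer than \<open>t\<close> points of \<open>R\<close> lie between them.\<close>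

lemma ex_pick:
  fixes t :: "'x rel"
  assumes t: "Cinfinite t"
  shows "\<exists>pick. \<forall>a R. cofp a t \<longrightarrow> R \<subseteq> below a \<longrightarrow> limpt R a \<longrightarrow>
    (\<forall>i\<in>Field t. \<forall>b. b \<prec> a \<longrightarrow> (\<exists>c\<in>R. b \<prec> c \<and> pick (R \<inter> below c) = i))"
proof -
  have tc: "Card_order t" and wt: "Well_order t" using t card_order_on_well_order_on by blast+
  have tinf: "infinite (Field t)" using t by (simp add: cinfinite_def)
  obtain p where p: "\<forall>i\<in>Field t. t \<le>o |{s \<in> Field t. p s = i}|"
    using Card_order_fibres[OF t] by blast
  \<comment> \<open>Here \<open>blk H\<close> is the last block of \<open>H\<close> and
    \<open>off H\<close> its order type, as a point of \<open>t\<close>. For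
    \<open>H = R \<inter> below c\<close> this will be the position of \<open>c\<close> in its
    block.\<close>
  define blk where "blk H = {h \<in> H. |{h' \<in> H. h \<preceq> h'}| <o t}" for H :: "'k set"
  define off where "off H = (SOME s. s \<in> Field t \<and> ord_on (blk H) =o Restr t (underS t s))" for H
  have Un: "|A \<union> B| <o t" if "|A| <o t" "|B| <o t" for A B :: "'k set"
    using Un_Cinfinite_bound_strict[OF that t] .
  have small: "|A| <o t" if "A \<subseteq> B" "|B| <o t" for A B :: "'k set"
    using card_of_mono1[OF that(1)] that(2) by (rule ordLeq_ordLess_trans)
  have fin: "|A| <o t" if "finite A" for A :: "'k set"
    using that tinf finite_ordLess_infinite[OF card_of_Well_order wt] by (simp add: Field_card_of)
  have "\<exists>c\<in>R. b \<prec> c \<and> p (off (R \<inter> below c)) = i"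
    if a: "cofp a t" "R \<subseteq> below a" "limpt R a" and i: "i \<in> Field t" and b: "b \<prec> a" for a R i b
  proof -
    obtain m where m: "m \<in> R" "b \<prec> m" "m \<prec> a" using limptD[OF a(3) b] by blast
    \<comment> \<open>The block of \<open>m\<close> in \<open>R\<close>. It has order type
      \<open>t\<close>: the part below any of its points has fewer than \<open>t\<close> elements.
      If the whole block had fewer than \<open>t\<close>, then either the next point of
      \<open>R\<close> would belong to it, or a tail of \<open>R\<close> would be too small to be
      cofinal in \<open>a\<close>.\<close>
    define Q where "Q = {x \<in> R. |{h \<in> R. x \<preceq> h \<and> h \<preceq> m}| <o t \<and> |{h \<in> R. m \<preceq> h \<and> h \<preceq> x}| <o t}"
    have blkQ: "blk (R \<inter> below c) = Q \<inter> below c" if c: "c \<in> Q" for c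
    proof -
      have cR: "c \<in> R" and c1: "|{h \<in> R. c \<preceq> h \<and> h \<preceq> m}| <o t" and c2: "|{h \<in> R. m \<preceq> h \<and> h \<preceq> c}| <o t"
        using c by (auto simp: Q_def)
      have "|{h' \<in> R \<inter> below c. h \<preceq> h'}| <o t \<longleftrightarrow> h \<in> Q" if h: "h \<in> R" "h \<prec> c" for h
      proof
        assume l: "|{h' \<in> R \<inter> below c. h \<preceq> h'}| <o t"
        have "{x \<in> R. h \<preceq> x \<and> x \<preceq> m} \<subseteq> {h' \<in> R \<inter> below c. h \<preceq> h'} \<union> {h \<in> R. c \<preceq> h \<and> h \<preceq> m}"
          by (auto simp: not_le[symmetric])
        then have "|{x \<in> R. h \<preceq> x \<and> x \<preceq> m}| <o t" by (rule small[OF _ Un[OF l c1]])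
        moreover have "{x \<in> R. m \<preceq> x \<and> x \<preceq> h} \<subseteq> {h \<in> R. m \<preceq> h \<and> h \<preceq> c}"
          using h(2) by auto
        then have "|{x \<in> R. m \<preceq> x \<and> x \<preceq> h}| <o t" by (rule small[OF _ c2])
        ultimately show "h \<in> Q" using h by (simp add: Q_def)
      next
        assume "h \<in> Q"
        then have l: "|{x \<in> R. h \<preceq> x \<and> x \<preceq> m}| <o t" by (simp add: Q_def)
        have "{h' \<in> R \<inter> below c. h \<preceq> h'} \<subseteq> {x \<in> R. h \<preceq> x \<and> x \<preceq> m} \<union> {h \<in> R. m \<preceq> h \<and> h \<preceq> c}"
          by auto
        then show "|{h' \<in> R \<inter> below c. h \<preceq> h'}| <o t" by (rule small[OF _ Un[OF l c2]])
      qed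
      moreover have "Q \<subseteq> R" by (auto simp: Q_def)
      ultimately show ?thesis unfolding blk_def by auto
    qed
    have blk_small: "|blk H| <o t" for H
    proof (cases "blk H = {}")
      case True then show ?thesis using fin by simp
    next
      case False
      have "minel (blk H) \<in> blk H" by (rule minel_in[OF False])
      then have "|{h' \<in> H. minel (blk H) \<preceq> h'}| <o t" by (simp add: blk_def)
      moreover have "blk H \<subseteq> {h' \<in> H. minel (blk H) \<preceq> h'}"
        using minel_le[of _ "blk H"] by (auto simp: blk_def)
      ultimately show ?thesis using small by blast
    qed
    have tQ: "t \<le>o |Q|"
    proof (rule ccontr)
      assume "\<not> t \<le>o |Q|"
      then have Ql: "|Q| <o t" using not_ordLeq_iff_ordLess[OF card_of_Well_order wt] by blast
      let ?U = "{x \<in> R. m \<preceq> x \<and> x \<notin> Q}"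
      show False
      proof (cases "?U = {}")
        case True
        have "limpt {x \<in> R. m \<prec> x} a" unfolding limpt_def
        proof (intro conjI allI impI)
          fix x assume "x \<prec> a"
          define x' where "x' = (if x \<prec> m then m else x)"
          have "x' \<prec> a" "m \<preceq> x'" "x \<preceq> x'" using m(3) \<open>x \<prec> a\<close> by (auto simp: x'_def not_less less_imp_le)
          then obtain c where "c \<in> R" "x' \<prec> c" "c \<prec> a" using limptD[OF a(3)] by blast
          then show "\<exists>c\<in>{x \<in> R. m \<prec> x}. x \<prec> c \<and> c \<prec> a" using \<open>m \<preceq> x'\<close> \<open>x \<preceq> x'\<close>
            by (intro bexI[of _ c]) (auto intro: le_less_trans)
        qed (use b in blast)
        moreover have "{x \<in> R. m \<prec> x} \<subseteq> below a" using a(2) by blast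
        ultimately have "t \<le>o |{x \<in> R. m \<prec> x}|" using a(1) unfolding cofp_def by blast
        moreover have "{x \<in> R. m \<prec> x} \<subseteq> Q" using True by auto
        ultimately show False using small[OF _ Ql] not_ordLess_ordLeq by blast
      next
        case False
        define u where "u = minel ?U"
        have u: "u \<in> R" "m \<preceq> u" "u \<notin> Q" using minel_in[OF False] by (auto simp: u_def)
        have u': "x \<in> Q" if "x \<in> R" "m \<preceq> x" "x \<prec> u" for x
        proof (rule ccontr)
          assume "x \<notin> Q"
          then have "u \<preceq> x" using minel_le[of x ?U] that by (simp add: u_def)
          then show False using that(3) by order
        qed
        have "{h \<in> R. m \<preceq> h \<and> h \<preceq> u} \<subseteq> Q \<union> {u}" using u' by (auto simp: le_less)
        then have "|{h \<in> R. m \<preceq> h \<and> h \<preceq> u}| <o t" by (rule small[OF _ Un[OF Ql fin]]) simp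
        moreover have "{h \<in> R. u \<preceq> h \<and> h \<preceq> m} \<subseteq> {m}" using u(2) by (auto intro: order.antisym order_trans)
        then have "|{h \<in> R. u \<preceq> h \<and> h \<preceq> m}| <o t" by (rule small[OF _ fin]) simp
        ultimately show False using u by (simp add: Q_def)
      qed
    qed
    have Qsm: "|Q \<inter> below c| <o t" if "c \<in> Q" for c using blk_small[of "R \<inter> below c"] blkQ[OF that] by simp
    have "ord_on Q =o t" by (rule ord_on_iso_Card_order[OF tc tQ Qsm])
    then obtain f where "iso (ord_on Q) t f" unfolding ordIso_def by blast
    then have "bij_betw f Q (Field t) \<and> (\<forall>x\<in>Q. \<forall>y\<in>Q. ((x, y) \<in> ord_on Q) = ((f x, f y) \<in> t))"
      unfolding iso_iff2 Field_ord_on .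
    then have f: "bij_betw f Q (Field t)" "\<And>x y. x \<in> Q \<Longrightarrow> y \<in> Q \<Longrightarrow> x \<preceq> y \<longleftrightarrow> (f x, f y) \<in> t"
      by (auto simp: ord_on_def)
    have fF: "f x \<in> Field t" if "x \<in> Q" for x using f(1) that by (auto simp: bij_betw_def)
    have finj: "f x = f y \<longleftrightarrow> x = y" if "x \<in> Q" "y \<in> Q" for x y
      using f(1) that by (auto simp: bij_betw_def inj_on_def)
    have off: "off (R \<inter> below c) = f c" if c: "c \<in> Q" for c
    proof -
      have im: "f ` (Q \<inter> below c) = underS t (f c)"
      proof (intro subset_antisym subsetI)
        fix s assume "s \<in> f ` (Q \<inter> below c)"
        then obtain x where x: "x \<in> Q" "x \<prec> c" "s = f x" by blast
        then have "(f x, f c) \<in> t" using f(2)[OF x(1) c] less_imp_le[OF x(2)] by blast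
        then show "s \<in> underS t (f c)"
          using finj[OF x(1) c] x by (auto simp: underS_def)
      next
        fix s assume s: "s \<in> underS t (f c)"
        then have "s \<in> Field t" by (auto simp: underS_def Field_def)
        then obtain x where x: "x \<in> Q" "s = f x" using f(1) by (auto simp: bij_betw_def)
        then have "x \<preceq> c" "x \<noteq> c" using s f(2)[OF x(1) c] by (auto simp: underS_def)
        then show "s \<in> f ` (Q \<inter> below c)" using x by (auto simp: le_less)
      qed
      have Fu: "Field (Restr t (underS t (f c))) = underS t (f c)"
      proof -
        have "Refl t" using wt by (simp add: well_order_on_def linear_order_on_def partial_order_on_def preorder_on_def)
        then show ?thesis by (rule Refl_Field_Restr2) (auto simp: underS_def Field_def)
      qed
      have "iso (ord_on (Q \<inter> below c)) (Restr t (underS t (f c))) f"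
        unfolding iso_iff2 Field_ord_on Fu
      proof (intro conjI ballI)
        have "inj_on f (Q \<inter> below c)" using f(1) by (auto simp: bij_betw_def intro: inj_on_subset)
        then show "bij_betw f (Q \<inter> below c) (underS t (f c))" using im by (simp add: bij_betw_def)
        fix x y assume xy: "x \<in> Q \<inter> below c" "y \<in> Q \<inter> below c"
        then have "f x \<in> underS t (f c)" "f y \<in> underS t (f c)" using im by blast+
        then show "((x, y) \<in> ord_on (Q \<inter> below c)) = ((f x, f y) \<in> Restr t (underS t (f c)))"
          using xy f(2)[of x y] by (auto simp: ord_on_def)
      qed
      then have iso: "ord_on (blk (R \<inter> below c)) =o Restr t (underS t (f c))"
        using Well_order_ord_on Well_order_Restr[OF wt] unfolding ordIso_def blkQ[OF c] by blast
      have "off (R \<inter> below c) \<in> Field t \<and> ord_on (blk (R \<inter> below c)) =o Restr t (underS t (off (R \<inter> below c)))"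
        unfolding off_def by (rule someI[of _ "f c"]) (use iso fF[OF c] in blast)
      then show ?thesis
        using Restr_underS_inj[OF wt _ fF[OF c]] iso ordIso_symmetric ordIso_transitive by blast
    qed
    have mQ: "m \<in> Q"
    proof -
      have "{h \<in> R. m \<preceq> h \<and> h \<preceq> m} \<subseteq> {m}" by auto
      then have "|{h \<in> R. m \<preceq> h \<and> h \<preceq> m}| <o t" by (rule small[OF _ fin]) simp
      then show ?thesis using m(1) by (simp add: Q_def)
    qed
    \<comment> \<open>The value \<open>i\<close> is assigned to \<open>t\<close> many positions of
      the block, while fewer than \<open>t\<close> of its points lie below \<open>m\<close>. So
      these positions are not all at or below \<open>b\<close>.\<close>
    show ?thesis
    proof (rule ccontr)
      assume no: "\<not> ?thesis"
      have "{s \<in> Field t. p s = i} \<subseteq> f ` (Q \<inter> below m)"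
      proof
        fix s assume s: "s \<in> {s \<in> Field t. p s = i}"
        then obtain c where c: "c \<in> Q" "s = f c" using f(1) by (auto simp: bij_betw_def)
        then have "p (off (R \<inter> below c)) = i" using off s by simp
        moreover have "c \<in> R" using c by (simp add: Q_def)
        ultimately have "\<not> b \<prec> c" using no by blast
        then have "c \<prec> m" using m(2) by order
        then show "s \<in> f ` (Q \<inter> below m)" using c by blast
      qed
      then have "|{s \<in> Field t. p s = i}| \<le>o |f ` (Q \<inter> below m)|" by (rule card_of_mono1)
      also have "|f ` (Q \<inter> below m)| \<le>o |Q \<inter> below m|" by (rule card_of_image)
      also have "|Q \<inter> below m| <o t" by (rule Qsm[OF mQ])
      finally show False using p i not_ordLess_ordLeq by blast
    qed
  qed
  then show ?thesis by (intro exI[of _ "\<lambda>H. p (off H)"]) blast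
qed

text \<open>If a single value of \<open>f\<close> occurs cofinally often, a singleton in
  \<open>W\<close> suffices. Otherwise every tail of \<open>N\<close> has at least \<open>t\<close>
  values, and choosing different values from \<open>t\<close> many tails gives a set of size
  \<open>t\<close>. A subset of size \<open>t\<close> that belongs to \<open>W\<close> uses
  arbitrarily late tails.\<close>

lemma dense_cofinal_fibres:
  fixes t :: "'x rel" and f :: "'k \<Rightarrow> 'l"
  assumes t: "Cinfinite t"
    and dense: "\<And>X. X \<subseteq> Field lam \<Longrightarrow> |X| =o t \<Longrightarrow> \<exists>Y\<in>W. Y \<subseteq> X \<and> |Y| =o t"
    and single: "\<And>x. x \<in> Field lam \<Longrightarrow> {x} \<in> W"
    and a: "cofp a t" and N: "N \<subseteq> below a" "limpt N a" "f ` N \<subseteq> Field lam"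
  shows "\<exists>w\<in>W. limpt {n \<in> N. f n \<in> w} a"
proof (cases "\<exists>x\<in>Field lam. limpt {n \<in> N. f n = x} a")
  case True then show ?thesis using single by force
next
  case False
  have tc: "Card_order t" and wt: "Well_order t" using t card_order_on_well_order_on by blast+
  interpret t: wo_rel t using wt by (simp add: wo_rel_def)
  obtain c where c: "c \<subseteq> below a" "limpt c a" "|c| =o t" using a by (auto simp: cofp_def)
  have tF: "t =o |Field t|" using card_of_Field_ordIso[OF tc] ordIso_symmetric by blast
  have "|Field t| =o |c|" using card_of_Field_ordIso[OF tc] c(3) ordIso_symmetric ordIso_transitive by blast
  then obtain e where e: "bij_betw e (Field t) c" using card_of_ordIso by blast
  define Ns where "Ns s = {n \<in> N. \<forall>s'. (s', s) \<in> t \<longrightarrow> e s' \<prec> n}" for s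
  have exa: "\<exists>b. b \<prec> a" using N(2) by (simp add: limpt_def)
  have "\<forall>v\<in>f ` N. \<exists>b. b \<prec> a \<and> (\<forall>n\<in>N. f n = v \<longrightarrow> n \<preceq> b)"
  proof
    fix v assume "v \<in> f ` N"
    then have "\<not> limpt {n \<in> N. f n = v} a" using False N(3) by blast
    then obtain b where "b \<prec> a" "\<forall>c\<in>{n \<in> N. f n = v}. b \<prec> c \<longrightarrow> \<not> c \<prec> a"
      using exa unfolding limpt_def by blast
    then show "\<exists>b. b \<prec> a \<and> (\<forall>n\<in>N. f n = v \<longrightarrow> n \<preceq> b)" using N(1) not_le by blast
  qed
  from bchoice[OF this] obtain bv where bv: "\<forall>v\<in>f ` N. bv v \<prec> a \<and> (\<forall>n\<in>N. f n = v \<longrightarrow> n \<preceq> bv v)" ..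
  \<comment> \<open>With fewer than \<open>t\<close> values, their bounds \<open>bv\<close> and the
    start of the tail would be bounded by some \<open>b\<close> below \<open>a\<close>, and
    \<open>N\<close> would have no point above \<open>b\<close>.\<close>
  have big: "t \<le>o |f ` Ns s|" if s: "s \<in> Field t" for s
  proof (rule ccontr)
    assume "\<not> t \<le>o |f ` Ns s|"
    then have "|f ` Ns s| <o t" using not_ordLeq_iff_ordLess[OF card_of_Well_order wt] by blast
    with card_of_image have 1: "|bv ` f ` Ns s| <o t" by (rule ordLeq_ordLess_trans)
    have "under t s \<subseteq> insert s (underS t s)" by (auto simp: under_def underS_def)
    moreover have "|insert s (underS t s)| <o t"
    proof -
      have "|{s}| <o t" using finite_ordLess_infinite[OF card_of_Well_order wt, of "{s}"] t
        by (simp add: Field_card_of cinfinite_def)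
      then show ?thesis using Un_Cinfinite_bound_strict[OF _ card_of_underS[OF tc s] t, of "{s}"] by simp
    qed
    ultimately have "|under t s| <o t" using card_of_mono1 ordLeq_ordLess_trans by blast
    with card_of_image have 2: "|e ` under t s| <o t" by (rule ordLeq_ordLess_trans)
    have "|bv ` f ` Ns s \<union> e ` under t s| <o t" by (rule Un_Cinfinite_bound_strict[OF 1 2 t])
    moreover have "bv ` f ` Ns s \<union> e ` under t s \<subseteq> below a"
    proof -
      have "e x \<in> c" if "x \<in> under t s" for x
        using e that by (auto simp: bij_betw_def under_def Field_def)
      moreover have "bv ` f ` Ns s \<subseteq> below a" using bv by (auto simp: Ns_def)
      ultimately show ?thesis using c(1) by blast
    qed
    ultimately obtain b where b: "b \<prec> a" "\<forall>x\<in>bv ` f ` Ns s \<union> e ` under t s. x \<preceq> b"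
      using cofp_bdd[OF a] by blast
    obtain n where n: "n \<in> N" "b \<prec> n" using limptD[OF N(2) b(1)] by blast
    have "n \<in> Ns s" using n b(2) by (auto simp: Ns_def under_def intro: le_less_trans)
    then have "bv (f n) \<preceq> b" using b(2) by blast
    moreover have "n \<preceq> bv (f n)" using bv n(1) by blast
    ultimately show False using n(2) by order
  qed
  then obtain v where v: "inj_on v (Field t)" "\<forall>s\<in>Field t. v s \<in> f ` Ns s"
    using injective_choice[OF tc, of "\<lambda>s. f ` Ns s"] by blast
  let ?Y = "v ` Field t"
  have "?Y \<subseteq> Field lam" using v(2) N(3) by (auto simp: Ns_def)
  moreover have "|?Y| =o t"
  proof -
    have "|Field t| =o |?Y|" using card_of_ordIso[of "Field t" ?Y] v(1) by (auto simp: bij_betw_def)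
    then show ?thesis using tF ordIso_symmetric ordIso_transitive by blast
  qed
  ultimately obtain Y where Y: "Y \<in> W" "Y \<subseteq> ?Y" "|Y| =o t" using dense by blast
  have "limpt {n \<in> N. f n \<in> Y} a" unfolding limpt_def
  proof (intro conjI allI impI)
    fix b assume "b \<prec> a"
    then obtain x where "x \<in> c" "b \<prec> x" using limptD[OF c(2)] by blast
    then obtain s0 where s0: "s0 \<in> Field t" "b \<prec> e s0" using e by (auto simp: bij_betw_def)
    have "\<exists>s\<in>Field t. v s \<in> Y \<and> (s0, s) \<in> t"
    proof (rule ccontr)
      assume no: "\<not> ?thesis"
      have "Y \<subseteq> v ` underS t s0"
      proof
        fix z assume z: "z \<in> Y"
        then obtain s where s: "s \<in> Field t" "z = v s" using Y(2) by blast
        then have "(s0, s) \<notin> t" using no z by blast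
        then have "s \<in> underS t s0" using t.TOTALS s0(1) s(1) by (auto simp: underS_def)
        then show "z \<in> v ` underS t s0" using s by blast
      qed
      then have "|Y| \<le>o |v ` underS t s0|" by (rule card_of_mono1)
      also have "|v ` underS t s0| \<le>o |underS t s0|" by (rule card_of_image)
      also have "|underS t s0| <o t" by (rule card_of_underS[OF tc s0(1)])
      finally show False using Y(3) not_ordLess_ordIso by blast
    qed
    then obtain s where s: "s \<in> Field t" "v s \<in> Y" "(s0, s) \<in> t" by blast
    then obtain n where n: "n \<in> Ns s" "v s = f n" using v(2) by blast
    then have "n \<in> N" "e s0 \<prec> n" using s(3) by (auto simp: Ns_def)
    then show "\<exists>c\<in>{n \<in> N. f n \<in> Y}. b \<prec> c \<and> c \<prec> a"
      using N(1) n(2) s(2) s0(2) by (intro bexI[of _ n]) (auto intro: less_trans)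
  qed (rule exa)
  then show ?thesis using Y(1) by blast
qed

end

section \<open>Guessing families of cofinal sets\<close>

context succ_card
begin

lemma infinite_F: "infinite F"
proof
  assume "finite F"
  then have "\<exists>b\<in>F. \<forall>x\<in>F. x \<prec> b" using bdd[of F] finite_le_lam by blast
  then show False by blast
qed

text \<open>The bound \<open>b\<close> is part of the code, because \<open>M\<close> alone does not
  show up to which point it describes the unbounded sets.\<close>

lemma ex_decoding:
  fixes Idx :: "'x set"
  assumes pow: "|Pow (Field lam)| \<le>o |F|" and Idx: "|Idx| \<le>o lam"
  shows "\<exists>dec :: 'k \<Rightarrow> 'k \<times> ('x \<times> 'k) set. \<forall>b\<in>F. \<forall>M. M \<subseteq> Idx \<times> below b \<longrightarrow> (\<exists>x\<in>F. dec x = (b, M))"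
proof -
  let ?O = "SIGMA b:F. Pow (Idx \<times> below b)"
  have "|Pow (Idx \<times> below b)| \<le>o |F|" if b: "b \<in> F" for b
  proof -
    have "|Idx \<times> below b| \<le>o lam"
      using card_of_Times_ordLeq_infinite_Field[OF _ Idx small[OF b] lam_card] lam_Cinfinite
      by (simp add: cinfinite_def)
    then have "|Idx \<times> below b| \<le>o |Field lam|"
      using card_of_Field_ordIso[OF lam_card] ordIso_symmetric ordLeq_ordIso_trans by blast
    then obtain f where f: "inj_on f (Idx \<times> below b)" "f ` (Idx \<times> below b) \<subseteq> Field lam"
      using card_of_ordLeq by metis
    have "inj_on (image f) (Pow (Idx \<times> below b))" using f(1) by (rule inj_on_image_Pow)
    moreover have "image f ` Pow (Idx \<times> below b) \<subseteq> Pow (Field lam)" using f(2) by blast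
    ultimately have "|Pow (Idx \<times> below b)| \<le>o |Pow (Field lam)|" using card_of_ordLeq by blast
    then show ?thesis using pow by (rule ordLeq_transitive)
  qed
  then have "|?O| \<le>o |F|"
    using infinite_F by (intro card_of_Sigma_ordLeq_infinite ballI) (auto intro: card_of_mono1)
  moreover have "?O \<noteq> {}" using infinite_F by (metis SigmaI Pow_bottom empty_iff ex_in_conv finite.emptyI)
  ultimately obtain dec where dec: "dec ` F = ?O" using card_of_ordLeq2 by metis
  have "\<exists>x\<in>F. dec x = (b, M)" if "b \<in> F" "M \<subseteq> Idx \<times> below b" for b M
  proof -
    have "(b, M) \<in> dec ` F" using that by (simp add: dec)
    then show ?thesis by (metis imageE)
  qed
  then show ?thesis by blast
qed

text \<open>The strategy \<open>y\<close> is found among candidates indexed by \<open>w \<in> W\<close> and \<open>\<tau> < \<lambda>\<close>.  A point \<open>c\<close> trusts the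
  least code \<open>x < c\<close> whose \<open>\<lambda>\<close>-index lies in \<open>w\<close> and which is right about the counterexamples to all
  candidates \<open>(w, \<tau>')\<close> with \<open>\<tau>' < \<tau>\<close>.  If every candidate had a counterexample, all of them could be coded
  together; for the right \<open>w\<close>, each \<open>\<tau>\<close> would then rule out one more of the \<open>|w| < \<lambda>\<close> codes available
  at \<open>c\<close>.\<close>

lemma guessing_strategy:
  fixes t :: "'l rel"
  assumes t: "Cinfinite t" "t <o lam" "Field t \<subseteq> Field lam"
    and pow: "|Pow (Field lam)| \<le>o |F|"
    and dense: "\<forall>X. X \<subseteq> Field lam \<and> |X| =o t \<longrightarrow> (\<exists>Y\<in>D. Y \<subseteq> X)" "\<forall>Y\<in>D. |Y| =o t" "|D| \<le>o lam"
    and S: "\<forall>a\<in>S. a \<in> F \<and> cofp a t" and T: "\<forall>a\<in>S. T a \<subseteq> below a"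
    and guess: "\<forall>g. (\<forall>x\<in>F. g x \<in> F) \<longrightarrow> (\<exists>a\<in>S. limpt (Nacc (T a) \<inter> Cl g) a)"
  shows "\<exists>y. gap_filler y \<and> (\<forall>A :: 'l \<Rightarrow> 'k set. (\<forall>i\<in>Field t. unbounded (A i)) \<longrightarrow>
    (\<exists>a\<in>S. \<forall>i\<in>Field t. limpt {z \<in> A i. \<exists>c\<in>Nacc (T a). z \<in> y (T a \<inter> below c) c} a))"
proof (rule ccontr)
  assume contra: "\<not> ?thesis"
  have wl: "Well_order lam" using lam_card card_order_on_well_order_on by blast
  interpret L: wo_rel lam using wl by (simp add: wo_rel_def)
  have tc: "Card_order t" using t(1) by blast
  define W where "W = D \<union> (\<lambda>x. {x}) ` Field lam"
  have lamF: "|Field lam| \<le>o lam" using card_of_Field_ordIso[OF lam_card] ordIso_imp_ordLeq by blast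
  have Wlam: "|W| \<le>o lam"
    unfolding W_def by (rule Un_Cinfinite_bound[OF dense(3) ordLeq_transitive[OF card_of_image lamF] lam_Cinfinite])
  have Wt: "|w| \<le>o t" if "w \<in> W" for w
  proof (cases "w \<in> D")
    case True then show ?thesis using dense(2) ordIso_imp_ordLeq by blast
  next
    case False
    then have "finite w" using that by (auto simp: W_def)
    then have "|w| <o t" using finite_ordLess_infinite[of "|w|" t] t(1) card_of_Well_order[of w]
      card_order_on_well_order_on by (auto simp: Field_card_of cinfinite_def)
    then show ?thesis using ordLess_imp_ordLeq by blast
  qed
  define Idx where "Idx = W \<times> Field lam \<times> Field t"
  have "|Field t| \<le>o lam"
    using card_of_Field_ordIso[OF tc] t(2) ordIso_ordLess_trans ordLess_imp_ordLeq by blast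
  then have Idx: "|Idx| \<le>o lam"
    unfolding Idx_def using lam_Cinfinite Wlam lamF
    by (intro card_of_Times_ordLeq_infinite_Field[OF _ _ _ lam_card]) (auto simp: cinfinite_def)
  obtain dec :: "'k \<Rightarrow> 'k \<times> (('l set \<times> 'l \<times> 'l) \<times> 'k) set"
    where dec: "\<forall>b\<in>F. \<forall>M. M \<subseteq> Idx \<times> below b \<longrightarrow> (\<exists>x\<in>F. dec x = (b, M))"
    using ex_decoding[OF pow Idx] by (rule exE)
  obtain pick :: "'k set \<Rightarrow> 'l" where pick: "\<forall>a R. cofp a t \<longrightarrow> R \<subseteq> below a \<longrightarrow> limpt R a \<longrightarrow>
    (\<forall>i\<in>Field t. \<forall>b. b \<prec> a \<longrightarrow> (\<exists>c\<in>R. b \<prec> c \<and> pick (R \<inter> below c) = i))"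
    using ex_pick[OF t(1)] by (rule exE)
  \<comment> \<open>The \<lambda>-index of a code \<open>x\<close> below \<open>c\<close> is
    \<open>e c x\<close>; it depends on \<open>c\<close>.\<close>
  have "\<forall>c\<in>F. \<exists>e. inj_on e (below c) \<and> e ` below c \<subseteq> Field lam"
  proof
    fix c assume "c \<in> F"
    then have "|below c| \<le>o |Field lam|"
      using small card_of_Field_ordIso[OF lam_card] ordIso_symmetric ordLeq_ordIso_trans by blast
    then show "\<exists>e. inj_on e (below c) \<and> e ` below c \<subseteq> Field lam" by (simp add: card_of_ordLeq)
  qed
  from bchoice[OF this] obtain e where e: "\<forall>c\<in>F. inj_on (e c) (below c) \<and> e c ` below c \<subseteq> Field lam" ..
  define bb where "bb x = fst (dec x)" for x
  define MM where "MM x w \<tau> i = {z. ((w, \<tau>, i), z) \<in> snd (dec x)}" for x w \<tau> i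
  \<comment> \<open>The codes that \<open>c\<close> may trust at stage \<tau>. That the coded sets
    reach above \<open>B\<close> guarantees a point to add. Agreement with \<open>P\<close> is
    demanded only for earlier stages, so that \<open>P\<close> can be defined by recursion on the
    stage.\<close>
  define V where "V w \<tau> P B c = {x. x \<prec> c \<and> e c x \<in> w \<and> bb x \<preceq> c \<and>
      (\<forall>i\<in>Field t. MM x w \<tau> i \<subseteq> below (bb x) \<and> (\<exists>z\<in>MM x w \<tau> i. \<forall>d\<in>B. d \<prec> z)) \<and>
      (\<forall>\<sigma>\<in>underS lam \<tau>. \<forall>i\<in>Field t. MM x w \<sigma> i = P \<sigma> i \<inter> below (bb x))}"
    for w \<tau> and P :: "'l \<Rightarrow> 'l \<Rightarrow> 'k set" and B c
  \<comment> \<open>The points before \<open>c\<close> whose trusted code agrees with the one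
    trusted at \<open>c\<close>. This is computed without knowing \<open>P \<tau>\<close>; if the
    code trusted at \<open>c\<close> is right about \<open>P \<tau>\<close>, these are exactly the
    earlier points whose trusted codes are right.\<close>
  define H where "H w \<tau> P B c = {c' \<in> Nacc B. V w \<tau> P (B \<inter> below c') c' \<noteq> {} \<and>
      (\<forall>i\<in>Field t. MM (minel (V w \<tau> P (B \<inter> below c') c')) w \<tau> i =
        MM (minel (V w \<tau> P B c)) w \<tau> i \<inter> below (bb (minel (V w \<tau> P (B \<inter> below c') c'))))}"
    for w \<tau> P B c
  define Z where "Z w \<tau> P B c = {z \<in> MM (minel (V w \<tau> P B c)) w \<tau> (pick (H w \<tau> P B c)). \<forall>d\<in>B. d \<prec> z}"
    for w \<tau> P B c
  \<comment> \<open>The index of the set to be served is \<open>pick (H w \<tau> P B c)\<close>. If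
    the points with right codes are cofinal, every index is picked cofinally often.\<close>
  define y where "y w \<tau> P B c = {z. V w \<tau> P B c \<noteq> {} \<and> pick (H w \<tau> P B c) \<in> Field t \<and>
      z \<in> Z w \<tau> P B c \<and> (\<forall>z'\<in>Z w \<tau> P B c. z \<preceq> z')}" for w \<tau> P B c
  have y_cong: "y w \<tau> P = y w \<tau> P'" if "\<And>\<sigma>. \<sigma> \<in> underS lam \<tau> \<Longrightarrow> P \<sigma> = P' \<sigma>" for w \<tau> P P'
  proof -
    have "V w \<tau> P = V w \<tau> P'" unfolding V_def using that by simp
    then show ?thesis unfolding y_def Z_def H_def by simp
  qed
  have minV: "minel (V w \<tau> P B c) \<in> V w \<tau> P B c" if "V w \<tau> P B c \<noteq> {}" for w \<tau> P B c
    by (rule minel_in[OF that])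
  have gap: "gap_filler (y w \<tau> P)" for w \<tau> P
    unfolding gap_filler_def
  proof (intro conjI allI impI)
    fix B c z assume z: "z \<in> y w \<tau> P B c"
    then have m: "minel (V w \<tau> P B c) \<in> V w \<tau> P B c" using minV by (simp add: y_def)
    have i: "pick (H w \<tau> P B c) \<in> Field t" using z by (simp add: y_def)
    have zM: "z \<in> MM (minel (V w \<tau> P B c)) w \<tau> (pick (H w \<tau> P B c))" "\<forall>d\<in>B. d \<prec> z"
      using z by (auto simp: y_def Z_def)
    have "bb (minel (V w \<tau> P B c)) \<preceq> c" using m by (simp add: V_def)
    moreover have "MM (minel (V w \<tau> P B c)) w \<tau> (pick (H w \<tau> P B c)) \<subseteq> below (bb (minel (V w \<tau> P B c)))"
      using m i unfolding V_def by blast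
    ultimately show "z \<prec> c" using zM(1) by (auto intro: less_le_trans)
    show "\<forall>d\<in>B. d \<prec> z" by (rule zM(2))
    fix z' assume "z' \<in> y w \<tau> P B c"
    then show "z = z'" using z by (auto simp: y_def intro: order.antisym)
  qed
  define hit where "hit y A a i \<longleftrightarrow> limpt {z \<in> A i. \<exists>c\<in>Nacc (T a). z \<in> y (T a \<inter> below c) c} a"
    for y and A :: "'l \<Rightarrow> 'k set" and a i
  have "\<forall>y. \<exists>A :: 'l \<Rightarrow> 'k set. gap_filler y \<longrightarrow> (\<forall>i\<in>Field t. unbounded (A i)) \<and>
      (\<forall>a\<in>S. \<exists>i\<in>Field t. \<not> hit y A a i)"
  proof
    fix y
    show "\<exists>A :: 'l \<Rightarrow> 'k set. gap_filler y \<longrightarrow> (\<forall>i\<in>Field t. unbounded (A i)) \<and> (\<forall>a\<in>S. \<exists>i\<in>Field t. \<not> hit y A a i)"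
    proof (cases "gap_filler y")
      case True
      have "\<not> (\<forall>A. (\<forall>i\<in>Field t. unbounded (A i)) \<longrightarrow> (\<exists>a\<in>S. \<forall>i\<in>Field t. hit y A a i))"
      proof
        assume "\<forall>A. (\<forall>i\<in>Field t. unbounded (A i)) \<longrightarrow> (\<exists>a\<in>S. \<forall>i\<in>Field t. hit y A a i)"
        with True have "gap_filler y \<and> (\<forall>A. (\<forall>i\<in>Field t. unbounded (A i)) \<longrightarrow> (\<exists>a\<in>S. \<forall>i\<in>Field t. hit y A a i))"
          by (rule conjI)
        then show False unfolding hit_def using contra by (elim notE) (rule exI)
      qed
      then have "\<exists>A. \<not> ((\<forall>i\<in>Field t. unbounded (A i)) \<longrightarrow> (\<exists>a\<in>S. \<forall>i\<in>Field t. hit y A a i))"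
        by (rule not_all[THEN iffD1])
      then obtain A where "\<not> ((\<forall>i\<in>Field t. unbounded (A i)) \<longrightarrow> (\<exists>a\<in>S. \<forall>i\<in>Field t. hit y A a i))" ..
      then show ?thesis by (intro exI[of _ A]) simp
    qed simp
  qed
  from choice[OF this] obtain AA :: "('k set \<Rightarrow> 'k \<Rightarrow> 'k set) \<Rightarrow> 'l \<Rightarrow> 'k set" where
    AA: "\<forall>y. gap_filler y \<longrightarrow> (\<forall>i\<in>Field t. unbounded (AA y i)) \<and> (\<forall>a\<in>S. \<exists>i\<in>Field t. \<not> hit y (AA y) a i)" ..
  \<comment> \<open>For fixed \<open>w\<close>, the family \<open>P w \<tau>\<close> is a
    counterexample to the candidate \<open>(w, \<tau>)\<close>, which itself depends only on the
    counterexamples of earlier stages.\<close>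
  have "\<forall>w. \<exists>P. \<forall>\<tau>. P \<tau> = AA (y w \<tau> P)"
  proof
    fix w
    from underS_recursion[OF wl, of "\<lambda>\<tau> P. AA (y w \<tau> P)"]
    obtain P where P: "\<forall>\<tau>. P \<tau> = AA (y w \<tau> (\<lambda>\<sigma>. if \<sigma> \<in> underS lam \<tau> then P \<sigma> else undefined))" ..
    have "P \<tau> = AA (y w \<tau> P)" for \<tau>
      using P[rule_format, of \<tau>] y_cong[of \<tau> "\<lambda>\<sigma>. if \<sigma> \<in> underS lam \<tau> then P \<sigma> else undefined" P w] by simp
    then show "\<exists>P. \<forall>\<tau>. P \<tau> = AA (y w \<tau> P)" by blast
  qed
  from choice[OF this] obtain P where P: "\<forall>w \<tau>. P w \<tau> = AA (y w \<tau> (P w))" by blast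
  have Punb: "unbounded (P w \<tau> i)" if "i \<in> Field t" for w \<tau> i
    using AA gap P that by metis
  have Pfail: "\<exists>i\<in>Field t. \<not> hit (y w \<tau> (P w)) (P w \<tau>) a i" if "a \<in> S" for w \<tau> a
    using AA gap P that by metis
  \<comment> \<open>The traces below \<open>b\<close> of the counterexamples to all candidates,
    joined into a single set that can be coded.\<close>
  define B where "B b = {((w, \<tau>, i), z). (w, \<tau>, i) \<in> Idx \<and> z \<in> P w \<tau> i \<and> z \<prec> b}" for b
  define Q where "Q j = (case j of (w, \<tau>, i) \<Rightarrow> P w \<tau> i)" for j
  \<comment> \<open>Each of the coded sets gets a point between \<open>b\<close> and
    \<open>bst b\<close>, as the definition of \<open>V\<close> demands.\<close>
  have "\<forall>b\<in>F. \<exists>s. s \<in> F \<and> (\<forall>j\<in>Idx. \<exists>z\<in>Q j. b \<prec> z \<and> z \<prec> s)"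
  proof
    fix b assume b: "b \<in> F"
    have "\<forall>j\<in>Idx. \<exists>z. z \<in> F \<and> b \<prec> z \<and> z \<in> Q j"
    proof (clarsimp simp: Idx_def Q_def)
      fix w \<tau> i assume "i \<in> Field t"
      then show "\<exists>z. z \<in> F \<and> b \<prec> z \<and> z \<in> P w \<tau> i" using Punb[of i w \<tau>] b unfolding unbounded_def by blast
    qed
    from bchoice[OF this] obtain n where n: "\<forall>j\<in>Idx. n j \<in> F \<and> b \<prec> n j \<and> n j \<in> Q j" ..
    then obtain s where s: "s \<in> F" "\<forall>j\<in>Idx. n j \<prec> s" using bdd_image[OF Idx, of n] by blast
    show "\<exists>s. s \<in> F \<and> (\<forall>j\<in>Idx. \<exists>z\<in>Q j. b \<prec> z \<and> z \<prec> s)" using s n by blast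
  qed
  from bchoice[OF this] obtain bst where bst: "\<forall>b\<in>F. bst b \<in> F \<and> (\<forall>j\<in>Idx. \<exists>z\<in>Q j. b \<prec> z \<and> z \<prec> bst b)" ..
  have "\<forall>b\<in>F. \<exists>x. x \<in> F \<and> dec x = (bst b, B (bst b))"
  proof
    fix b assume "b \<in> F"
    then have "bst b \<in> F" using bst by blast
    moreover have "B (bst b) \<subseteq> Idx \<times> below (bst b)" by (auto simp: B_def)
    ultimately show "\<exists>x. x \<in> F \<and> dec x = (bst b, B (bst b))" using dec by blast
  qed
  from bchoice[OF this] obtain xB where xB: "\<forall>b\<in>F. xB b \<in> F \<and> dec (xB b) = (bst b, B (bst b))" ..
  \<comment> \<open>A closure point of \<open>g\<close> above \<open>b\<close> lies above the code
    \<open>xB b\<close> of the true counterexamples and above the bound recorded in it.\<close>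
  have "\<forall>b\<in>F. \<exists>u. u \<in> F \<and> bst b \<prec> u \<and> xB b \<prec> u"
  proof
    fix b assume b: "b \<in> F"
    have "{bst b, xB b} \<subseteq> F" using b bst xB by blast
    moreover have "|{bst b, xB b}| \<le>o lam" by (rule finite_le_lam) simp
    ultimately have "\<exists>u\<in>F. \<forall>x\<in>{bst b, xB b}. x \<prec> u" by (rule bdd)
    then show "\<exists>u. u \<in> F \<and> bst b \<prec> u \<and> xB b \<prec> u" by auto
  qed
  from bchoice[OF this] obtain g where g: "\<forall>b\<in>F. g b \<in> F \<and> bst b \<prec> g b \<and> xB b \<prec> g b" ..
  then obtain a where a: "a \<in> S" "limpt (Nacc (T a) \<inter> Cl g) a" using guess by blast
  have aF: "a \<in> F" "cofp a t" using S a(1) by blast+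
  have Ta: "T a \<subseteq> below a" using T a(1) by blast
  have TF: "c \<in> F" if "c \<in> T a" for c using Ta that aF(1) F_down by blast
  define N where "N = Nacc (T a) \<inter> Cl g"
  have NT: "c \<in> T a" if "c \<in> N" for c using that by (auto simp: N_def Nacc_def)
  have Nb: "N \<subseteq> below a" using NT Ta by blast
  \<comment> \<open>A point \<open>c\<close> of \<open>N\<close> is a limit ordinal but not a limit
    point of \<open>T a\<close>. So \<open>T a\<close> has a bound \<open>\<beta> c\<close> below
    \<open>c\<close>, and by closure the code \<open>X c\<close> of the true counterexamples below
    \<open>bst (\<beta> c)\<close> is available at \<open>c\<close>.\<close>
  have "\<forall>c\<in>N. \<exists>b. b \<prec> c \<and> (\<forall>d\<in>T a \<inter> below c. d \<preceq> b)"
  proof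
    fix c assume c: "c \<in> N"
    then have "\<not> limpt (T a) c" by (auto simp: N_def Nacc_def Acc_def)
    moreover have "\<exists>b. b \<prec> c" using c by (auto simp: N_def Cl_def limpt_def)
    ultimately obtain b where b: "b \<prec> c" "\<forall>d\<in>T a. b \<prec> d \<longrightarrow> \<not> d \<prec> c" unfolding limpt_def by blast
    have "d \<preceq> b" if "d \<in> T a \<inter> below c" for d using b(2) that not_le by blast
    then show "\<exists>b. b \<prec> c \<and> (\<forall>d\<in>T a \<inter> below c. d \<preceq> b)" using b(1) by blast
  qed
  from bchoice[OF this] obtain \<beta> where \<beta>: "\<forall>c\<in>N. \<beta> c \<prec> c \<and> (\<forall>d\<in>T a \<inter> below c. d \<preceq> \<beta> c)" ..
  define X where "X c = xB (\<beta> c)" for c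
  have X: "X c \<prec> c" "bst (\<beta> c) \<prec> c" "\<beta> c \<in> F" if c: "c \<in> N" for c
  proof -
    show bF: "\<beta> c \<in> F" using \<beta> c TF[OF NT[OF c]] F_down by blast
    have "g (\<beta> c) \<prec> c" using c \<beta> by (auto simp: N_def Cl_def)
    moreover have "bst (\<beta> c) \<prec> g (\<beta> c)" "xB (\<beta> c) \<prec> g (\<beta> c)" using g bF by blast+
    ultimately show "X c \<prec> c" "bst (\<beta> c) \<prec> c" unfolding X_def by order+
  qed
  have Xdec: "bb (X c) = bst (\<beta> c)" "dec (X c) = (bst (\<beta> c), B (bst (\<beta> c)))" if c: "c \<in> N" for c
    using xB X(3)[OF c] by (auto simp: X_def bb_def)
  have XM: "MM (X c) w \<tau> i = P w \<tau> i \<inter> below (bb (X c))" if "c \<in> N" "(w, \<tau>, i) \<in> Idx" for c w \<tau> i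
    using Xdec[OF that(1)] that(2) by (auto simp: MM_def B_def)
  define f where "f c = e c (X c)" for c
  have fF: "f ` N \<subseteq> Field lam"
  proof
    fix x assume "x \<in> f ` N"
    then obtain c where "c \<in> N" "x = e c (X c)" by (auto simp: f_def)
    then show "x \<in> Field lam" using e TF[OF NT] X(1) by blast
  qed
  have dense': "\<exists>Y\<in>W. Y \<subseteq> X \<and> |Y| =o t" if X: "X \<subseteq> Field lam" "|X| =o t" for X
  proof -
    obtain Y where "Y \<in> D" "Y \<subseteq> X" using dense(1) X by blast
    moreover from this have "|Y| =o t" using dense(2) by blast
    ultimately show ?thesis unfolding W_def by blast
  qed
  have "\<exists>w\<in>W. limpt {n \<in> N. f n \<in> w} a"
    by (rule dense_cofinal_fibres[OF t(1) dense' _ aF(2) Nb _ fF]) (use a(2) in \<open>auto simp: W_def N_def\<close>)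
  then obtain w where w: "w \<in> W" "limpt {n \<in> N. f n \<in> w} a" by blast
  \<comment> \<open>The true code passes the tests at every stage, provided that its index lies in
    \<open>w\<close>.\<close>
  have XV: "X c \<in> V w \<tau> (P w) (T a \<inter> below c) c" if c: "c \<in> N" "f c \<in> w" and \<tau>: "\<tau> \<in> Field lam" for c \<tau>
  proof -
    have "MM (X c) w \<sigma> i = P w \<sigma> i \<inter> below (bb (X c))" if "\<sigma> \<in> Field lam" "i \<in> Field t" for \<sigma> i
      using XM[OF c(1)] w(1) that by (simp add: Idx_def)
    moreover have "\<sigma> \<in> Field lam" if "\<sigma> \<in> underS lam \<tau>" for \<sigma> using that by (auto simp: underS_def Field_def)
    moreover have "\<exists>z\<in>P w \<tau> i \<inter> below (bb (X c)). \<forall>d\<in>T a \<inter> below c. d \<prec> z" if i: "i \<in> Field t" for i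
    proof -
      have "(w, \<tau>, i) \<in> Idx" using w(1) \<tau> i by (simp add: Idx_def)
      then have "\<exists>z\<in>Q (w, \<tau>, i). \<beta> c \<prec> z \<and> z \<prec> bst (\<beta> c)" using bst X(3)[OF c(1)] by blast
      then obtain z where "z \<in> P w \<tau> i" "\<beta> c \<prec> z" "z \<prec> bst (\<beta> c)" by (auto simp: Q_def)
      then show ?thesis using \<beta> c(1) Xdec(1)[OF c(1)] by (intro bexI[of _ z]) (auto intro: le_less_trans)
    qed
    ultimately show ?thesis
      using c X(1)[OF c(1)] less_imp_le[OF X(2)[OF c(1)]] Xdec(1)[OF c(1)] \<tau>
      unfolding V_def f_def by auto
  qed
  let ?V = "\<lambda>\<tau> c. V w \<tau> (P w) (T a \<inter> below c) c"
  let ?x = "\<lambda>\<tau> c. minel (?V \<tau> c)"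
  \<comment> \<open>The points whose trusted code is right about \<open>P w \<tau>\<close>. If they
    were cofinal in \<open>a\<close>, the candidate \<open>(w, \<tau>)\<close> would serve all the
    sets \<open>P w \<tau> i\<close> at \<open>a\<close>, against the choice of
    \<open>P w \<tau>\<close>.\<close>
  define R where "R \<tau> = {c \<in> Nacc (T a). ?V \<tau> c \<noteq> {} \<and>
      (\<forall>i\<in>Field t. MM (?x \<tau> c) w \<tau> i = P w \<tau> i \<inter> below (bb (?x \<tau> c)))}" for \<tau>
  have RT: "c \<in> T a" if "c \<in> R \<tau>" for c \<tau> using that by (auto simp: R_def Nacc_def)
  have TT: "T a \<inter> below c \<inter> below c' = T a \<inter> below c'" if "c' \<prec> c" for c c'
    using that by (auto intro: less_trans)
  have HR: "H w \<tau> (P w) (T a \<inter> below c) c = R \<tau> \<inter> below c" if c: "c \<in> R \<tau>" for \<tau> c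
  proof -
    have xc: "?x \<tau> c \<in> ?V \<tau> c" using c minV by (simp add: R_def)
    have eqv: "(?V \<tau> c' \<noteq> {} \<and> (\<forall>i\<in>Field t. MM (?x \<tau> c') w \<tau> i = MM (?x \<tau> c) w \<tau> i \<inter> below (bb (?x \<tau> c')))) \<longleftrightarrow>
        (?V \<tau> c' \<noteq> {} \<and> (\<forall>i\<in>Field t. MM (?x \<tau> c') w \<tau> i = P w \<tau> i \<inter> below (bb (?x \<tau> c'))))"
      if c': "c' \<in> Nacc (T a)" "c' \<prec> c" for c'
    proof (cases "?V \<tau> c' = {}")
      case False
      then have "bb (?x \<tau> c') \<preceq> c'" using minV[OF False] by (simp add: V_def)
      moreover have "c' \<prec> bb (?x \<tau> c)"
      proof -
        obtain i where i: "i \<in> Field t" using t(1) by (metis cinfinite_def ex_in_conv finite.emptyI)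
        then have "MM (?x \<tau> c) w \<tau> i \<subseteq> below (bb (?x \<tau> c))" "\<exists>z\<in>MM (?x \<tau> c) w \<tau> i. \<forall>d\<in>T a \<inter> below c. d \<prec> z"
          using xc unfolding V_def by blast+
        moreover have "c' \<in> T a \<inter> below c" using c' by (auto simp: Nacc_def)
        ultimately show ?thesis by (blast intro: less_trans)
      qed
      ultimately have "below (bb (?x \<tau> c)) \<inter> below (bb (?x \<tau> c')) = below (bb (?x \<tau> c'))"
        by (auto intro: less_le_trans less_trans)
      then have "P w \<tau> i \<inter> below (bb (?x \<tau> c)) \<inter> below (bb (?x \<tau> c')) = P w \<tau> i \<inter> below (bb (?x \<tau> c'))" for i
        by blast
      then show ?thesis using c by (simp add: R_def)
    qed simp
    have mem: "c' \<in> H w \<tau> (P w) (T a \<inter> below c) c \<longleftrightarrow> c' \<in> Nacc (T a) \<and> c' \<prec> c \<and> ?V \<tau> c' \<noteq> {} \<and>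
        (\<forall>i\<in>Field t. MM (?x \<tau> c') w \<tau> i = MM (?x \<tau> c) w \<tau> i \<inter> below (bb (?x \<tau> c')))" for c'
    proof (cases "c' \<prec> c")
      case True
      show ?thesis unfolding H_def Nacc_below mem_Collect_eq Int_iff TT[OF True] using True by simp
    qed (simp add: H_def Nacc_below)
    show ?thesis
    proof (rule set_eqI)
      fix c'
      show "c' \<in> H w \<tau> (P w) (T a \<inter> below c) c \<longleftrightarrow> c' \<in> R \<tau> \<inter> below c"
        unfolding mem R_def Int_iff mem_Collect_eq using eqv[of c'] by blast
    qed
  qed
  have Rbdd: "\<not> limpt (R \<tau>) a" for \<tau>
  proof
    assume l: "limpt (R \<tau>) a"
    obtain i where i: "i \<in> Field t" "\<not> hit (y w \<tau> (P w)) (P w \<tau>) a i" using Pfail[OF a(1)] by blast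
    have "hit (y w \<tau> (P w)) (P w \<tau>) a i"
      unfolding hit_def limpt_def
    proof (intro conjI allI impI)
      show "\<exists>b. b \<prec> a" using l by (simp add: limpt_def)
      fix b assume "b \<prec> a"
      then obtain r where r: "r \<in> R \<tau>" "b \<prec> r" "r \<prec> a" using limptD[OF l] by blast
      have Ra: "R \<tau> \<subseteq> below a" using RT Ta by blast
      obtain c where c: "c \<in> R \<tau>" "r \<prec> c" "pick (R \<tau> \<inter> below c) = i"
        using pick aF(2) Ra l i(1) r(3) by blast
      have xc: "?x \<tau> c \<in> ?V \<tau> c" using c minV by (simp add: R_def)
      have pk: "pick (H w \<tau> (P w) (T a \<inter> below c) c) = i" using HR[OF c(1)] c(3) by simp
      let ?Z = "Z w \<tau> (P w) (T a \<inter> below c) c"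
      have Z: "?Z = {z \<in> MM (?x \<tau> c) w \<tau> i. \<forall>d\<in>T a \<inter> below c. d \<prec> z}" unfolding Z_def pk ..
      have "?Z \<noteq> {}" using xc i(1) unfolding Z V_def by blast
      then have z: "minel ?Z \<in> ?Z" "\<forall>z'\<in>?Z. minel ?Z \<preceq> z'" using minel_in minel_le by blast+
      have zy: "minel ?Z \<in> y w \<tau> (P w) (T a \<inter> below c) c"
        using z pk i(1) c(1) by (simp add: y_def R_def)
      have "minel ?Z \<in> P w \<tau> i" using z(1) c(1) i(1) unfolding Z by (auto simp: R_def)
      moreover have "b \<prec> minel ?Z"
      proof -
        have "r \<in> T a \<inter> below c" using RT[OF r(1)] c(2) by blast
        then have "r \<prec> minel ?Z" using z(1) unfolding Z by blast
        then show ?thesis using r(2) by order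
      qed
      moreover have "minel ?Z \<prec> a"
      proof -
        have "minel ?Z \<prec> c" using gap zy unfolding gap_filler_def by blast
        then show ?thesis using Ra c(1) by (auto intro: less_trans)
      qed
      moreover have "c \<in> Nacc (T a)" using c(1) by (simp add: R_def)
      ultimately show "\<exists>z\<in>{z \<in> P w \<tau> i. \<exists>c\<in>Nacc (T a). z \<in> y w \<tau> (P w) (T a \<inter> below c) c}. b \<prec> z \<and> z \<prec> a"
        using zy by blast
    qed
    then show False using i(2) by blast
  qed
  obtain cc where cc: "cc \<subseteq> below a" "limpt cc a" "|cc| =o t" using aF(2) by (auto simp: cofp_def)
  have "\<forall>\<tau>. \<exists>r. r \<in> cc \<and> (\<forall>c\<in>R \<tau>. \<not> r \<prec> c)"
  proof
    fix \<tau>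
    obtain b where b: "b \<prec> a" "\<forall>c\<in>R \<tau>. b \<prec> c \<longrightarrow> \<not> c \<prec> a"
      using Rbdd[of \<tau>] cc(2) unfolding limpt_def by blast
    obtain r where r: "r \<in> cc" "b \<prec> r" using limptD[OF cc(2) b(1)] by blast
    have "\<not> r \<prec> c" if "c \<in> R \<tau>" for c
      using b(2) r(2) that RT[OF that] Ta by (blast intro: less_trans)
    then show "\<exists>r. r \<in> cc \<and> (\<forall>c\<in>R \<tau>. \<not> r \<prec> c)" using r(1) by blast
  qed
  from choice[OF this] obtain \<rho> where \<rho>: "\<forall>\<tau>. \<rho> \<tau> \<in> cc \<and> (\<forall>c\<in>R \<tau>. \<not> \<rho> \<tau> \<prec> c)" ..
  have ccl: "|cc| <o lam" using cc(3) t(2) by (rule ordIso_ordLess_trans)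
  have \<rho>F: "\<rho> ` Field lam \<subseteq> cc" using \<rho> by blast
  \<comment> \<open>More than \<open>t\<close> stages share the bound \<open>r\<close>. At a
    suitable \<open>c\<close> above \<open>r\<close> the trusted code of each of them is wrong at
    its own stage but right at all earlier ones. So these codes are pairwise different, although
    their indices lie in \<open>w\<close>.\<close>
  obtain r where r: "r \<in> cc" "\<not> |{\<tau> \<in> Field lam. \<rho> \<tau> = r}| \<le>o t"
    by (rule large_fibre[OF ccl \<rho>F tc t(2)])
  have "r \<prec> a" using r(1) cc(1) by blast
  then obtain c where c: "c \<in> N" "f c \<in> w" "r \<prec> c" using limptD[OF w(2)] by blast
  let ?T = "{\<tau> \<in> Field lam. \<rho> \<tau> = r}"
  have Vne: "?V \<tau> c \<noteq> {}" if "\<tau> \<in> ?T" for \<tau> using XV[OF c(1,2)] that by blast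
  have Vx: "?x \<tau> c \<in> ?V \<tau> c" if "\<tau> \<in> ?T" for \<tau> using Vne minV that by blast
  have wrong: "\<exists>i\<in>Field t. MM (?x \<tau> c) w \<tau> i \<noteq> P w \<tau> i \<inter> below (bb (?x \<tau> c))" if \<tau>: "\<tau> \<in> ?T" for \<tau>
  proof -
    have "c \<notin> R \<tau>" using \<rho> \<tau> c(3) by blast
    moreover have "c \<in> Nacc (T a)" using c(1) by (simp add: N_def)
    ultimately show ?thesis using Vne[OF \<tau>] by (simp add: R_def)
  qed
  have neq: "?x \<sigma> c \<noteq> ?x \<tau> c" if "\<sigma> \<in> ?T" "\<tau> \<in> ?T" "\<sigma> \<in> underS lam \<tau>" for \<sigma> \<tau>
  proof
    assume eq: "?x \<sigma> c = ?x \<tau> c"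
    have "\<forall>i\<in>Field t. MM (?x \<tau> c) w \<sigma> i = P w \<sigma> i \<inter> below (bb (?x \<tau> c))"
      using Vx[OF that(2)] that(3) unfolding V_def by blast
    then show False using wrong[OF that(1)] unfolding eq by blast
  qed
  have "inj_on (\<lambda>\<tau>. ?x \<tau> c) ?T"
  proof (rule inj_onI)
    fix \<sigma> \<tau> assume st: "\<sigma> \<in> ?T" "\<tau> \<in> ?T" "?x \<sigma> c = ?x \<tau> c"
    have "\<sigma> = \<tau> \<or> \<sigma> \<in> underS lam \<tau> \<or> \<tau> \<in> underS lam \<sigma>"
      using L.TOTALS st(1,2) unfolding underS_def by blast
    then show "\<sigma> = \<tau>" using neq[OF st(1,2)] neq[OF st(2,1)] st(3) by auto
  qed
  then have "inj_on (e c \<circ> (\<lambda>\<tau>. ?x \<tau> c)) ?T"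
  proof (rule comp_inj_on)
    have "inj_on (e c) (below c)" using e TF[OF NT[OF c(1)]] by blast
    moreover have "(\<lambda>\<tau>. ?x \<tau> c) ` ?T \<subseteq> below c" using Vx by (auto simp: V_def)
    ultimately show "inj_on (e c) ((\<lambda>\<tau>. ?x \<tau> c) ` ?T)" by (rule inj_on_subset)
  qed
  moreover have "(e c \<circ> (\<lambda>\<tau>. ?x \<tau> c)) ` ?T \<subseteq> w" using Vx by (auto simp: V_def)
  ultimately have "|?T| \<le>o |w|" using card_of_ordLeq by blast
  then show False using Wt[OF w(1)] r(2) ordLeq_transitive by blast
qed

end

section \<open>A transformation guessing for all cofinalities at once\<close>

context succ_card
begin

text \<open>That is, \<eta> is the minimum of \<open>C\<close> from \<epsilon> on. All initial
  segments of \<open>C\<close> that contain \<eta> have the same start, so a decision based on it is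
  visible to them.\<close>

definition start :: "'k \<Rightarrow> 'k \<Rightarrow> 'k set \<Rightarrow> bool" where
  "start \<epsilon> \<eta> C \<longleftrightarrow> \<eta> \<in> C \<and> \<epsilon> \<preceq> \<eta> \<and> (\<forall>x\<in>C. \<epsilon> \<preceq> x \<longrightarrow> \<eta> \<preceq> x)"

lemma start_unique: "start \<epsilon> \<eta> C \<Longrightarrow> start \<epsilon> \<eta>' C \<Longrightarrow> \<eta> = \<eta>'"
  unfolding start_def by (blast intro: order.antisym)

lemma ex_start: "x \<in> C \<Longrightarrow> \<epsilon> \<preceq> x \<Longrightarrow> \<exists>\<eta>. start \<epsilon> \<eta> C"
  using minel_in[of "{x \<in> C. \<epsilon> \<preceq> x}"] minel_le[of _ "{x \<in> C. \<epsilon> \<preceq> x}"] unfolding start_def by blast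

lemma start_mono: "start \<epsilon> \<eta> C \<Longrightarrow> \<epsilon> \<preceq> \<epsilon>' \<Longrightarrow> \<epsilon>' \<preceq> \<eta> \<Longrightarrow> start \<epsilon>' \<eta> C"
  unfolding start_def by (blast intro: order_trans)

text \<open>Otherwise \<open>\<gamma> \<epsilon>\<close> bounds the good starts. Diagonalizing the
  clubs that refute the other starts gives an \<open>a\<close> with a point \<open>e\<close> of
  \<open>Nacc (T a)\<close>, closed under \<gamma>, such that for each \<epsilon> below
  \<open>e\<close> the start of \<open>T a\<close> is good. These starts then lie below
  \<open>e\<close>, which makes \<open>e\<close> a limit point of \<open>T a\<close>.\<close>

lemma unbounded_starts:
  assumes S: "S \<subseteq> F" and T: "\<forall>a\<in>S. T a \<subseteq> below a \<and> limpt (T a) a"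
    and guess: "\<forall>g. (\<forall>x\<in>F. g x \<in> F) \<longrightarrow> (\<exists>a\<in>S. limpt (Nacc (T a) \<inter> Cl g) a)"
  shows "\<exists>\<epsilon>\<in>F. \<forall>b\<in>F. \<exists>\<eta>\<in>F. b \<prec> \<eta> \<and> (\<forall>g. (\<forall>x\<in>F. g x \<in> F) \<longrightarrow>
    (\<exists>a\<in>{a\<in>S. start \<epsilon> \<eta> (T a)}. limpt (Nacc (T a) \<inter> Cl g) a))"
proof (rule ccontr)
  define good where "good \<epsilon> \<eta> \<longleftrightarrow> (\<forall>g. (\<forall>x\<in>F. g x \<in> F) \<longrightarrow>
    (\<exists>a\<in>{a\<in>S. start \<epsilon> \<eta> (T a)}. limpt (Nacc (T a) \<inter> Cl g) a))" for \<epsilon> \<eta>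
  assume "\<not> ?thesis"
  then have "\<forall>\<epsilon>\<in>F. \<exists>b. b \<in> F \<and> (\<forall>\<eta>\<in>F. b \<prec> \<eta> \<longrightarrow> \<not> good \<epsilon> \<eta>)" unfolding good_def[symmetric] by blast
  from bchoice[OF this] obtain \<gamma> where \<gamma>: "\<forall>\<epsilon>\<in>F. \<gamma> \<epsilon> \<in> F \<and> (\<forall>\<eta>\<in>F. \<gamma> \<epsilon> \<prec> \<eta> \<longrightarrow> \<not> good \<epsilon> \<eta>)" ..
  have "\<forall>p. \<exists>g. (\<forall>x\<in>F. g x \<in> F) \<and> (\<not> good (fst p) (snd p) \<longrightarrow>
      \<not> (\<exists>a\<in>{a\<in>S. start (fst p) (snd p) (T a)}. limpt (Nacc (T a) \<inter> Cl g) a))"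
  proof
    fix p
    show "\<exists>g. (\<forall>x\<in>F. g x \<in> F) \<and> (\<not> good (fst p) (snd p) \<longrightarrow>
      \<not> (\<exists>a\<in>{a\<in>S. start (fst p) (snd p) (T a)}. limpt (Nacc (T a) \<inter> Cl g) a))"
    proof (cases "good (fst p) (snd p)")
      case True then show ?thesis by (intro exI[of _ "\<lambda>x. x"]) simp
    next
      case False then show ?thesis unfolding good_def by blast
    qed
  qed
  from choice[OF this] obtain h where h: "\<forall>p. (\<forall>x\<in>F. h p x \<in> F) \<and> (\<not> good (fst p) (snd p) \<longrightarrow>
      \<not> (\<exists>a\<in>{a\<in>S. start (fst p) (snd p) (T a)}. limpt (Nacc (T a) \<inter> Cl (h p)) a))" ..
  have "\<forall>\<epsilon>. \<exists>h1. (\<forall>x\<in>F. h1 x \<in> F) \<and> (\<forall>e\<in>Cl h1. \<forall>\<eta>. \<eta> \<prec> e \<longrightarrow> e \<in> Cl (h (\<epsilon>, \<eta>)))"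
  proof
    fix \<epsilon>
    have "\<forall>\<eta>\<in>F. \<forall>x\<in>F. h (\<epsilon>, \<eta>) x \<in> F" using h by blast
    then show "\<exists>h1. (\<forall>x\<in>F. h1 x \<in> F) \<and> (\<forall>e\<in>Cl h1. \<forall>\<eta>. \<eta> \<prec> e \<longrightarrow> e \<in> Cl (h (\<epsilon>, \<eta>)))"
      by (rule Cl_diagonal)
  qed
  from choice[OF this] obtain h1
    where h1: "\<forall>\<epsilon>. (\<forall>x\<in>F. h1 \<epsilon> x \<in> F) \<and> (\<forall>e\<in>Cl (h1 \<epsilon>). \<forall>\<eta>. \<eta> \<prec> e \<longrightarrow> e \<in> Cl (h (\<epsilon>, \<eta>)))" ..
  have h1F: "\<forall>\<epsilon>\<in>F. \<forall>x\<in>F. h1 \<epsilon> x \<in> F" using h1 by blast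
  obtain h2 where h2: "\<forall>x\<in>F. h2 x \<in> F" "\<forall>e\<in>Cl h2. \<forall>\<epsilon>. \<epsilon> \<prec> e \<longrightarrow> e \<in> Cl (h1 \<epsilon>)"
    using Cl_diagonal[OF h1F] by blast
  have "\<forall>i\<in>UNIV. \<forall>x\<in>F. (if i then h2 else \<gamma>) x \<in> F" using h2(1) \<gamma> by auto
  moreover have "|UNIV :: bool set| \<le>o lam" by (rule finite_le_lam) simp
  ultimately have "\<exists>g. (\<forall>x\<in>F. g x \<in> F) \<and> (\<forall>i\<in>UNIV. Cl g \<subseteq> Cl (if i then h2 else \<gamma>))"
    by (rule Cl_common)
  then obtain g where g: "\<forall>x\<in>F. g x \<in> F" "\<forall>i. Cl g \<subseteq> Cl (if i then h2 else \<gamma>)" by auto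
  have g2: "e \<in> Cl h2" "e \<in> Cl \<gamma>" if "e \<in> Cl g" for e
    using g(2)[rule_format, of True] g(2)[rule_format, of False] that by auto
  obtain a where a: "a \<in> S" "limpt (Nacc (T a) \<inter> Cl g) a" using guess g(1) by blast
  have aF: "a \<in> F" using S a(1) by blast
  obtain e where e: "e \<in> Nacc (T a)" "e \<in> Cl g" "e \<prec> a" using limpt_ne[OF a(2)] by blast
  have elim: "limpt UNIV e" using e(2) by (simp add: Cl_def)
  have "limpt (T a) e"
    unfolding limpt_def
  proof (intro conjI allI impI)
    show "\<exists>b. b \<prec> e" using elim by (simp add: limpt_def)
    fix b assume "b \<prec> e"
    then obtain \<epsilon> where \<epsilon>: "b \<prec> \<epsilon>" "\<epsilon> \<prec> e" using limptD[OF elim] by blast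
    have "e \<in> T a" using e(1) by (simp add: Nacc_def)
    then obtain \<eta> where \<eta>: "start \<epsilon> \<eta> (T a)" using ex_start[of e "T a" \<epsilon>] \<epsilon>(2) less_imp_le by blast
    have "\<eta> \<in> T a" using \<eta> by (simp add: start_def)
    then have \<eta>a: "\<eta> \<prec> a" using T a(1) by blast
    have \<epsilon>a: "\<epsilon> \<prec> a" using \<epsilon>(2) e(3) by order
    define m where "m = (if \<epsilon> \<prec> \<eta> then \<eta> else \<epsilon>)"
    have m: "m \<prec> a" "\<epsilon> \<preceq> m" "\<eta> \<preceq> m" using \<eta>a \<epsilon>a by (auto simp: m_def not_less less_imp_le)
    have "limpt (Nacc (T a) \<inter> Cl (h (\<epsilon>, \<eta>))) a"
      unfolding limpt_def
    proof (intro conjI allI impI)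
      show "\<exists>b. b \<prec> a" using m(1) by blast
      fix b assume "b \<prec> a"
      define m' where "m' = (if b \<prec> m then m else b)"
      have m': "m' \<prec> a" "b \<preceq> m'" "m \<preceq> m'" using m(1) \<open>b \<prec> a\<close> by (auto simp: m'_def not_less less_imp_le)
      then obtain c where c: "c \<in> Nacc (T a)" "c \<in> Cl g" "m' \<prec> c" "c \<prec> a" using limptD[OF a(2)] by blast
      have "\<epsilon> \<prec> c" "\<eta> \<prec> c" "b \<prec> c" using c(3) m m' by order+
      then have "c \<in> Cl (h (\<epsilon>, \<eta>))" using g2(1)[OF c(2)] h2(2) h1 by blast
      then show "\<exists>c\<in>Nacc (T a) \<inter> Cl (h (\<epsilon>, \<eta>)). b \<prec> c \<and> c \<prec> a" using c \<open>b \<prec> c\<close> by blast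
    qed
    then have "good \<epsilon> \<eta>" using h[rule_format, of "(\<epsilon>, \<eta>)"] a(1) \<eta> by auto
    have "\<epsilon> \<in> F" "\<eta> \<in> F" using \<epsilon>a \<eta>a aF F_down by blast+
    then have "\<not> \<gamma> \<epsilon> \<prec> \<eta>" using \<gamma> \<open>good \<epsilon> \<eta>\<close> by blast
    moreover have "\<gamma> \<epsilon> \<prec> e" using g2(2)[OF e(2)] \<epsilon>(2) by (simp add: Cl_def)
    ultimately have "\<eta> \<prec> e" by order
    moreover have "b \<prec> \<eta>" using \<eta> \<epsilon>(1) unfolding start_def by (auto intro: less_le_trans)
    ultimately show "\<exists>c\<in>T a. b \<prec> c \<and> c \<prec> e" using \<open>\<eta> \<in> T a\<close> by blast
  qed
  then show False using e(1) by (auto simp: Nacc_def Acc_def)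
qed

lemma unbounded_card:
  assumes "unbounded B"
  shows "|F| \<le>o |B|"
proof -
  have BF: "B \<subseteq> F" using assms by (simp add: unbounded_def)
  have "\<not> |B| \<le>o lam"
  proof
    assume "|B| \<le>o lam"
    then obtain b where "b \<in> F" "\<forall>x\<in>B. x \<prec> b" using bdd[OF BF] by blast
    then show False using assms unfolding unbounded_def by force
  qed
  then have lB: "lam \<le>o |B|"
    using lam_card ordLeq_total[of lam "|B|"] card_of_Well_order card_order_on_well_order_on by blast
  have "infinite B"
    using \<open>\<not> |B| \<le>o lam\<close> finite_le_lam by blast
  moreover have "\<forall>b\<in>B. |below b| \<le>o |B|" using small BF lB ordLeq_transitive by blast
  ultimately have "|\<Union>b\<in>B. below b| \<le>o |B|"
    by (intro card_of_UNION_ordLeq_infinite) (auto intro: card_of_mono1)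
  moreover have "F \<subseteq> (\<Union>b\<in>B. below b)" using assms by (auto simp: unbounded_def)
  ultimately show ?thesis using card_of_mono1 ordLeq_transitive by blast
qed

text \<open>This prescribes the minimum of a club as a function of its start, and changes nothing
  from the start on.\<close>

definition cut :: "'k \<Rightarrow> ('k \<Rightarrow> 'k) \<Rightarrow> 'k set \<Rightarrow> 'k set" where
  "cut \<epsilon> \<zeta> C = (if \<exists>\<eta>. start \<epsilon> \<eta> C then {z. \<exists>\<eta>. start \<epsilon> \<eta> C \<and> z = \<zeta> \<eta> \<and> z \<prec> \<eta>} \<union> {c \<in> C. \<exists>\<eta>. start \<epsilon> \<eta> C \<and> \<eta> \<preceq> c}
     else C)"

lemma cut_start:
  "start \<epsilon> \<eta> C \<Longrightarrow> cut \<epsilon> \<zeta> C = {z. z = \<zeta> \<eta> \<and> z \<prec> \<eta>} \<union> {c \<in> C. \<eta> \<preceq> c}"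
  unfolding cut_def using start_unique by auto

lemma cut_no_start: "(\<And>x. x \<in> C \<Longrightarrow> x \<prec> \<epsilon>) \<Longrightarrow> cut \<epsilon> \<zeta> C = C"
  unfolding cut_def start_def by (auto simp: not_le[symmetric])

lemma cut_limpt:
  assumes "limpt (cut \<epsilon> \<zeta> C) b"
  shows "limpt C b"
proof (cases "\<exists>\<eta>. start \<epsilon> \<eta> C")
  case True
  then obtain \<eta> where \<eta>: "start \<epsilon> \<eta> C" by blast
  show ?thesis
    unfolding limpt_def
  proof (intro conjI allI impI)
    show "\<exists>x. x \<prec> b" using assms by (simp add: limpt_def)
    fix x assume "x \<prec> b"
    then obtain d where d: "d \<in> cut \<epsilon> \<zeta> C" "x \<prec> d" "d \<prec> b" using limptD[OF assms] by blast
    then obtain d' where d': "d' \<in> cut \<epsilon> \<zeta> C" "d \<prec> d'" "d' \<prec> b" using limptD[OF assms] by blast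
    have "d \<in> C \<or> d' \<in> C" using d(1) d'(1,2) unfolding cut_start[OF \<eta>] by auto
    then show "\<exists>c\<in>C. x \<prec> c \<and> c \<prec> b" using d d' by (meson less_trans)
  qed
next
  case False then show ?thesis using assms by (simp add: cut_def)
qed

lemma conservative_cut: "conservative (cut \<epsilon> \<zeta>)"
  unfolding conservative_def
proof (intro ballI allI impI conjI)
  fix a C assume C: "club C a"
  note ca = clubD[OF C]
  have "club (cut \<epsilon> \<zeta> C) a \<and> Acc (cut \<epsilon> \<zeta> C) \<subseteq> Acc C \<and>
    (\<forall>b\<in>Acc (cut \<epsilon> \<zeta> C). cut \<epsilon> \<zeta> C \<inter> below b = cut \<epsilon> \<zeta> (C \<inter> below b))"
  proof (cases "\<exists>\<eta>. start \<epsilon> \<eta> C")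
    case False
    then have C_eq: "cut \<epsilon> \<zeta> C = C" by (simp add: cut_def)
    have low: "x \<prec> \<epsilon>" if "x \<in> C" for x using False ex_start[OF that] not_le by blast
    have "cut \<epsilon> \<zeta> (C \<inter> below b) = C \<inter> below b" for b by (rule cut_no_start) (use low in blast)
    then show ?thesis using C C_eq by simp
  next
    case True
    then obtain \<eta> where \<eta>: "start \<epsilon> \<eta> C" by blast
    let ?D = "cut \<epsilon> \<zeta> C"
    note D = cut_start[OF \<eta>, of \<zeta>]
    have \<eta>C: "\<eta> \<in> C" "\<epsilon> \<preceq> \<eta>" "\<And>x. x \<in> C \<Longrightarrow> \<epsilon> \<preceq> x \<Longrightarrow> \<eta> \<preceq> x" using \<eta> by (auto simp: start_def)
    have \<eta>a: "\<eta> \<prec> a" using \<eta>C ca(1) by blast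
    have above: "\<eta> \<prec> b" if l: "limpt ?D b" for b
    proof -
      obtain d where d: "d \<in> ?D" "d \<prec> b" using limpt_ne[OF l] by blast
      then obtain d' where d': "d' \<in> ?D" "d \<prec> d'" "d' \<prec> b" using limptD[OF l] by blast
      then have "\<eta> \<preceq> d'" using d unfolding D by auto
      then show ?thesis using d'(3) by order
    qed
    have acc: "Acc ?D \<subseteq> Acc C"
    proof
      fix b assume "b \<in> Acc ?D"
      then have b: "b \<in> ?D" "limpt ?D b" by (auto simp: Acc_def)
      then have "b \<in> C" using above[OF b(2)] unfolding D by auto
      then show "b \<in> Acc C" using cut_limpt[OF b(2)] by (simp add: Acc_def)
    qed
    have "club ?D a"
      unfolding club_def
    proof (intro conjI allI impI)
      show "?D \<subseteq> below a" using ca(1) \<eta>a unfolding D by (auto intro: less_trans)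
      show "limpt ?D a" unfolding limpt_def
      proof (intro conjI allI impI)
        show "\<exists>b. b \<prec> a" using \<eta>a by blast
        fix b assume "b \<prec> a"
        define m where "m = (if b \<prec> \<eta> then \<eta> else b)"
        have m: "m \<prec> a" "b \<preceq> m" "\<eta> \<preceq> m" using \<eta>a \<open>b \<prec> a\<close> by (auto simp: m_def not_less less_imp_le)
        then obtain c where c: "c \<in> C" "m \<prec> c" "c \<prec> a" using limptD[OF ca(2)] by blast
        then have "\<eta> \<preceq> c" "b \<prec> c" using m by order+
        then show "\<exists>c\<in>?D. b \<prec> c \<and> c \<prec> a" using c unfolding D by blast
      qed
      fix b assume b: "b \<prec> a \<and> limpt ?D b"
      then have "b \<in> C" using ca(3) cut_limpt by blast
      moreover have "\<eta> \<preceq> b" using above b less_imp_le by blast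
      ultimately show "b \<in> ?D" unfolding D by blast
    qed
    moreover have "?D \<inter> below b = cut \<epsilon> \<zeta> (C \<inter> below b)" if b: "b \<in> Acc ?D" for b
    proof -
      have "\<eta> \<prec> b" using above b by (simp add: Acc_def)
      then have "start \<epsilon> \<eta> (C \<inter> below b)" using \<eta> by (simp add: start_def)
      from cut_start[OF this] show ?thesis using \<open>\<eta> \<prec> b\<close> unfolding D by (auto intro: less_trans)
    qed
    ultimately show ?thesis using acc by blast
  qed
  then show "club (cut \<epsilon> \<zeta> C) a" "Acc (cut \<epsilon> \<zeta> C) \<subseteq> Acc C"
    "\<And>b. b \<in> Acc (cut \<epsilon> \<zeta> C) \<Longrightarrow> cut \<epsilon> \<zeta> C \<inter> below b = cut \<epsilon> \<zeta> (C \<inter> below b)" by blast+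
qed

lemma Nacc_cut:
  assumes "start \<epsilon> \<eta> C" "c \<in> Nacc C" "\<eta> \<preceq> c"
  shows "c \<in> Nacc (cut \<epsilon> \<zeta> C)"
proof -
  have "c \<in> C" "\<not> limpt C c" using assms(2) by (auto simp: Nacc_def Acc_def)
  then show ?thesis using cut_limpt[of \<epsilon> \<zeta> C c] assms by (auto simp: Nacc_def Acc_def cut_start)
qed

lemma limpt_above:
  assumes "limpt X a" "\<eta> \<prec> a" "\<And>x. x \<in> X \<Longrightarrow> \<eta> \<prec> x \<Longrightarrow> x \<prec> a \<Longrightarrow> x \<in> Y"
  shows "limpt Y a"
  unfolding limpt_def
proof (intro conjI allI impI)
  show "\<exists>b. b \<prec> a" using assms(2) by blast
  fix b assume "b \<prec> a"
  define m where "m = (if b \<prec> \<eta> then \<eta> else b)"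
  have m: "m \<prec> a" "b \<preceq> m" "\<eta> \<preceq> m" using assms(2) \<open>b \<prec> a\<close> by (auto simp: m_def not_less less_imp_le)
  then obtain c where c: "c \<in> X" "m \<prec> c" "c \<prec> a" using limptD[OF assms(1)] by blast
  have "\<eta> \<prec> c" "b \<prec> c" using c(2) m by order+
  then show "\<exists>c\<in>Y. b \<prec> c \<and> c \<prec> a" using c assms(3) by blast
qed

lemma limpt_Nacc_cut:
  assumes C: "club C a" and l: "limpt (Nacc C \<inter> E) a"
  shows "limpt (Nacc (cut \<epsilon> \<zeta> C) \<inter> E) a"
proof (cases "\<exists>\<eta>. start \<epsilon> \<eta> C")
  case True
  then obtain \<eta> where \<eta>: "start \<epsilon> \<eta> C" by blast
  then have "\<eta> \<prec> a" using clubD(1)[OF C] by (auto simp: start_def)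
  then show ?thesis
    by (rule limpt_above[OF l]) (use Nacc_cut[OF \<eta>] less_imp_le in blast)
next
  case False then show ?thesis using l by (simp add: cut_def)
qed

text \<open>The good starts for a pair \<open>(i, z)\<close> are as many as there are pairs, namely
  \<open>\<lambda>\<^sup>+\<close>, so each pair can receive a start of its own. It is taken above
  \<open>z\<close>, so that \<open>z\<close> can become the minimum.\<close>

lemma ex_guessing_transformation:
  fixes t :: "'i \<Rightarrow> 'l rel"
  assumes I: "|I| \<le>o lam"
    and t: "\<forall>i\<in>I. Cinfinite (t i) \<and> t i <o lam \<and> Field (t i) \<subseteq> Field lam"
    and pow: "|Pow (Field lam)| \<le>o |F|"
    and dense: "\<forall>i\<in>I. \<exists>D. (\<forall>X. X \<subseteq> Field lam \<and> |X| =o t i \<longrightarrow> (\<exists>Y\<in>D. Y \<subseteq> X)) \<and> (\<forall>Y\<in>D. |Y| =o t i) \<and> |D| \<le>o lam"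
    and S: "\<forall>i\<in>I. \<forall>a\<in>S i. a \<in> F \<and> cofp a (t i)" and T: "\<forall>i\<in>I. \<forall>a\<in>S i. club (T a) a"
    and guess: "\<forall>i\<in>I. \<forall>g. (\<forall>x\<in>F. g x \<in> F) \<longrightarrow> (\<exists>a\<in>S i. limpt (Nacc (T a) \<inter> Cl g) a)"
  shows "\<exists>P. conservative P \<and>
    (\<forall>a C E. club C a \<longrightarrow> a \<in> F \<longrightarrow> limpt (Nacc C \<inter> E) a \<longrightarrow> limpt (Nacc (P C) \<inter> E) a) \<and>
    (\<forall>i\<in>I. \<forall>z\<in>F. \<forall>A :: 'l \<Rightarrow> 'k set. (\<forall>j\<in>Field (t i). unbounded (A j)) \<longrightarrow>
      (\<exists>a\<in>S i. minel (P (T a)) = z \<and> (\<forall>j\<in>Field (t i). limpt (Nacc (P (T a)) \<inter> A j) a)))"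
proof -
  define good where "good i \<epsilon> \<eta> \<longleftrightarrow> (\<forall>g. (\<forall>x\<in>F. g x \<in> F) \<longrightarrow>
    (\<exists>a\<in>{a\<in>S i. start \<epsilon> \<eta> (T a)}. limpt (Nacc (T a) \<inter> Cl g) a))" for i \<epsilon> \<eta>
  have "\<forall>i\<in>I. \<exists>\<epsilon>. \<epsilon> \<in> F \<and> (\<forall>b\<in>F. \<exists>\<eta>\<in>F. b \<prec> \<eta> \<and> good i \<epsilon> \<eta>)"
  proof
    fix i assume i: "i \<in> I"
    have "\<exists>\<epsilon>\<in>F. \<forall>b\<in>F. \<exists>\<eta>\<in>F. b \<prec> \<eta> \<and> good i \<epsilon> \<eta>"
      unfolding good_def
    proof (rule unbounded_starts)
      show "S i \<subseteq> F" using S i by blast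
      show "\<forall>a\<in>S i. T a \<subseteq> below a \<and> limpt (T a) a" using T i clubD(1,2) by blast
      show "\<forall>g. (\<forall>x\<in>F. g x \<in> F) \<longrightarrow> (\<exists>a\<in>S i. limpt (Nacc (T a) \<inter> Cl g) a)" using guess i by blast
    qed
    then show "\<exists>\<epsilon>. \<epsilon> \<in> F \<and> (\<forall>b\<in>F. \<exists>\<eta>\<in>F. b \<prec> \<eta> \<and> good i \<epsilon> \<eta>)" by blast
  qed
  from bchoice[OF this] obtain \<epsilon>0 where \<epsilon>0: "\<forall>i\<in>I. \<epsilon>0 i \<in> F \<and> (\<forall>b\<in>F. \<exists>\<eta>\<in>F. b \<prec> \<eta> \<and> good i (\<epsilon>0 i) \<eta>)" ..
  \<comment> \<open>One \<epsilon> above all \<open>\<epsilon>0 i\<close> serves all indices: a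
    start with respect to \<open>\<epsilon>0 i\<close> that is at least \<epsilon> is also the start
    with respect to \<epsilon>.\<close>
  obtain \<epsilon> where \<epsilon>: "\<epsilon> \<in> F" "\<forall>i\<in>I. \<epsilon>0 i \<prec> \<epsilon>" using bdd_image[OF I, of \<epsilon>0] \<epsilon>0 by blast
  have good_eps: "\<exists>\<eta>\<in>F. b \<prec> \<eta> \<and> good i \<epsilon> \<eta>" if i: "i \<in> I" and b: "b \<in> F" for i b
  proof -
    define m where "m = (if b \<prec> \<epsilon> then \<epsilon> else b)"
    have m: "m \<in> F" "b \<preceq> m" "\<epsilon> \<preceq> m" using \<epsilon> b by (auto simp: m_def not_less less_imp_le)
    then obtain \<eta> where \<eta>: "\<eta> \<in> F" "m \<prec> \<eta>" "good i (\<epsilon>0 i) \<eta>" using \<epsilon>0 i by blast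
    have "\<epsilon>0 i \<preceq> \<epsilon>" "\<epsilon> \<preceq> \<eta>" "b \<prec> \<eta>" using \<epsilon>(2) i m \<eta>(2) by (auto intro: less_imp_le le_less_trans)
    then have "start (\<epsilon>0 i) \<eta> C \<Longrightarrow> start \<epsilon> \<eta> C" for C using start_mono by blast
    then have "good i \<epsilon> \<eta>" using \<eta>(3) unfolding good_def by blast
    then show ?thesis using \<eta>(1) \<open>b \<prec> \<eta>\<close> by blast
  qed
  let ?r = "|I \<times> F|"
  let ?Q = "\<lambda>p. {\<eta> \<in> F. snd p \<prec> \<eta> \<and> good (fst p) \<epsilon> \<eta>}"
  have "\<forall>p\<in>Field ?r. ?r \<le>o |?Q p|"
  proof
    fix p assume "p \<in> Field ?r"
    then have p: "fst p \<in> I" "snd p \<in> F" by (auto simp: Field_card_of)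
    have "unbounded (?Q p)"
      unfolding unbounded_def
    proof (intro conjI ballI)
      fix b assume b: "b \<in> F"
      define m where "m = (if b \<prec> snd p then snd p else b)"
      have m: "m \<in> F" "b \<preceq> m" "snd p \<preceq> m" using p b by (auto simp: m_def not_less less_imp_le)
      obtain \<eta> where "\<eta> \<in> F" "m \<prec> \<eta>" "good (fst p) \<epsilon> \<eta>" using good_eps[OF p(1) m(1)] by blast
      then show "\<exists>s\<in>?Q p. b \<prec> s" using m by (intro bexI[of _ \<eta>]) (auto intro: le_less_trans)
    qed blast
    then have FQ: "|F| \<le>o |?Q p|" by (rule unbounded_card)
    have "lam \<le>o |F|"
    proof -
      have "\<not> |F| \<le>o lam" using bdd[of F] by blast
      then show ?thesis
        using lam_card ordLeq_total[of lam "|F|"] card_of_Well_order card_order_on_well_order_on by blast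
    qed
    then have "|I| \<le>o |F|" using I ordLeq_transitive by blast
    then have "|I \<times> F| \<le>o |F|"
      using card_of_Times_ordLeq_infinite_Field[of "|F|" I F] infinite_F card_of_mono1[of F F]
        card_of_Card_order[of F] by (simp add: Field_card_of)
    then show "?r \<le>o |?Q p|" using FQ by (rule ordLeq_transitive)
  qed
  from injective_choice[OF card_of_Card_order this] obtain \<eta> where
    \<eta>: "inj_on \<eta> (I \<times> F)" "\<forall>p\<in>I \<times> F. \<eta> p \<in> F \<and> snd p \<prec> \<eta> p \<and> good (fst p) \<epsilon> (\<eta> p)"
    by (auto simp: Field_card_of)
  have "\<forall>p\<in>I \<times> F. \<exists>y. gap_filler y \<and> (\<forall>A :: 'l \<Rightarrow> 'k set. (\<forall>j\<in>Field (t (fst p)). unbounded (A j)) \<longrightarrow>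
    (\<exists>a\<in>{a\<in>S (fst p). start \<epsilon> (\<eta> p) (T a)}.
       \<forall>j\<in>Field (t (fst p)). limpt {z \<in> A j. \<exists>c\<in>Nacc (T a). z \<in> y (T a \<inter> below c) c} a))"
  proof
    fix p assume p: "p \<in> I \<times> F"
    then have i: "fst p \<in> I" by auto
    obtain D where "(\<forall>X. X \<subseteq> Field lam \<and> |X| =o t (fst p) \<longrightarrow> (\<exists>Y\<in>D. Y \<subseteq> X)) \<and> (\<forall>Y\<in>D. |Y| =o t (fst p)) \<and> |D| \<le>o lam"
      using bspec[OF dense i] by (rule exE)
    then have D: "\<forall>X. X \<subseteq> Field lam \<and> |X| =o t (fst p) \<longrightarrow> (\<exists>Y\<in>D. Y \<subseteq> X)" "\<forall>Y\<in>D. |Y| =o t (fst p)" "|D| \<le>o lam"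
      by simp_all
    show "\<exists>y. gap_filler y \<and> (\<forall>A :: 'l \<Rightarrow> 'k set. (\<forall>j\<in>Field (t (fst p)). unbounded (A j)) \<longrightarrow>
      (\<exists>a\<in>{a\<in>S (fst p). start \<epsilon> (\<eta> p) (T a)}.
       \<forall>j\<in>Field (t (fst p)). limpt {z \<in> A j. \<exists>c\<in>Nacc (T a). z \<in> y (T a \<inter> below c) c} a))"
    proof (rule guessing_strategy[OF _ _ _ pow D])
      show "Cinfinite (t (fst p))" "t (fst p) <o lam" "Field (t (fst p)) \<subseteq> Field lam" using t i by blast+
      show "\<forall>a\<in>{a\<in>S (fst p). start \<epsilon> (\<eta> p) (T a)}. a \<in> F \<and> cofp a (t (fst p))" using S i by blast
      show "\<forall>a\<in>{a\<in>S (fst p). start \<epsilon> (\<eta> p) (T a)}. T a \<subseteq> below a" using T i clubD(1) by blast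
      show "\<forall>g. (\<forall>x\<in>F. g x \<in> F) \<longrightarrow>
        (\<exists>a\<in>{a\<in>S (fst p). start \<epsilon> (\<eta> p) (T a)}. limpt (Nacc (T a) \<inter> Cl g) a)"
        using \<eta>(2) p unfolding good_def by blast
    qed
  qed
  from bchoice[OF this] obtain y where y: "\<forall>p\<in>I \<times> F. gap_filler (y p) \<and>
    (\<forall>A :: 'l \<Rightarrow> 'k set. (\<forall>j\<in>Field (t (fst p)). unbounded (A j)) \<longrightarrow>
    (\<exists>a\<in>{a\<in>S (fst p). start \<epsilon> (\<eta> p) (T a)}.
       \<forall>j\<in>Field (t (fst p)). limpt {z \<in> A j. \<exists>c\<in>Nacc (T a). z \<in> y p (T a \<inter> below c) c} a))" ..
  \<comment> \<open>The pair \<open>p\<close> is read off from the start of \<open>D\<close>, the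
    part of the club below \<open>c\<close>. By injectivity of \<eta> at most one pair is
    found.\<close>
  define yy where "yy D c = {z. \<exists>p\<in>I \<times> F. start \<epsilon> (\<eta> p) D \<and> z \<in> y p D c}" for D c
  define \<zeta> where "\<zeta> = snd \<circ> inv_into (I \<times> F) \<eta>"
  have yy: "yy D c = y p D c" if p: "p \<in> I \<times> F" and D: "start \<epsilon> (\<eta> p) D" for p D c
  proof -
    have "q = p" if "q \<in> I \<times> F" "start \<epsilon> (\<eta> q) D" for q
      using start_unique[OF that(2) D] \<eta>(1) that(1) p by (auto dest: inj_onD)
    then show ?thesis unfolding yy_def using p D by blast
  qed
  have gap: "gap_filler yy"
    unfolding gap_filler_def
  proof (intro conjI allI impI)
    fix D c z assume "z \<in> yy D c"
    then obtain p where p: "p \<in> I \<times> F" "start \<epsilon> (\<eta> p) D" "z \<in> y p D c" by (auto simp: yy_def)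
    have gp: "gap_filler (y p)" using y p(1) by blast
    show "z \<prec> c" "\<forall>d\<in>D. d \<prec> z" using gp p(3) unfolding gap_filler_def by blast+
    fix z' assume "z' \<in> yy D c"
    then have "z' \<in> y p D c" using yy[OF p(1,2)] by simp
    then show "z = z'" using gp p(3) unfolding gap_filler_def by blast
  qed
  let ?P = "cut \<epsilon> \<zeta> \<circ> extend yy"
  have cons: "conservative ?P" by (rule conservative_comp[OF conservative_cut conservative_extend[OF gap]])
  have ext_club: "club (extend yy C) a" if "club C a" "a \<in> F" for C a
    using conservative_extend[OF gap] that unfolding conservative_def by blast
  have pres: "limpt (Nacc (?P C) \<inter> E) a" if C: "club C a" "a \<in> F" and l: "limpt (Nacc C \<inter> E) a" for a C E
  proof -
    have "limpt (Nacc (extend yy C) \<inter> E) a"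
      by (rule limpt_mono[OF l]) (use Nacc_subset_extend[OF gap] in blast)
    then show ?thesis using limpt_Nacc_cut[OF ext_club[OF C]] by simp
  qed
  have hit: "\<exists>a\<in>S i. minel (?P (T a)) = z \<and> (\<forall>j\<in>Field (t i). limpt (Nacc (?P (T a)) \<inter> A j) a)"
    if i: "i \<in> I" and z: "z \<in> F" and A: "\<forall>j\<in>Field (t i). unbounded (A j)" for i z and A :: "'l \<Rightarrow> 'k set"
  proof -
    let ?p = "(i, z)"
    have p: "?p \<in> I \<times> F" using i z by blast
    obtain a where a: "a \<in> S i" "start \<epsilon> (\<eta> ?p) (T a)"
      "\<forall>j\<in>Field (t i). limpt {z \<in> A j. \<exists>c\<in>Nacc (T a). z \<in> y ?p (T a \<inter> below c) c} a"
      using y p A by fastforce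
    have C: "club (T a) a" "a \<in> F" using T S i a(1) by blast+
    have \<eta>p: "\<eta> ?p \<in> T a" "\<epsilon> \<preceq> \<eta> ?p" "\<And>x. x \<in> T a \<Longrightarrow> \<epsilon> \<preceq> x \<Longrightarrow> \<eta> ?p \<preceq> x" using a(2) by (auto simp: start_def)
    have \<eta>a: "\<eta> ?p \<prec> a" using \<eta>p(1) clubD(1)[OF C(1)] by blast
    have "\<zeta> (\<eta> ?p) = z" using inv_into_f_f[OF \<eta>(1) p] by (simp add: \<zeta>_def)
    moreover have "z \<prec> \<eta> ?p" using \<eta>(2) p by force
    \<comment> \<open>Points are added only to gaps beyond the start, so the start remains the same
      and \<open>cut\<close> sees the same pair.\<close>
    moreover have st: "start \<epsilon> (\<eta> ?p) (extend yy (T a))"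
      unfolding start_def
    proof (intro conjI ballI impI)
      show "\<eta> ?p \<in> extend yy (T a)" using \<eta>p(1) by (simp add: extend_def)
      show "\<epsilon> \<preceq> \<eta> ?p" by (rule \<eta>p(2))
      fix x assume x: "x \<in> extend yy (T a)" "\<epsilon> \<preceq> x"
      show "\<eta> ?p \<preceq> x"
      proof (cases "x \<in> T a")
        case True then show ?thesis using \<eta>p(3) x(2) by blast
      next
        case False
        then obtain c where c: "x \<in> yy (T a \<inter> below c) c" using x(1) by (auto simp: extend_def)
        then obtain q where q: "start \<epsilon> (\<eta> q) (T a \<inter> below c)" by (auto simp: yy_def)
        have "\<eta> q \<prec> x" using gap c q unfolding gap_filler_def start_def by blast
        moreover have "\<eta> ?p \<preceq> \<eta> q" using \<eta>p(3) q unfolding start_def by blast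
        ultimately show ?thesis by order
      qed
    qed
    ultimately have P: "?P (T a) = insert z {c \<in> extend yy (T a). \<eta> ?p \<preceq> c}" "z \<prec> \<eta> ?p"
      using cut_start[OF st, of \<zeta>] by auto
    have "minel (?P (T a)) = z"
      unfolding P(1) by (rule minel_eqI) (use P(2) in \<open>auto intro: less_imp_le less_le_trans\<close>)
    moreover have "limpt (Nacc (?P (T a)) \<inter> A j) a" if j: "j \<in> Field (t i)" for j
    proof -
      have "limpt {z \<in> A j. \<exists>c\<in>Nacc (T a). z \<in> y ?p (T a \<inter> below c) c} a" using a(3) j by blast
      then show ?thesis
      proof (rule limpt_above[OF _ \<eta>a])
        fix x assume x: "x \<in> {z \<in> A j. \<exists>c\<in>Nacc (T a). z \<in> y ?p (T a \<inter> below c) c}" "\<eta> ?p \<prec> x"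
        then obtain c where c: "c \<in> Nacc (T a)" "x \<in> y ?p (T a \<inter> below c) c" by blast
        have "gap_filler (y ?p)" using y p by blast
        then have "x \<prec> c" using c(2) unfolding gap_filler_def by blast
        then have "\<eta> ?p \<prec> c" using x(2) by order
        then have "start \<epsilon> (\<eta> ?p) (T a \<inter> below c)" using a(2) by (simp add: start_def)
        then have "x \<in> yy (T a \<inter> below c) c" using yy[OF p] c(2) by simp
        then have "x \<in> Nacc (extend yy (T a))" by (rule gap_Nacc_extend[OF gap C(1) c(1)])
        then have "x \<in> Nacc (?P (T a))" using Nacc_cut[OF st] x(2) less_imp_le by simp
        then show "x \<in> Nacc (?P (T a)) \<inter> A j" using x(1) by blast
      qed
    qed
    ultimately show ?thesis using a(1) by blast
  qed
  show ?thesis using cons pres hit by (intro exI[of _ ?P]) blast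
qed

end

section \<open>Points of prescribed cofinality and order types of clubs\<close>

context succ_card
begin

text \<open>The point \<open>b\<close> is the limit of an increasing sequence of length
  \<open>t\<close> in \<open>X\<close> that passes the \<open>bnd g\<close> values of its earlier
  terms. Regularity of \<open>t\<close> excludes a smaller cofinality. The set \<open>U\<close> will
  be \<open>F\<close>, or the ordinals below a point of cofinality \<lambda>.\<close>

lemma ex_cofp:
  fixes t :: "'x rel"
  assumes t: "Cinfinite t" "regularCard t" "t \<le>o lam"
    and g: "\<forall>x\<in>F. g x \<in> F" and X: "X \<subseteq> U" "U \<subseteq> F" and gU: "\<forall>x\<in>U. bnd g x \<in> U"
    and step: "\<And>B. B \<subseteq> U \<Longrightarrow> |B| <o t \<Longrightarrow> \<exists>x\<in>X. \<forall>b\<in>B. b \<prec> x"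
  obtains b B where "b \<in> Cl g" "cofp b t" "B \<subseteq> X" "|B| =o t" "limpt B b"
proof -
  have tc: "Card_order t" and wt: "Well_order t" using t card_order_on_well_order_on by blast+
  interpret t: wo_rel t using wt by (simp add: wo_rel_def)
  from underS_recursion[OF wt, of "\<lambda>i s. SOME x. x \<in> X \<and> (\<forall>j\<in>underS t i. s j \<prec> x \<and> bnd g (s j) \<prec> x)"]
  obtain s where s0: "\<forall>i. s i = (SOME x. x \<in> X \<and> (\<forall>j\<in>underS t i. (if j \<in> underS t i then s j else undefined) \<prec> x \<and>
     bnd g (if j \<in> underS t i then s j else undefined) \<prec> x))" ..
  have s0: "s i = (SOME x. x \<in> X \<and> (\<forall>j\<in>underS t i. s j \<prec> x \<and> bnd g (s j) \<prec> x))" for i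
    using s0[rule_format, of i] by simp
  have s: "i \<in> Field t \<longrightarrow> s i \<in> X \<and> (\<forall>j\<in>underS t i. s j \<prec> s i \<and> bnd g (s j) \<prec> s i)" for i
  proof (induction i rule: t.well_order_induct)
    fix i assume IH: "\<forall>j. j \<noteq> i \<and> (j, i) \<in> t \<longrightarrow> j \<in> Field t \<longrightarrow> s j \<in> X \<and> (\<forall>l\<in>underS t j. s l \<prec> s j \<and> bnd g (s l) \<prec> s j)"
    show "i \<in> Field t \<longrightarrow> s i \<in> X \<and> (\<forall>j\<in>underS t i. s j \<prec> s i \<and> bnd g (s j) \<prec> s i)"
    proof
      assume i: "i \<in> Field t"
      let ?B = "s ` underS t i \<union> (\<lambda>j. bnd g (s j)) ` underS t i"
      have sX: "s j \<in> X" if "j \<in> underS t i" for j using IH that by (auto simp: underS_def Field_def)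
      have "?B \<subseteq> U" using sX X(1) gU by blast
      moreover have "|?B| <o t"
        by (rule Un_Cinfinite_bound_strict[OF ordLeq_ordLess_trans[OF card_of_image card_of_underS[OF tc i]]
              ordLeq_ordLess_trans[OF card_of_image card_of_underS[OF tc i]] t(1)])
      ultimately have "\<exists>x\<in>X. \<forall>b\<in>?B. b \<prec> x" by (rule step)
      then have "\<exists>x. x \<in> X \<and> (\<forall>j\<in>underS t i. s j \<prec> x \<and> bnd g (s j) \<prec> x)" by blast
      from someI_ex[OF this] show "s i \<in> X \<and> (\<forall>j\<in>underS t i. s j \<prec> s i \<and> bnd g (s j) \<prec> s i)"
        unfolding s0[of i, symmetric] .
    qed
  qed
  define B where "B = s ` Field t"
  have sF: "s i \<in> F" if "i \<in> Field t" for i using s X that by blast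
  have BX: "B \<subseteq> X" using s by (auto simp: B_def)
  have less: "s j \<prec> s i" "bnd g (s j) \<prec> s i" if "i \<in> Field t" "j \<in> underS t i" for i j using s that by blast+
  have lim: "\<exists>i'\<in>Field t. i \<in> underS t i'" if i: "i \<in> Field t" for i
    using infinite_Card_order_limit[OF tc _ i] t(1) by (auto simp: underS_def cinfinite_def)
  have Blam: "|B| \<le>o lam"
    unfolding B_def using card_of_image[of s "Field t"] card_of_Field_ordIso[OF tc] t(3)
      ordLeq_ordIso_trans ordLeq_transitive by blast
  have Fne: "Field t \<noteq> {}" using t(1) by (auto simp: cinfinite_def)
  have "\<exists>b. b \<in> F \<and> (\<forall>x\<in>B. x \<prec> b) \<and> limpt B b"
  proof (rule ex_sup_limpt[of B])
    show "B \<subseteq> F" using sF by (auto simp: B_def)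
    show "B \<noteq> {}" using Fne by (simp add: B_def)
    show "\<exists>y\<in>B. x \<prec> y" if "x \<in> B" for x using that lim less(1) unfolding B_def by blast
  qed (use Blam in blast)+
  then obtain b where b: "b \<in> F" "\<forall>x\<in>B. x \<prec> b" "limpt B b" by blast
  have "inj_on s (Field t)"
  proof (rule inj_onI)
    fix i j assume ij: "i \<in> Field t" "j \<in> Field t" "s i = s j"
    have "i = j \<or> i \<in> underS t j \<or> j \<in> underS t i" using t.TOTALS ij unfolding underS_def by blast
    then show "i = j" using less(1)[OF ij(1), of j] less(1)[OF ij(2), of i] ij(3) by auto
  qed
  then have "|Field t| =o |B|" using card_of_ordIso[of "Field t" B] by (auto simp: bij_betw_def B_def)
  then have Bt: "|B| =o t" using card_of_Field_ordIso[OF tc] ordIso_symmetric ordIso_transitive by blast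
  have "t \<le>o |B'|" if B': "B' \<subseteq> below b" "limpt B' b" for B'
  proof (rule ccontr)
    assume "\<not> t \<le>o |B'|"
    then have l: "|B'| <o t" using not_ordLeq_iff_ordLess[OF card_of_Well_order wt] by blast
    have "\<forall>y\<in>B'. \<exists>i. i \<in> Field t \<and> y \<prec> s i"
    proof
      fix y assume "y \<in> B'"
      then have "y \<prec> b" using B'(1) by blast
      from limptD[OF b(3) this] show "\<exists>i. i \<in> Field t \<and> y \<prec> s i" by (auto simp: B_def)
    qed
    from bchoice[OF this] obtain i where i: "\<forall>y\<in>B'. i y \<in> Field t \<and> y \<prec> s (i y)" ..
    have "cofinal (i ` B') t"
      unfolding cofinal_def
    proof
      fix j assume j: "j \<in> Field t"
      then have "s j \<prec> b" using b(2) by (simp add: B_def)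
      from limptD[OF B'(2) this] obtain y where y: "y \<in> B'" "s j \<prec> y" by blast
      have "y \<prec> s (i y)" "i y \<in> Field t" using i y(1) by blast+
      then have sj: "s j \<prec> s (i y)" using y(2) by order
      then have "j \<noteq> i y" by auto
      moreover have "i y \<notin> underS t j" using less(1)[OF j, of "i y"] sj by auto
      then have "(j, i y) \<in> t" using t.TOTALS j \<open>i y \<in> Field t\<close> \<open>j \<noteq> i y\<close> unfolding underS_def by auto
      ultimately show "\<exists>b\<in>i ` B'. j \<noteq> b \<and> (j, b) \<in> t" using y(1) by blast
    qed
    moreover have "i ` B' \<subseteq> Field t" using i by blast
    ultimately have "|i ` B'| =o t" using t(2) unfolding regularCard_def by blast
    moreover have "|i ` B'| <o t" using card_of_image l by (rule ordLeq_ordLess_trans)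
    ultimately show False using not_ordLess_ordIso by blast
  qed
  moreover have "B \<subseteq> below b" using b(2) by blast
  ultimately have "cofp b t" unfolding cofp_def using b(3) Bt by blast
  moreover have "b \<in> Cl g"
    unfolding Cl_def
  proof (intro CollectI conjI allI impI)
    show "limpt UNIV b" by (rule limpt_mono[OF b(3)]) blast
    fix x assume "x \<prec> b"
    from limptD[OF b(3) this] obtain i where i: "i \<in> Field t" "x \<prec> s i" by (auto simp: B_def)
    obtain i' where i': "i' \<in> Field t" "i \<in> underS t i'" using lim[OF i(1)] by blast
    have "g x \<prec> bnd g (s i)" using bnd(3)[OF g sF[OF i(1)]] i(2) less_imp_le by blast
    also have "bnd g (s i) \<prec> s i'" by (rule less(2)[OF i'])
    also have "s i' \<prec> b" using b(2) i'(1) by (simp add: B_def)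
    finally show "g x \<prec> b" .
  qed (rule b(1))
  ultimately show thesis using that BX Bt b(3) by blast
qed

lemma ex_cofp_Cl:
  fixes t :: "'x rel"
  assumes t: "Cinfinite t" "regularCard t" "t \<le>o lam" and g: "\<forall>x\<in>F. g x \<in> F" and X: "unbounded X"
  shows "\<exists>b\<in>Cl g. cofp b t \<and> limpt X b"
proof -
  have XF: "X \<subseteq> F" using X by (simp add: unbounded_def)
  have gF: "\<forall>x\<in>F. bnd g x \<in> F" using bnd(1)[OF g] by blast
  have step: "\<exists>x\<in>X. \<forall>b\<in>B. b \<prec> x" if B: "B \<subseteq> F" "|B| <o t" for B
  proof -
    have "|B| \<le>o lam" using B(2) t(3) ordLess_ordLeq_trans ordLess_imp_ordLeq by blast
    then obtain b where "b \<in> F" "\<forall>x\<in>B. x \<prec> b" using bdd[OF B(1)] by blast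
    moreover obtain x where "x \<in> X" "b \<prec> x" using X \<open>b \<in> F\<close> unfolding unbounded_def by blast
    ultimately show ?thesis by (blast intro: less_trans)
  qed
  obtain b B where b: "b \<in> Cl g" "cofp b t" "B \<subseteq> X" "|B| =o t" "limpt B b"
    by (rule ex_cofp[OF t g XF subset_refl gF step])
  have "limpt X b" by (rule limpt_mono[OF b(5)]) (use b(3) in blast)
  then show ?thesis using b by blast
qed

text \<open>An order isomorphism of a club \<open>C\<close> onto a proper initial segment of \<open>D\<close> would have to respect the
  limit points of \<open>C\<close>, since all limit points of \<open>D\<close> are limit points of \<open>C\<close>.\<close>

lemma ord_on_mono:
  assumes C: "club C a" and D: "club D a" and acc: "Acc D \<subseteq> Acc C"
  shows "ord_on D \<le>o ord_on C"
proof (rule ccontr)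
  assume "\<not> ?thesis"
  then have "ord_on C <o ord_on D"
    using not_ordLeq_iff_ordLess[OF Well_order_ord_on Well_order_ord_on] by blast
  then obtain z where z: "z \<in> D" "ord_on C =o Restr (ord_on D) (underS (ord_on D) z)"
    using ordLess_iff_ordIso_Restr[OF Well_order_ord_on Well_order_ord_on] by (auto simp: Field_ord_on)
  have "ord_on C =o ord_on (D \<inter> below z)" using z(2) by (simp add: Restr_ord_on underS_ord_on[OF z(1)])
  then obtain f where "iso (ord_on C) (ord_on (D \<inter> below z)) f" unfolding ordIso_def by blast
  then have "bij_betw f C (D \<inter> below z) \<and> (\<forall>x\<in>C. \<forall>y\<in>C. ((x, y) \<in> ord_on C) = ((f x, f y) \<in> ord_on (D \<inter> below z)))"
    unfolding iso_iff2 Field_ord_on .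
  then have bij: "bij_betw f C (D \<inter> below z)" and
    mono0: "\<forall>x\<in>C. \<forall>y\<in>C. ((x, y) \<in> ord_on C) = ((f x, f y) \<in> ord_on (D \<inter> below z))" by blast+
  have fD: "f c \<in> D" "f c \<prec> z" if "c \<in> C" for c using bij that by (auto simp: bij_betw_def)
  have mono: "x \<prec> y \<longleftrightarrow> f x \<prec> f y" if "x \<in> C" "y \<in> C" for x y
  proof -
    have "y \<preceq> x \<longleftrightarrow> f y \<preceq> f x" using mono0 that fD unfolding ord_on_def by auto
    then show ?thesis by (simp add: not_le[symmetric])
  qed
  have limD: "s \<in> C \<and> limpt C s" if s: "s \<in> D" "limpt D s" for s
    using acc s by (auto simp: Acc_def)
  have lim: "limpt D d" if d: "d \<in> D" "D \<inter> below d \<noteq> {}" "\<And>x. x \<in> D \<inter> below d \<Longrightarrow> \<exists>y\<in>D \<inter> below d. x \<prec> y" for d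
  proof -
    obtain s where s: "s \<preceq> d" "\<And>x. x \<in> D \<inter> below d \<Longrightarrow> x \<prec> s" "limpt (D \<inter> below d) s"
      by (rule sup_limpt[of "D \<inter> below d" d]) (use d in auto)
    have "limpt D s" by (rule limpt_mono[OF s(3)]) blast
    moreover have "s = d"
    proof (rule ccontr)
      assume "s \<noteq> d"
      then have "s \<prec> d" using s(1) by order
      moreover have "d \<prec> a" using d(1) clubD(1)[OF D] by blast
      ultimately have "s \<prec> a" by order
      then have "s \<in> D \<inter> below d" using clubD(3)[OF D] \<open>limpt D s\<close> \<open>s \<prec> d\<close> by blast
      then show False using s(2) by blast
    qed
    ultimately show ?thesis by simp
  qed
  \<comment> \<open>No \<open>c\<close> in \<open>C\<close> is moved down by \<open>f\<close> past a
    limit point \<open>l\<close> of \<open>C\<close>. Otherwise \<open>C\<close> has no points from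
    \<open>l\<close> up to \<open>c\<close>, so \<open>f c\<close> is a limit point of
    \<open>D\<close>, hence in \<open>Acc C\<close>; it lies below \<open>c\<close> and would itself
    be moved down past \<open>f c\<close>. For \<open>c = l = z\<close> this gives the
    contradiction.\<close>
  have main: "\<forall>l. limpt C l \<longrightarrow> f c \<prec> l \<longrightarrow> l \<preceq> a \<longrightarrow> c \<prec> l" if "c \<in> C" for c
    using that
  proof (induction c rule: less_induct)
    case (less c)
    show ?case
    proof (intro allI impI)
      fix l assume l: "limpt C l" "f c \<prec> l" "l \<preceq> a"
      show "c \<prec> l"
      proof (rule ccontr)
        assume "\<not> c \<prec> l"
        then have lc: "l \<preceq> c" by order
        have below: "x \<prec> l" if x: "x \<in> C" "x \<prec> c" for x
        proof -
          have "f x \<prec> f c" using mono[OF x(1) less.prems] x(2) by blast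
          then have "f x \<prec> l" using l(2) by order
          then show ?thesis using less.IH[OF x(2,1)] l(1,3) by blast
        qed
        have im: "\<exists>x\<in>C. x \<prec> c \<and> d = f x" if d: "d \<in> D" "d \<prec> f c" for d
        proof -
          have "d \<prec> z" using d(2) fD(2)[OF less.prems] by order
          then obtain x where x: "x \<in> C" "d = f x" using bij d(1) by (auto simp: bij_betw_def)
          then show ?thesis using mono[OF x(1) less.prems] d(2) by blast
        qed
        have "limpt D (f c)"
        proof (rule lim)
          show "f c \<in> D" by (rule fD(1)[OF less.prems])
          obtain x where x: "x \<in> C" "x \<prec> l" using limpt_ne[OF l(1)] by blast
          then have "x \<prec> c" using lc by order
          then have "f x \<in> D \<inter> below (f c)" using mono[OF x(1) less.prems] fD(1)[OF x(1)] by blast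
          then show "D \<inter> below (f c) \<noteq> {}" by blast
          fix d assume "d \<in> D \<inter> below (f c)"
          then obtain x where x: "x \<in> C" "x \<prec> c" "d = f x" using im by blast
          obtain x' where x': "x' \<in> C" "x \<prec> x'" "x' \<prec> l" using limptD[OF l(1) below[OF x(1,2)]] by blast
          then have "x' \<prec> c" using lc by order
          then have "f x' \<in> D \<inter> below (f c)" using mono[OF x'(1) less.prems] fD(1)[OF x'(1)] by blast
          moreover have "d \<prec> f x'" using mono[OF x(1) x'(1)] x'(2) x(3) by blast
          ultimately show "\<exists>y\<in>D \<inter> below (f c). d \<prec> y" by blast
        qed
        then have fc: "f c \<in> C" "limpt C (f c)" using limD fD(1)[OF less.prems] by blast+
        have "f c \<prec> c" using l(2) lc by order
        then have 1: "f (f c) \<prec> f c" using mono[OF fc(1) less.prems] by blast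
        have "f c \<preceq> a" using fc(1) clubD(1)[OF C] less_imp_le by blast
        then have "f c \<prec> f c" using less.IH[OF \<open>f c \<prec> c\<close> fc(1)] fc(2) 1 by blast
        then show False by order
      qed
    qed
  qed
  have zl: "limpt D z"
  proof (rule lim)
    show "z \<in> D" by (rule z(1))
    obtain x where "x \<in> C" using limpt_ne[OF clubD(2)[OF C]] by blast
    then show "D \<inter> below z \<noteq> {}" using fD by blast
    fix d assume "d \<in> D \<inter> below z"
    then obtain x where x: "x \<in> C" "d = f x" using bij by (auto simp: bij_betw_def)
    then have "x \<prec> a" using clubD(1)[OF C] by blast
    then obtain x' where x': "x' \<in> C" "x \<prec> x'" using limptD[OF clubD(2)[OF C]] by blast
    then show "\<exists>y\<in>D \<inter> below z. d \<prec> y" using mono[OF x(1) x'(1)] fD[OF x'(1)] x(2) by blast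
  qed
  then have zC: "z \<in> C" "limpt C z" using limD z(1) by blast+
  have "z \<preceq> a" using zC(1) clubD(1)[OF C] less_imp_le by blast
  then have "z \<prec> z" using main[OF zC(1)] zC(2) fD(2)[OF zC(1)] by blast
  then show False by order
qed

end

section \<open>Translation into the notions of the statement\<close>

locale succ_card_rel = succ_card le lt F lam
  for le :: "'k \<Rightarrow> 'k \<Rightarrow> bool" (infix "\<preceq>" 50) and lt :: "'k \<Rightarrow> 'k \<Rightarrow> bool" (infix "\<prec>" 50)
    and F :: "'k set" and lam :: "'l rel" +
  fixes k :: "'k rel"
  assumes k_wo: "Well_order k" and Field_k: "Field k = F" and underS_k: "a \<in> F \<Longrightarrow> underS k a = below a"
begin

sublocale k: wo_rel k
  using k_wo by (simp add: wo_rel_def)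

lemma k_iff: "a \<in> F \<Longrightarrow> b \<in> F \<Longrightarrow> (a, b) \<in> k \<longleftrightarrow> a \<preceq> b"
proof -
  assume ab: "a \<in> F" "b \<in> F"
  have "(a, a) \<in> k" using k.REFL ab(1) unfolding refl_on_def Field_k by blast
  then have "(a, b) \<in> k \<longleftrightarrow> a = b \<or> a \<in> underS k b" by (auto simp: underS_def)
  then show ?thesis using underS_k[OF ab(2)] le_less by blast
qed

lemma minim_k: "X \<subseteq> F \<Longrightarrow> X \<noteq> {} \<Longrightarrow> k.minim X = minel X"
proof -
  assume X: "X \<subseteq> F" "X \<noteq> {}"
  have "(minel X, b) \<in> k" if "b \<in> X" for b
    using k_iff[of "minel X" b] minel_in[OF X(2)] minel_le[OF that] X(1) that by blast
  then have "minel X = k.minim X"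
    using X minel_in[OF X(2)] by (intro k.equals_minim) (auto simp: Field_k)
  then show ?thesis by simp
qed

lemma supr_k:
  assumes X: "X \<subseteq> below a" and a: "a \<in> F"
  shows "limpt X a \<Longrightarrow> k.supr X = a" "k.supr X = a \<Longrightarrow> a \<noteq> ozero k \<Longrightarrow> limpt X a"
proof -
  let ?U = "{b \<in> F. \<forall>x\<in>X. x \<preceq> b}"
  have XF: "X \<subseteq> F" using X a F_down by blast
  have U: "Above k X = ?U" using XF k_iff by (auto simp: Above_def Field_k)
  have aU: "a \<in> ?U" using X a less_imp_le by blast
  have s: "k.supr X = minel ?U" unfolding k.supr_def U by (rule minim_k) (use aU in blast)+
  show "k.supr X = a" if l: "limpt X a"
    unfolding s
  proof (rule minel_eqI[OF aU])
    fix b assume b: "b \<in> ?U"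
    show "a \<preceq> b"
    proof (rule ccontr)
      assume "\<not> a \<preceq> b"
      then have "b \<prec> a" by order
      then obtain x where "x \<in> X" "b \<prec> x" using limptD[OF l] by blast
      then show False using b not_le by blast
    qed
  qed
  show "limpt X a" if l: "k.supr X = a" "a \<noteq> ozero k"
    unfolding limpt_def
  proof (intro conjI allI impI)
    have Fne: "F \<noteq> {}" using a by blast
    have "ozero k = minel F" unfolding Field_k by (rule minim_k[OF subset_refl Fne])
    then have "minel F \<prec> a" using l(2) minel_le[OF a] by order
    then show "\<exists>b. b \<prec> a" by blast
    fix b assume b: "b \<prec> a"
    then have "b \<notin> ?U" using minel_le[of b ?U] l(1) s not_le by metis
    then obtain x where "x \<in> X" "b \<prec> x" using b a F_down not_le by blast
    then show "\<exists>c\<in>X. b \<prec> c \<and> c \<prec> a" using X by blast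
  qed
qed

lemma limpt_not_ozero: "limpt X a \<Longrightarrow> a \<in> F \<Longrightarrow> a \<noteq> ozero k"
proof
  assume l: "limpt X a" "a \<in> F" "a = ozero k"
  then obtain b where b: "b \<prec> a" by (auto simp: limpt_def)
  have "F \<noteq> {}" using l(2) by blast
  then have "ozero k = minel F" unfolding Field_k by (intro minim_k) auto
  then show False using b l F_down minel_le[of b F] by (metis not_le)
qed

lemma supr_below_iff:
  assumes "a \<in> F"
  shows "k.supr (C \<inter> underS k a) = a \<and> a \<noteq> ozero k \<longleftrightarrow> limpt C a"
  unfolding underS_k[OF assms]
  using supr_k[OF Int_lower2 assms, of C] limpt_not_ozero[OF _ assms] limpt_Int_below[of a a C] by blast

lemma acc_k: "C \<subseteq> F \<Longrightarrow> acc k C = Acc C"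
  unfolding acc_def Acc_def using supr_below_iff by blast

lemma nacc_k: "C \<subseteq> F \<Longrightarrow> nacc k C = Nacc C"
  by (simp add: nacc_def Nacc_def acc_k)

definition Lims :: "'k set" where "Lims = {a \<in> F. limpt UNIV a}"

lemma acc_Field: "acc k (Field k) = Lims"
proof -
  have "limpt F a \<longleftrightarrow> limpt UNIV a" if "a \<in> F" for a
    using limpt_mono[of UNIV a F] limpt_mono[of F a UNIV] F_down[OF that] by blast
  then show ?thesis unfolding Field_k acc_k[OF subset_refl] Acc_def Lims_def by blast
qed

lemma otp_k: "C \<subseteq> F \<Longrightarrow> otp k C = ord_on C"
  unfolding ord_on_def using k_iff by blast

lemma cofinal_in_Field: "cofinal_in k (Field k) A \<longleftrightarrow> unbounded A"
proof -
  have "(\<forall>p\<in>F. \<exists>a\<in>A. (p, a) \<in> k) \<longleftrightarrow> (\<forall>b\<in>F. \<exists>s\<in>A. b \<prec> s)" if A: "A \<subseteq> F"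
  proof
    assume l: "\<forall>p\<in>F. \<exists>a\<in>A. (p, a) \<in> k"
    show "\<forall>b\<in>F. \<exists>s\<in>A. b \<prec> s"
    proof
      fix b assume "b \<in> F"
      then obtain c where c: "c \<in> F" "b \<prec> c" using ex_greater by blast
      then obtain s where "s \<in> A" "(c, s) \<in> k" using l by blast
      then have "c \<preceq> s" using k_iff c A by blast
      then show "\<exists>s\<in>A. b \<prec> s" using c \<open>s \<in> A\<close> less_le_trans by blast
    qed
  next
    assume "\<forall>b\<in>F. \<exists>s\<in>A. b \<prec> s"
    then show "\<forall>p\<in>F. \<exists>a\<in>A. (p, a) \<in> k" using k_iff A less_imp_le by blast
  qed
  then show ?thesis unfolding cofinal_in_def unbounded_def Field_k by blast
qed

lemma club_in_Field: "club_in k (Field k) E \<longleftrightarrow> Club E"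
proof -
  have "(\<forall>a\<in>F. k.supr (E \<inter> underS k a) = a \<and> a \<noteq> ozero k \<longrightarrow> a \<in> E) \<longleftrightarrow> (\<forall>a\<in>F. limpt E a \<longrightarrow> a \<in> E)"
    using supr_below_iff by blast
  then show ?thesis unfolding club_in_def cofinal_in_Field unfolding Club_def unbounded_def Field_k by blast
qed

lemma club_in_below:
  assumes "a \<in> Lims"
  shows "club_in k (underS k a) C \<longleftrightarrow> club C a"
proof -
  have a: "a \<in> F" "limpt UNIV a" using assms by (auto simp: Lims_def)
  have bF: "b \<in> F" if "b \<prec> a" for b using a(1) that F_down by blast
  have "(\<forall>p\<in>below a. \<exists>c\<in>C. (p, c) \<in> k) \<longleftrightarrow> limpt C a" if C: "C \<subseteq> below a"
  proof
    assume l: "\<forall>p\<in>below a. \<exists>c\<in>C. (p, c) \<in> k"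
    show "limpt C a" unfolding limpt_def
    proof (intro conjI allI impI)
      show "\<exists>b. b \<prec> a" using a(2) by (simp add: limpt_def)
      fix b assume "b \<prec> a"
      then obtain b' where b': "b \<prec> b'" "b' \<prec> a" using limptD[OF a(2)] by blast
      then obtain c where c: "c \<in> C" "(b', c) \<in> k" using l by blast
      then have "b' \<preceq> c" "c \<prec> a" using k_iff bF b'(2) C by blast+
      then show "\<exists>c\<in>C. b \<prec> c \<and> c \<prec> a" using b'(1) c(1) less_le_trans by blast
    qed
  next
    assume l: "limpt C a"
    show "\<forall>p\<in>below a. \<exists>c\<in>C. (p, c) \<in> k"
    proof
      fix p assume p: "p \<in> below a"
      then obtain c where "c \<in> C" "p \<prec> c" "c \<prec> a" using limptD[OF l] by blast
      then show "\<exists>c\<in>C. (p, c) \<in> k" using k_iff bF p less_imp_le by blast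
    qed
  qed
  moreover have "(\<forall>b\<in>below a. k.supr (C \<inter> underS k b) = b \<and> b \<noteq> ozero k \<longrightarrow> b \<in> C) \<longleftrightarrow> (\<forall>b. b \<prec> a \<and> limpt C b \<longrightarrow> b \<in> C)"
    using supr_below_iff bF by blast
  ultimately show ?thesis
    unfolding club_in_def cofinal_in_def underS_k[OF a(1)] club_def by blast
qed

lemma acc_plus_k: "unbounded A \<Longrightarrow> acc_plus k A = {a \<in> F. limpt A a}"
proof -
  assume A: "unbounded A"
  then have AF: "A \<subseteq> F" by (simp add: unbounded_def)
  have "(\<exists>c\<in>A. a \<in> underS k c) \<longleftrightarrow> a \<in> F" for a
    using A underS_k AF F_down unfolding unbounded_def by (metis mem_Collect_eq subsetD)
  then show ?thesis unfolding acc_plus_def using supr_below_iff by blast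
qed

lemma cofp_cof_points:
  assumes a: "a \<in> F" and c: "cofp a t"
  shows "a \<in> cof_points k t"
proof -
  have u: "underS k a = below a" by (rule underS_k[OF a])
  have bF: "b \<in> F" if "b \<prec> a" for b using a that F_down by blast
  obtain C where C: "C \<subseteq> below a" "limpt C a" "|C| =o t" using c by (auto simp: cofp_def)
  have aL: "limpt UNIV a" by (rule limpt_mono[OF C(2)]) blast
  obtain A where A: "cofinal_in k (below a) A" "cofinality k (below a) = |A|"
    "\<And>B. cofinal_in k (below a) B \<Longrightarrow> |A| \<le>o |B|"
    by (rule cofinality_attained[of "below a" k]) (use k_iff bF in auto)
  have "cofinal_in k (below a) C"
    unfolding cofinal_in_def
  proof (intro conjI ballI)
    fix p assume p: "p \<in> below a"
    then obtain c where "c \<in> C" "p \<prec> c" "c \<prec> a" using limptD[OF C(2)] by blast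
    then show "\<exists>c\<in>C. (p, c) \<in> k" using k_iff bF p less_imp_le by blast
  qed (rule C(1))
  then have 1: "|A| \<le>o t" using A(3) C(3) ordLeq_ordIso_trans by blast
  have "A \<subseteq> below a" using A(1) by (simp add: cofinal_in_def)
  moreover have "limpt A a" unfolding limpt_def
  proof (intro conjI allI impI)
    show "\<exists>b. b \<prec> a" using aL by (simp add: limpt_def)
    fix b assume "b \<prec> a"
    then obtain b' where b': "b \<prec> b'" "b' \<prec> a" using limptD[OF aL] by blast
    then obtain c where c: "c \<in> A" "(b', c) \<in> k" using A(1) by (auto simp: cofinal_in_def)
    then have "b' \<preceq> c" "c \<prec> a" using k_iff bF b'(2) \<open>A \<subseteq> below a\<close> by blast+
    then show "\<exists>c\<in>A. b \<prec> c \<and> c \<prec> a" using b'(1) c(1) less_le_trans by blast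
  qed
  ultimately have "t \<le>o |A|" using c by (simp add: cofp_def)
  with 1 have "|A| =o t" by (simp add: ordIso_iff_ordLeq)
  then have "cf k a =o t" unfolding u A(2) .
  then show ?thesis unfolding cof_points_def Field_k using a by simp
qed

lemma osuc_k:
  assumes "a \<in> F"
  shows "osuc k a \<in> F" "a \<prec> osuc k a" "a \<prec> b \<Longrightarrow> osuc k a \<preceq> b"
proof -
  let ?U = "{b \<in> F. a \<prec> b}"
  have U: "AboveS k {a} = ?U" using k_iff assms by (auto simp: AboveS_def Field_k le_less)
  have ne: "?U \<noteq> {}" using ex_greater[OF assms] by blast
  have s: "osuc k a = minel ?U" unfolding k.suc_def U by (rule minim_k) (use ne in blast)+
  show "osuc k a \<in> F" "a \<prec> osuc k a" using minel_in[OF ne] unfolding s by blast+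
  show "osuc k a \<preceq> b" if "a \<prec> b"
  proof (cases "b \<in> F")
    case True then show ?thesis unfolding s using minel_le[of b ?U] that by blast
  next
    case False
    then show ?thesis using \<open>osuc k a \<in> F\<close> F_le le_cases by blast
  qed
qed

lemma not_Lims:
  assumes "a \<in> F" "a \<notin> Lims"
  shows "a = ozero k \<or> (\<exists>b\<in>F. a = osuc k b)"
proof (cases "\<exists>b. b \<prec> a")
  case True
  then obtain b where b: "b \<prec> a" "\<not> (\<exists>c. b \<prec> c \<and> c \<prec> a)" using assms by (auto simp: Lims_def limpt_def)
  then have "b \<in> F" using assms(1) F_down by blast
  have "a = osuc k b" using b osuc_k(2,3)[OF \<open>b \<in> F\<close>] by (metis le_less)
  then show ?thesis using \<open>b \<in> F\<close> by blast
next
  case False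
  have "F \<noteq> {}" using assms(1) by blast
  then have "ozero k = minel F" unfolding Field_k by (intro minim_k) auto
  moreover have "minel F = a" using False by (intro minel_eqI[OF assms(1)]) (auto simp: not_less[symmetric])
  ultimately show ?thesis by simp
qed

end

section \<open>Square sequences\<close>

context succ_card_rel
begin

lemma square_seqD:
  assumes "square_seq k xi mu chi Cs"
  shows "Cs (ozero k) = {{}}" "a \<in> F \<Longrightarrow> Cs (osuc k a) = {{a}}"
    "a \<in> Lims \<Longrightarrow> Cs a \<noteq> {}" "a \<in> Lims \<Longrightarrow> C \<in> Cs a \<Longrightarrow> club C a" "a \<in> Lims \<Longrightarrow> C \<in> Cs a \<Longrightarrow> otp k C \<le>o xi"
    "a \<in> Lims \<Longrightarrow> |Cs a| <o mu"
    "a \<in> Lims \<Longrightarrow> C \<in> Cs a \<Longrightarrow> C' \<in> Cs a \<Longrightarrow> otp k C =o xi \<Longrightarrow> otp k C' =o xi \<Longrightarrow> C = C'"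
    "a \<in> Lims \<Longrightarrow> C \<in> Cs a \<Longrightarrow> b \<in> Acc C \<Longrightarrow> \<exists>D\<in>Cs b. initial_part_mod k chi D C"
    "unbounded A \<Longrightarrow> \<exists>a\<in>F. limpt A a \<and> A \<inter> below a \<notin> Cs a"
    "a \<in> Lims \<Longrightarrow> a \<notin> support k Cs \<Longrightarrow> \<exists>e. Cs a = {e} \<and> otp k e =o cf k a"
    "cof_points k natLeq \<subseteq> support k Cs"
proof -
  note sq = assms[unfolded square_seq_def acc_Field]
  note p1 = sq[THEN conjunct1] and r1 = sq[THEN conjunct2]
  note p2 = r1[THEN conjunct1] and r2 = r1[THEN conjunct2]
  note p3 = r2[THEN conjunct1] and r3 = r2[THEN conjunct2]
  note p4 = r3[THEN conjunct1] and r4 = r3[THEN conjunct2]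
  note p5 = r4[THEN conjunct1] and r5 = r4[THEN conjunct2]
  note p6 = r5[THEN conjunct1] and p7 = r5[THEN conjunct2]
  note q1 = p3[THEN bspec, THEN conjunct1] and s1 = p3[THEN bspec, THEN conjunct2]
  note q2 = s1[THEN conjunct1] and s2 = s1[THEN conjunct2]
  note q3 = s2[THEN conjunct1] and q4 = s2[THEN conjunct2]
  show "Cs (ozero k) = {{}}" by (rule p1)
  show "Cs (osuc k a) = {{a}}" if "a \<in> F" using p2 that unfolding Field_k by (rule bspec)
  show "Cs a \<noteq> {}" if "a \<in> Lims" by (rule q1[OF that])
  show club: "club C a" if "a \<in> Lims" "C \<in> Cs a" for a C
    using bspec[OF q2[OF that(1)] that(2), THEN conjunct1] club_in_below[OF that(1)] by simp
  show "otp k C \<le>o xi" if "a \<in> Lims" "C \<in> Cs a"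
    by (rule bspec[OF q2[OF that(1)] that(2), THEN conjunct2])
  show "|Cs a| <o mu" if "a \<in> Lims" by (rule q3[OF that])
  show "C = C'" if "a \<in> Lims" "C \<in> Cs a" "C' \<in> Cs a" "otp k C =o xi" "otp k C' =o xi"
    using q4[OF that(1), rule_format, OF that(2,3)] that(4,5) by simp
  show "\<exists>D\<in>Cs b. initial_part_mod k chi D C" if "a \<in> Lims" "C \<in> Cs a" "b \<in> Acc C"
  proof -
    have aF: "a \<in> F" using that(1) by (simp add: Lims_def)
    then have "C \<subseteq> F" using clubD(1)[OF club[OF that(1,2)]] F_down by blast
    then have "b \<in> acc k C" using that(3) acc_k by simp
    then show ?thesis using p4 that(2) aF unfolding Field_k by simp
  qed
  show "\<exists>a\<in>F. limpt A a \<and> A \<inter> below a \<notin> Cs a" if A: "unbounded A"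
  proof -
    have "cofinal_in k (Field k) A" using A by (simp add: cofinal_in_Field)
    then have "\<exists>a\<in>acc_plus k A. A \<inter> underS k a \<notin> Cs a" using p5 by simp
    then obtain a where "a \<in> F" "limpt A a" "A \<inter> underS k a \<notin> Cs a" unfolding acc_plus_k[OF A] by blast
    then show ?thesis by (intro bexI[of _ a]) (simp_all add: underS_k)
  qed
  show "\<exists>e. Cs a = {e} \<and> otp k e =o cf k a" if "a \<in> Lims" "a \<notin> support k Cs"
    using p6 that by simp
  show "cof_points k natLeq \<subseteq> support k Cs" by (rule p7)
qed

lemma Lims_subset_F: "Lims \<subseteq> F"
  by (auto simp: Lims_def)

lemma club_subset_F: "club C a \<Longrightarrow> a \<in> F \<Longrightarrow> C \<subseteq> F"
  using clubD(1) F_down by blast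

lemma support_k:
  assumes "\<forall>a\<in>Lims. \<forall>C\<in>Cs a. club C a"
  shows "support k Cs = {a \<in> Lims. \<forall>C\<in>Cs a. \<forall>b\<in>Acc C. C \<inter> below b \<in> Cs b}"
proof -
  have "(\<forall>C\<in>Cs a. \<forall>b\<in>acc k C. C \<inter> underS k b \<in> Cs b) \<longleftrightarrow> (\<forall>C\<in>Cs a. \<forall>b\<in>Acc C. C \<inter> below b \<in> Cs b)"
    if a: "a \<in> Lims" for a
  proof (rule ball_cong[OF refl])
    fix C assume "C \<in> Cs a"
    then have "C \<subseteq> F" using assms a club_subset_F Lims_subset_F by blast
    then have CF: "C \<subseteq> F" .
    show "(\<forall>b\<in>acc k C. C \<inter> underS k b \<in> Cs b) \<longleftrightarrow> (\<forall>b\<in>Acc C. C \<inter> below b \<in> Cs b)"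
      unfolding acc_k[OF CF]
    proof (rule ball_cong[OF refl])
      fix b assume "b \<in> Acc C"
      then have "b \<in> F" using CF by (auto simp: Acc_def)
      then show "(C \<inter> underS k b \<in> Cs b) = (C \<inter> below b \<in> Cs b)" by (simp only: underS_k)
    qed
  qed
  then show ?thesis unfolding support_def acc_Field by blast
qed

lemma Acc_Lims: "club C a \<Longrightarrow> a \<in> F \<Longrightarrow> b \<in> Acc C \<Longrightarrow> b \<in> Lims"
  using club_subset_F limpt_mono[of C b UNIV] unfolding Acc_def Lims_def by blast

lemma square_seq_support:
  assumes sq: "square_seq k xi mu chi Cs"
  shows "support k Cs = {a \<in> Lims. \<forall>C\<in>Cs a. \<forall>b\<in>Acc C. C \<inter> below b \<in> Cs b}"
  by (rule support_k) (use square_seqD(4)[OF sq] in blast)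

text \<open>Outside the support \<open>Cs b\<close> has only one element, which must then be
  \<open>C \<inter> below b\<close>. Its restrictions are restrictions of \<open>C\<close> and
  belong to the sequence, so \<open>b\<close> is in the support after all.\<close>

lemma square_seq_support_Acc:
  assumes sq: "square_seq k xi mu chi Cs" and a: "a \<in> support k Cs" and C: "C \<in> Cs a" and b: "b \<in> Acc C"
  shows "b \<in> support k Cs"
proof (rule ccontr)
  note D = square_seqD[OF sq]
  note G = square_seq_support[OF sq]
  assume no: "b \<notin> support k Cs"
  have aL: "a \<in> Lims" and aF: "a \<in> F" using a G Lims_subset_F by blast+
  have clC: "club C a" by (rule D(4)[OF aL C])
  have res: "C \<inter> below c \<in> Cs c" if "c \<in> Acc C" for c using a C that G by blast
  have bL: "b \<in> Lims" by (rule Acc_Lims[OF clC aF b])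
  obtain e where e: "Cs b = {e}" using D(10)[OF bL no] by blast
  then have e': "e = C \<inter> below b" using res[OF b] by blast
  have "e \<inter> below c \<in> Cs c" if c: "c \<in> Acc e" for c
  proof -
    have "c \<in> Acc C" "c \<prec> b" using c unfolding e' Acc_below by blast+
    then have "C \<inter> below b \<inter> below c = C \<inter> below c" by (auto intro: less_trans)
    then show ?thesis using res[OF \<open>c \<in> Acc C\<close>] unfolding e' by simp
  qed
  then have "\<forall>C\<in>Cs b. \<forall>c\<in>Acc C. C \<inter> below c \<in> Cs c" by (simp add: e)
  then have "b \<in> support k Cs" unfolding G using bL by (intro CollectI conjI)
  then show False using no by (rule notE[rotated])
qed

lemma square_seq_coherent:
  assumes sq: "square_seq k xi mu chi Cs" and mu: "mu \<le>o lam"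
  shows "coherent Cs (support k Cs)" "threadless Cs (support k Cs)"
proof -
  note D = square_seqD[OF sq]
  note G = square_seq_support[OF sq]
  let ?G = "support k Cs"
  have GL: "?G \<subseteq> Lims" using G by blast
  show "coherent Cs ?G"
    unfolding coherent_def
  proof (intro conjI ballI)
    show "?G \<subseteq> F" using GL Lims_subset_F by blast
    fix a assume a: "a \<in> ?G"
    then have aL: "a \<in> Lims" using GL by blast
    show "Cs a \<noteq> {}" by (rule D(3)[OF aL])
    show "|Cs a| <o lam" using D(6)[OF aL] mu by (rule ordLess_ordLeq_trans)
    fix C assume C: "C \<in> Cs a"
    show "club C a" by (rule D(4)[OF aL C])
    fix b assume b: "b \<in> Acc C"
    show "b \<in> ?G" by (rule square_seq_support_Acc[OF sq a C b])
    show "C \<inter> below b \<in> Cs b" using a C b G by blast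
  qed
  show "threadless Cs ?G" unfolding threadless_def using D(9) by blast
qed

lemma initial_part_club:
  assumes E: "club E b" and b: "b \<in> C" and i: "initial_part k E C"
  shows "E = C \<inter> below b"
proof -
  have "E \<noteq> C" using b clubD(1)[OF E] by blast
  then obtain c where c: "c \<in> F" "E = C \<inter> below c" using i underS_k unfolding initial_part_def Field_k by blast
  have "\<not> b \<prec> c" using b c(2) clubD(1)[OF E] by blast
  moreover have "\<not> c \<prec> b"
  proof
    assume "c \<prec> b"
    then obtain x where "x \<in> E" "c \<prec> x" using limptD[OF clubD(2)[OF E]] by blast
    then show False using c(2) by auto
  qed
  ultimately have "b = c" by order
  then show ?thesis using c(2) by simp
qed

text \<open>Some restriction of \<open>C\<close> is missing from the sequence. Coherence of
  \<open>C\<close> at that point can only come from the second alternative of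
  \<open>initial_part_mod\<close>, and that is a condition on \<open>C\<close> alone.\<close>

lemma not_support:
  assumes sq: "square_seq k xi mu chi Cs" and a: "a \<in> Lims" "a \<notin> support k Cs" and C: "C \<in> Cs a"
  shows "otp k C <o chi \<and> (\<forall>c\<in>nacc k C. \<exists>b\<in>Field k. c = osuc k b)"
proof -
  note D = square_seqD[OF sq]
  obtain e where e: "Cs a = {e}" using D(10)[OF a] by blast
  have Ce: "C = e" using e C by blast
  have "\<exists>C\<in>Cs a. \<exists>b\<in>Acc C. C \<inter> below b \<notin> Cs b" using a square_seq_support[OF sq] by blast
  then obtain b where b: "b \<in> Acc C" "C \<inter> below b \<notin> Cs b" unfolding Ce e by blast
  have clubC: "club C a" by (rule D(4)[OF a(1) C])
  have aF: "a \<in> F" using a(1) Lims_subset_F by blast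
  have bL: "b \<in> Lims" by (rule Acc_Lims[OF clubC aF b(1)])
  obtain E where E: "E \<in> Cs b" "initial_part_mod k chi E C" using D(8)[OF a(1) C b(1)] by blast
  have "\<not> initial_part k E C"
    using initial_part_club[OF D(4)[OF bL E(1)], of C] b E(1) by (auto simp: Acc_def)
  then show ?thesis using E(2) unfolding initial_part_mod_def by blast
qed

lemma ex_limit_in_support:
  assumes sq: "square_seq k xi mu chi Cs" and A: "unbounded A" and b: "b \<in> F"
  shows "\<exists>a\<in>support k Cs. b \<prec> a \<and> limpt A a"
proof -
  \<comment> \<open>The value \<open>b\<close> at all points up to \<open>b\<close> forces closure
    points above \<open>b\<close>.\<close>
  have g: "\<forall>x\<in>F. (if x \<preceq> b then b else x) \<in> F" using b by simp
  have "natLeq \<le>o lam" using lam_uncountable ordLess_imp_ordLeq by blast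
  from ex_cofp_Cl[OF natLeq_Cinfinite regularCard_natLeq this g A]
  obtain a where a: "a \<in> Cl (\<lambda>x. if x \<preceq> b then b else x)" "cofp a natLeq" "limpt A a" by blast
  have aF: "a \<in> F" using a(1) Cl_subset_F by blast
  obtain x where "x \<prec> a" using a(3) by (auto simp: limpt_def)
  then have "(if x \<preceq> b then b else x) \<prec> a" using a(1) by (simp add: Cl_def)
  then have "b \<prec> a" by (auto split: if_splits)
  moreover have "a \<in> support k Cs" using cofp_cof_points[OF aF a(2)] square_seqD(11)[OF sq] by blast
  ultimately show ?thesis using a(3) by blast
qed

text \<open>For the supports only an inclusion is claimed: a club outside the old support may happen
  to cohere with the changed ones.\<close>

lemma square_seq_conservative:
  assumes sq: "square_seq k xi mu chi Cs" and mu: "mu \<le>o lam" and P: "conservative P"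
  defines "Cs' \<equiv> \<lambda>a. if a \<in> support k Cs then P ` Cs a else Cs a"
  shows "square_seq k xi mu chi Cs'" "support k Cs \<subseteq> support k Cs'"
proof -
  note D = square_seqD[OF sq]
  note G = square_seq_support[OF sq]
  let ?G = "support k Cs"
  have GL: "?G \<subseteq> Lims" using G by blast
  have coh: "coherent Cs ?G" and thr: "threadless Cs ?G" using square_seq_coherent[OF sq mu] by blast+
  have in_G: "Cs' a = P ` Cs a" if "a \<in> ?G" for a using that by (simp add: Cs'_def)
  have out_G: "Cs' a = Cs a" if "a \<notin> ?G" for a using that by (simp add: Cs'_def)
  have PC: "club (P C) a" "Acc (P C) \<subseteq> Acc C" "\<And>b. b \<in> Acc (P C) \<Longrightarrow> P C \<inter> below b = P (C \<inter> below b)"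
    if "club C a" "a \<in> F" for a C
    using P that unfolding conservative_def by blast+
  have old: "club C a" "\<And>b. b \<in> Acc C \<Longrightarrow> b \<in> ?G \<and> C \<inter> below b \<in> Cs b" if "a \<in> ?G" "C \<in> Cs a" for a C
    using coh that unfolding coherent_def by blast+
  have GF: "?G \<subseteq> F" using GL Lims_subset_F by blast
  have club': "club C a" if a: "a \<in> Lims" and C: "C \<in> Cs' a" for a C
  proof (cases "a \<in> ?G")
    case True
    then obtain C0 where C0: "C0 \<in> Cs a" "C = P C0" using C in_G by auto
    have "a \<in> F" using True GF by (rule subsetD[rotated])
    then show ?thesis unfolding C0(2) by (rule PC(1)[OF old(1)[OF True C0(1)]])
  next
    case False
    then have "C \<in> Cs a" using C out_G by simp
    then show ?thesis by (rule D(4)[OF a])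
  qed
  have dn: "b \<in> ?G \<and> C \<inter> below b \<in> Cs' b" if a: "a \<in> ?G" and C: "C \<in> Cs' a" and b: "b \<in> Acc C" for a b C
  proof -
    obtain C0 where C0: "C0 \<in> Cs a" "C = P C0" using C in_G[OF a] by auto
    have aF: "a \<in> F" using a GF by blast
    have "b \<in> Acc C0" using b PC(2)[OF old(1)[OF a C0(1)] aF] C0(2) by blast
    then have b0: "b \<in> ?G" "C0 \<inter> below b \<in> Cs b" using old(2)[OF a C0(1)] by blast+
    have "C \<inter> below b = P (C0 \<inter> below b)" using PC(3)[OF old(1)[OF a C0(1)] aF, of b] b C0(2) by simp
    then show ?thesis using b0 in_G[OF b0(1)] by simp
  qed
  have G': "support k Cs' = {a \<in> Lims. \<forall>C\<in>Cs' a. \<forall>b\<in>Acc C. C \<inter> below b \<in> Cs' b}"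
    by (rule support_k) (use club' in blast)
  show sup: "?G \<subseteq> support k Cs'" unfolding G' using GL dn by blast
  have otp_le: "otp k (P C) \<le>o otp k C" if "a \<in> ?G" "C \<in> Cs a" for a C
  proof -
    have a: "a \<in> F" using that(1) GF by blast
    have C: "club C a" by (rule old(1)[OF that])
    have "ord_on (P C) \<le>o ord_on C" by (rule ord_on_mono[OF C PC(1,2)[OF C a]])
    then show ?thesis using otp_k club_subset_F[OF C a] club_subset_F[OF PC(1)[OF C a] a] by simp
  qed
  have otp_xi: "otp k C =o xi" if "a \<in> ?G" "C \<in> Cs a" "otp k (P C) =o xi" for a C
  proof -
    have "xi \<le>o otp k C"
      using ordIso_ordLeq_trans[OF ordIso_symmetric[OF that(3)] otp_le[OF that(1,2)]] .
    moreover have "otp k C \<le>o xi" by (rule D(5)[OF _ that(2)]) (use that(1) GL in blast)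
    ultimately show ?thesis using ordIso_iff_ordLeq by blast
  qed
  have not_limit: "a \<notin> ?G" if "a \<notin> Lims" for a using that GL by blast
  show "square_seq k xi mu chi Cs'"
    unfolding square_seq_def acc_Field
  proof (intro conjI ballI allI impI)
    have Fne: "F \<noteq> {}" using bdd[of "{}"] finite_le_lam[of "{}"] by auto
    have "ozero k \<in> F" using k.minim_in[of "Field k"] Fne by (simp add: Field_k)
    then have "ozero k \<notin> Lims" using limpt_not_ozero by (auto simp: Lims_def)
    then show "Cs' (ozero k) = {{}}" using D(1) out_G not_limit by simp
    fix a assume "a \<in> Field k"
    then have aF: "a \<in> F" by (simp add: Field_k)
    have "osuc k a \<notin> Lims"
    proof
      assume "osuc k a \<in> Lims"
      then obtain x where "a \<prec> x" "x \<prec> osuc k a" using limptD osuc_k(2)[OF aF] unfolding Lims_def by blast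
      then show False using osuc_k(3)[OF aF] not_le by blast
    qed
    then show "Cs' (osuc k a) = {{a}}" using D(2)[OF aF] out_G not_limit by simp
  next
    fix a assume a: "a \<in> Lims"
    then show "Cs' a \<noteq> {}" using D(3) by (simp add: Cs'_def)
    show "|Cs' a| <o mu"
      using D(6)[OF a] ordLeq_ordLess_trans[OF card_of_image] by (auto simp: Cs'_def)
    fix C assume C: "C \<in> Cs' a"
    then show "club_in k (underS k a) C" using club' a club_in_below by blast
    show "otp k C \<le>o xi"
    proof (cases "a \<in> ?G")
      case True
      then obtain C0 where C0: "C0 \<in> Cs a" "C = P C0" using C in_G by auto
      show ?thesis unfolding C0(2) by (rule ordLeq_transitive[OF otp_le[OF True C0(1)] D(5)[OF a C0(1)]])
    next
      case False
      then have "C \<in> Cs a" using C out_G by simp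
      then show ?thesis by (rule D(5)[OF a])
    qed
    fix C' assume C': "C' \<in> Cs' a" and xi: "otp k C =o xi \<and> otp k C' =o xi"
    show "C = C'"
    proof (cases "a \<in> ?G")
      case True
      then obtain C0 C0' where C0: "C0 \<in> Cs a" "C = P C0" "C0' \<in> Cs a" "C' = P C0'" using C C' in_G by auto
      have "otp k C0 =o xi" "otp k C0' =o xi"
        using otp_xi[OF True C0(1)] otp_xi[OF True C0(3)] C0(2,4) xi by simp_all
      then show ?thesis using D(7)[OF a C0(1,3)] C0(2,4) by simp
    next
      case False then show ?thesis using D(7)[OF a] C C' xi out_G by simp
    qed
  next
    fix a C b assume a: "a \<in> Field k" and C: "C \<in> Cs' a" and b: "b \<in> acc k C"
    have aF: "a \<in> F" using a by (simp add: Field_k)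
    show "\<exists>E\<in>Cs' b. initial_part_mod k chi E C"
    proof (cases "a \<in> Lims")
      case True
      have clubC: "club C a" by (rule club'[OF True C])
      have b: "b \<in> Acc C" using b acc_k[OF club_subset_F[OF clubC aF]] by blast
      have bL: "b \<in> Lims" by (rule Acc_Lims[OF clubC aF b])
      show ?thesis
      proof (cases "a \<in> ?G")
        case True
        have "C \<inter> below b \<in> Cs' b" using dn[OF True C b] by blast
        moreover have "initial_part k (C \<inter> below b) C"
          unfolding initial_part_def Field_k using bL Lims_subset_F underS_k by blast
        ultimately show ?thesis unfolding initial_part_mod_def by blast
      next
        case False
        then have "C \<in> Cs a" using C out_G by blast
        \<comment> \<open>Outside the support every \<open>E\<close> is coherent with
          \<open>C\<close>, so the change of \<open>Cs b\<close> does no harm.\<close>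
        then have "initial_part_mod k chi E C" for E
          using not_support[OF sq \<open>a \<in> Lims\<close> False] unfolding initial_part_mod_def by blast
        moreover have "Cs' b \<noteq> {}" using D(3)[OF bL] by (simp add: Cs'_def)
        ultimately show ?thesis by blast
      qed
    next
      case False
      then have Ca: "C \<in> Cs a" using C out_G not_limit by blast
      from not_Lims[OF aF False] show ?thesis
      proof
        assume "a = ozero k"
        then have "C = {}" using Ca D(1) by simp
        then show ?thesis using b by (simp add: acc_def)
      next
        assume "\<exists>c\<in>F. a = osuc k c"
        then obtain c where c: "c \<in> F" "a = osuc k c" by blast
        then have Cc: "C = {c}" using Ca D(2)[OF c(1)] by simp
        then have "b \<in> Acc {c}" using b acc_k[of "{c}"] c(1) by simp
        then have "b = c" "limpt {c} c" by (auto simp: Acc_def)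
        then show ?thesis using limpt_ne[of "{c}" c] by auto
      qed
    qed
  next
    fix A assume "cofinal_in k (Field k) A"
    then have A: "unbounded A" by (simp add: cofinal_in_Field)
    show "\<exists>a\<in>acc_plus k A. A \<inter> underS k a \<notin> Cs' a"
    proof (rule ccontr)
      assume "\<not> ?thesis"
      then have all: "A \<inter> below a \<in> Cs' a" if "a \<in> F" "limpt A a" for a
        using acc_plus_k[OF A] underS_k that by auto
      \<comment> \<open>The supposed thread \<open>A\<close> is pulled back: the tree consists of
        the old clubs that \<open>P\<close> maps to initial segments of \<open>A\<close>, on the
        levels given by limit points of \<open>A\<close>.\<close>
      let ?S = "{a \<in> F. limpt A a}"
      let ?L = "\<lambda>a. {C \<in> Cs a. P C = A \<inter> below a}"
      \<comment> \<open>A limit point \<open>a\<close> of \<open>A\<close> is an accumulation point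
        of \<open>A \<inter> below b\<close> for some larger \<open>b\<close> in the old support,
        and the accumulation points of the new clubs at \<open>b\<close> lie in the old
        support.\<close>
      have SG: "a \<in> ?G" if "a \<in> ?S" for a
      proof -
        have aF: "a \<in> F" and la: "limpt A a" using that by blast+
        obtain b where b: "b \<in> ?G" "a \<prec> b" "limpt A b" using ex_limit_in_support[OF sq A aF] by blast
        have bF: "b \<in> F" using b(1) GF by blast
        then have Ab: "A \<inter> below b \<in> Cs' b" using all b(3) by blast
        then have cl: "club (A \<inter> below b) b" using club' b(1) GL by blast
        have "limpt (A \<inter> below b) a" using limpt_Int_below[of a b A] la b(2) less_imp_le by blast
        then have "a \<in> Acc (A \<inter> below b)" using clubD(3)[OF cl b(2)] by (simp add: Acc_def)
        then show ?thesis using dn[OF b(1) Ab] by blast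
      qed
      show False
      proof (rule threadless_no_branch[OF coh thr, of ?S ?L])
        show "unbounded ?S" unfolding unbounded_def
        proof (intro conjI ballI)
          fix b assume "b \<in> F"
          then show "\<exists>s\<in>?S. b \<prec> s" using ex_limit_in_support[OF sq A] GF by blast
        qed blast
        show "?S \<subseteq> ?G" using SG by blast
        fix a assume a: "a \<in> ?S"
        show "?L a \<subseteq> Cs a" by blast
        have "A \<inter> below a \<in> P ` Cs a" using all a in_G[OF SG[OF a]] by blast
        then show "?L a \<noteq> {}" by blast
      next
        fix a b C assume a: "a \<in> ?S" and b: "b \<in> ?S" and ba: "b \<prec> a" and C: "C \<in> ?L a"
        have aG: "a \<in> ?G" and aF: "a \<in> F" using SG[OF a] GF by blast+
        have C0: "C \<in> Cs a" and PCa: "P C = A \<inter> below a" using C by blast+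
        have clC: "club C a" by (rule old(1)[OF aG C0])
        have "limpt (P C) b" unfolding PCa using limpt_Int_below[of b a A] b ba less_imp_le by blast
        then have bA: "b \<in> Acc (P C)" using clubD(3)[OF PC(1)[OF clC aF] ba] by (simp add: Acc_def)
        then have "b \<in> Acc C" using PC(2)[OF clC aF] by blast
        then have "C \<inter> below b \<in> Cs b" using old(2)[OF aG C0] by blast
        moreover have "P (C \<inter> below b) = A \<inter> below b"
        proof -
          have "P (C \<inter> below b) = A \<inter> below a \<inter> below b" using PC(3)[OF clC aF bA] unfolding PCa by simp
          also have "A \<inter> below a \<inter> below b = A \<inter> below b" using ba by (auto intro: less_trans)
          finally show ?thesis .
        qed
        ultimately show "C \<inter> below b \<in> ?L b" by blast
      qed
    qed
  next
    fix a assume "a \<in> Lims - support k Cs'"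
    then have "a \<in> Lims" "a \<notin> ?G" using sup by blast+
    then show "\<exists>e. Cs' a = {e} \<and> otp k e =o cf k a" using D(10) out_G by simp
  next
    show "cof_points k natLeq \<subseteq> support k Cs'" using D(11) sup by blast
  qed
qed

text \<open>A club outside the support is shorter than \<open>chi\<close>, while every club in
  \<open>a\<close> has at least \<open>t\<close> points.\<close>

lemma large_cofinality_support:
  fixes t :: "'x rel"
  assumes sq: "square_seq k xi mu chi Cs" and a: "a \<in> F" "cofp a t" and t: "chi \<le>o t"
  shows "a \<in> support k Cs"
proof (rule ccontr)
  assume no: "a \<notin> support k Cs"
  obtain c where "limpt c a" using a(2) by (auto simp: cofp_def)
  then have aL: "a \<in> Lims" using a(1) limpt_mono[of c a UNIV] by (simp add: Lims_def)
  obtain C where C: "C \<in> Cs a" using square_seqD(3)[OF sq aL] by blast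
  have cl: "club C a" by (rule square_seqD(4)[OF sq aL C])
  have "otp k C <o chi" using not_support[OF sq aL no C] by blast
  then have "ord_on C <o chi" using otp_k[OF club_subset_F[OF cl a(1)]] by simp
  moreover have "|C| \<le>o ord_on C"
    using card_of_least[of C "ord_on C"] Well_order_ord_on[of C] by (simp add: Field_ord_on)
  moreover have "t \<le>o |C|" using a(2) clubD(1,2)[OF cl] by (simp add: cofp_def)
  ultimately have "t <o chi" using ordLeq_transitive ordLeq_ordLess_trans by blast
  then show False using t not_ordLess_ordLeq by blast
qed

text \<open>If \<open>chi\<close> is at most \<open>t\<close>, all points of cofinality
  \<open>t\<close> are in the support. If \<lambda> is regular, a point of cofinality \<lambda> is
  in the support, and closure points of \<open>g\<close> with cofinality \<open>t\<close> are found
  among the accumulation points of any club assigned to it.\<close>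

lemma stationary_support:
  fixes t :: "'x rel"
  assumes sq: "square_seq k xi mu chi Cs" and t: "Cinfinite t" "regularCard t" "t <o lam"
    and chi: "chi \<le>o lam" and large: "chi \<le>o t \<or> regularCard lam" and g: "\<forall>x\<in>F. g x \<in> F"
  shows "\<exists>a\<in>support k Cs \<inter> Cl g. cofp a t"
proof -
  have unbF: "unbounded F" using ex_greater by (auto simp: unbounded_def)
  have t_le: "t \<le>o lam" using t(3) ordLess_imp_ordLeq by blast
  from large show ?thesis
  proof
    assume "chi \<le>o t"
    obtain a where a: "a \<in> Cl g" "cofp a t" using ex_cofp_Cl[OF t(1,2) t_le g unbF] by blast
    then have "a \<in> support k Cs" using large_cofinality_support[OF sq _ a(2) \<open>chi \<le>o t\<close>] Cl_subset_F by blast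
    then show ?thesis using a by blast
  next
    assume reg: "regularCard lam"
    \<comment> \<open>With \<open>a\<close> closed under \<open>bnd g\<close>, the construction of
      \<open>ex_cofp\<close> can be carried out below \<open>a\<close>, inside a club
      \<open>C\<close>.\<close>
    have g': "\<forall>x\<in>F. bnd g x \<in> F" using bnd(1)[OF g] by blast
    have "lam \<le>o lam" using lam_card by (rule ordLeq_refl)
    then obtain a where a: "a \<in> Cl (bnd g)" "cofp a lam"
      using ex_cofp_Cl[OF lam_Cinfinite reg _ g' unbF] by blast
    have aF: "a \<in> F" using a(1) Cl_subset_F by blast
    have aG: "a \<in> support k Cs" by (rule large_cofinality_support[OF sq aF a(2) chi])
    then have aL: "a \<in> Lims" unfolding square_seq_support[OF sq] by blast
    obtain C where C: "C \<in> Cs a" using square_seqD(3)[OF sq aL] by blast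
    have cl: "club C a" by (rule square_seqD(4)[OF sq aL C])
    have step: "\<exists>x\<in>C. \<forall>b\<in>B. b \<prec> x" if B: "B \<subseteq> below a" "|B| <o t" for B
    proof -
      have "|B| <o lam" using B(2) t_le by (rule ordLess_ordLeq_trans)
      then obtain b where b: "b \<prec> a" "\<forall>x\<in>B. x \<preceq> b" by (rule cofp_bdd[OF a(2) B(1)])
      obtain x where "x \<in> C" "b \<prec> x" using limptD[OF clubD(2)[OF cl] b(1)] by blast
      then show ?thesis using b(2) by (blast intro: le_less_trans)
    qed
    have belowF: "below a \<subseteq> F" using aF F_down by blast
    have closed: "\<forall>x\<in>below a. bnd g x \<in> below a" using a(1) by (simp add: Cl_def)
    obtain b B where b: "b \<in> Cl g" "cofp b t" "B \<subseteq> C" "|B| =o t" "limpt B b"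
      by (rule ex_cofp[OF t(1,2) t_le g clubD(1)[OF cl] belowF closed step])
    have Ba: "B \<subseteq> below a" using b(3) clubD(1)[OF cl] by blast
    have "|B| <o lam" using b(4) t(3) by (rule ordIso_ordLess_trans)
    then obtain b' where b': "b' \<prec> a" "\<forall>x\<in>B. x \<preceq> b'" by (rule cofp_bdd[OF a(2) Ba])
    have "\<not> b' \<prec> b" using limptD[OF b(5), of b'] b'(2) not_le by blast
    then have ba: "b \<prec> a" using b'(1) by order
    have "limpt C b" by (rule limpt_mono[OF b(5)]) (use b(3) in blast)
    then have "b \<in> Acc C" using clubD(3)[OF cl ba] by (simp add: Acc_def)
    then have "b \<in> support k Cs" by (rule square_seq_support_Acc[OF sq aG C])
    then show ?thesis using b(1,2) by blast
  qed
qed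

end

section \<open>Density and the cofinalities at which the support is stationary\<close>

lemma ord_seg_facts:
  assumes "Card_order lam" "a \<in> Field lam"
  shows "Field (ord_seg lam a) = underS lam a" "ord_seg lam a <o lam"
proof -
  have wo: "Well_order lam" using assms(1) card_order_on_well_order_on by blast
  then have "Refl lam"
    by (simp add: well_order_on_def linear_order_on_def partial_order_on_def preorder_on_def)
  then show "Field (ord_seg lam a) = underS lam a"
    unfolding ord_seg_def by (rule Refl_Field_Restr2) (auto simp: underS_def Field_def)
  show "ord_seg lam a <o lam"
    unfolding ord_seg_def by (rule underS_Restr_ordLess[OF wo]) (use assms(2) in blast)
qed

lemma ord_seg_mono:
  assumes lam: "Well_order lam" and ab: "(a, b) \<in> lam"
  shows "ord_seg lam a \<le>o ord_seg lam b"
proof -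
  interpret wo_rel lam using lam by (simp add: wo_rel_def)
  have "underS a \<subseteq> underS b"
    using ab TRANS ANTISYM unfolding underS_def trans_def antisym_def by blast
  then show ?thesis
    unfolding ord_seg_def using ofilter_subset_ordLeq[OF WELL underS_ofilter underS_ofilter] by blast
qed

lemma density_family:
  assumes lam: "Card_order lam" and d: "density lam t =o lam"
  shows "\<exists>D. (\<forall>X. X \<subseteq> Field lam \<and> |X| =o t \<longrightarrow> (\<exists>Y\<in>D. Y \<subseteq> X)) \<and> (\<forall>Y\<in>D. |Y| =o t) \<and> |D| \<le>o lam"
proof -
  let ?le = "{(X, Y). X \<supseteq> Y}"
  obtain D where D: "cofinal_in ?le (subsets_of_size lam t) D" "density lam t = |D|"
    unfolding density_def by (rule cofinality_attained[of "subsets_of_size lam t" ?le]) auto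
  have "|D| \<le>o lam" using d unfolding D(2) by (rule ordIso_imp_ordLeq)
  moreover have "\<exists>Y\<in>D. Y \<subseteq> X" if "X \<subseteq> Field lam \<and> |X| =o t" for X
    using D(1) that unfolding cofinal_in_def subsets_of_size_def by auto
  moreover have "|Y| =o t" if "Y \<in> D" for Y
    using D(1) that unfolding cofinal_in_def subsets_of_size_def by auto
  ultimately show ?thesis by blast
qed

context succ_card_rel
begin

text \<open>If \<lambda> is singular, the regular \<open>chi\<close> is smaller than \<lambda> and
  itself represented in \<open>reg lam\<close>, so that cofinally many of the given cofinalities are
  at least \<open>chi\<close>.\<close>

lemma cofinal_stationary_cofinalities:
  assumes sq: "square_seq k xi mu chi Cs"
    and chi: "Cinfinite chi" "regularCard chi" "chi \<le>o lam"
    and dense: "cofinal_in lam (reg lam) {t \<in> reg lam. density lam (ord_seg lam t) =o lam}"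
  shows "cofinal_in lam (reg lam) {t \<in> reg lam. density lam (ord_seg lam t) =o lam \<and>
    (\<forall>g. (\<forall>x\<in>F. g x \<in> F) \<longrightarrow> (\<exists>a\<in>support k Cs \<inter> Cl g. cofp a (ord_seg lam t)))}"
proof -
  have wl: "Well_order lam" using lam_card card_order_on_well_order_on by blast
  interpret L: wo_rel lam using wl by (simp add: wo_rel_def)
  have stat: "\<exists>a\<in>support k Cs \<inter> Cl g. cofp a (ord_seg lam t)"
    if t: "t \<in> reg lam" "chi \<le>o ord_seg lam t \<or> regularCard lam" and g: "\<forall>x\<in>F. g x \<in> F" for t g
  proof (rule stationary_support[OF sq _ _ _ chi(3) t(2) g])
    show "Cinfinite (ord_seg lam t)" "regularCard (ord_seg lam t)" using t(1) by (auto simp: reg_def)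
    show "ord_seg lam t <o lam" using ord_seg_facts(2)[OF lam_card] t(1) by (auto simp: reg_def)
  qed
  have "\<exists>t\<in>reg lam. density lam (ord_seg lam t) =o lam \<and> (chi \<le>o ord_seg lam t \<or> regularCard lam) \<and> (p, t) \<in> lam"
    if p: "p \<in> reg lam" for p
  proof (cases "regularCard lam")
    case True
    then show ?thesis using dense p unfolding cofinal_in_def by blast
  next
    case False
    have "\<not> chi =o lam" using False regularCard_ordIso chi(1,2) by blast
    then have "chi <o lam" using chi(3) ordLeq_iff_ordLess_or_ordIso by blast
    then obtain c where c: "c \<in> Field lam" "chi =o ord_seg lam c"
      using ordLess_iff_ordIso_Restr[OF wl, of chi] chi(1) card_order_on_well_order_on
      unfolding ord_seg_def by blast
    have creg: "c \<in> reg lam"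
      using c Cinfinite_cong[OF c(2) chi(1)] regularCard_ordIso[OF c(2) chi(1,2)] by (simp add: reg_def)
    have pF: "p \<in> Field lam" using p by (simp add: reg_def)
    define m where "m = (if (p, c) \<in> lam then c else p)"
    have m: "m \<in> reg lam" "(p, m) \<in> lam" "(c, m) \<in> lam"
      using creg p L.TOTALS pF c(1) L.REFL unfolding m_def refl_on_def by auto
    then obtain t where t: "t \<in> reg lam" "density lam (ord_seg lam t) =o lam" "(m, t) \<in> lam"
      using dense unfolding cofinal_in_def by blast
    have tr: "(x, t) \<in> lam" if "(x, m) \<in> lam" for x
      using L.TRANS that t(3) unfolding trans_def by blast
    have "chi \<le>o ord_seg lam t"
      by (rule ordIso_ordLeq_trans[OF c(2) ord_seg_mono[OF wl tr[OF m(3)]]])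
    then show ?thesis using t tr[OF m(2)] by blast
  qed
  then show ?thesis unfolding cofinal_in_def using stat by blast
qed

lemma guessing_square_seq:
  assumes sq0: "square_seq k xi mu chi Cs0" and mu: "mu \<le>o lam"
    and chi: "Cinfinite chi" "regularCard chi" "chi \<le>o lam"
    and pow: "|Pow (Field lam)| \<le>o |F|"
    and dense: "cofinal_in lam (reg lam) {t \<in> reg lam. density lam (ord_seg lam t) =o lam}"
  shows "\<exists>Cs T Theta. square_seq k xi mu chi Cs \<and> transversal k Cs T \<and> cofinal_in lam (reg lam) Theta \<and>
    (\<forall>t\<in>Theta.
      (\<forall>E. club_in k (Field k) E \<longrightarrow>
        (\<exists>a \<in> cof_points k (ord_seg lam t) \<inter> support k Cs. \<forall>C\<in>Cs a. k.supr (nacc k C \<inter> E) = a)) \<and>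
      (\<forall>z\<in>Field k. \<forall>A :: 'l \<Rightarrow> 'k set. (\<forall>i\<in>underS lam t. cofinal_in k (Field k) (A i)) \<longrightarrow>
        (\<exists>a \<in> cof_points k (ord_seg lam t) \<inter> support k Cs. k.minim (T a) = z \<and>
          (\<forall>i\<in>underS lam t. k.supr (nacc k (T a) \<inter> A i) = a))))"
proof -
  let ?G = "support k Cs0"
  define Theta where "Theta = {t \<in> reg lam. density lam (ord_seg lam t) =o lam \<and>
    (\<forall>g. (\<forall>x\<in>F. g x \<in> F) \<longrightarrow> (\<exists>a\<in>?G \<inter> Cl g. cofp a (ord_seg lam t)))}"
  have Theta_cof: "cofinal_in lam (reg lam) Theta"
    unfolding Theta_def by (rule cofinal_stationary_cofinalities[OF sq0 chi dense])
  have TF: "t \<in> Field lam" if "t \<in> Theta" for t using that by (simp add: Theta_def reg_def)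
  have t1: "Cinfinite (ord_seg lam t)" if "t \<in> Theta" for t using that by (simp add: Theta_def reg_def)
  have t2: "ord_seg lam t <o lam" "Field (ord_seg lam t) = underS lam t" if "t \<in> Theta" for t
    using ord_seg_facts[OF lam_card TF[OF that]] by blast+
  have "|Theta| \<le>o |Field lam|" by (rule card_of_mono1) (use TF in blast)
  then have Theta_small: "|Theta| \<le>o lam"
    using card_of_Field_ordIso[OF lam_card] ordLeq_ordIso_trans by blast
  note coh = square_seq_coherent[OF sq0 mu]
  have "\<exists>E. \<forall>t\<in>Theta. \<forall>D. Club D \<longrightarrow>
     (\<exists>a\<in>?G. cofp a (ord_seg lam t) \<and> (\<forall>C\<in>Cs0 a. limpt (Nacc (extend (clubfill E) C) \<inter> D) a))"
  proof (rule wide_club_guessing_simultaneous[OF coh Theta_small])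
    show "Card_order (ord_seg lam t)" if "t \<in> Theta" for t using t1[OF that] by blast
    show "ord_seg lam t <o lam" if "t \<in> Theta" for t by (rule t2[OF that])
    show "\<exists>a\<in>?G \<inter> Cl g. cofp a (ord_seg lam t)" if "t \<in> Theta" "\<forall>x\<in>F. g x \<in> F" for t g
      using that by (simp add: Theta_def)
  qed
  then obtain E where E: "\<forall>t\<in>Theta. \<forall>D. Club D \<longrightarrow>
     (\<exists>a\<in>?G. cofp a (ord_seg lam t) \<and> (\<forall>C\<in>Cs0 a. limpt (Nacc (extend (clubfill E) C) \<inter> D) a))" ..
  define Cs1 where "Cs1 = (\<lambda>a. if a \<in> ?G then extend (clubfill E) ` Cs0 a else Cs0 a)"
  note cons1 = conservative_extend[OF gap_filler_clubfill[of E]]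
  have sq1: "square_seq k xi mu chi Cs1" and sup1: "?G \<subseteq> support k Cs1"
    unfolding Cs1_def by (rule square_seq_conservative[OF sq0 mu cons1])+
  let ?G1 = "support k Cs1"
  note coh1 = square_seq_coherent[OF sq1 mu]
  have G1F: "?G1 \<subseteq> F" using coh1(1) by (simp add: coherent_def)
  \<comment> \<open>Guessing is known at points of the original support; they remain in the support
    after both changes.\<close>
  define S where "S t = {a \<in> ?G. cofp a (ord_seg lam t)}" for t
  have SG1: "a \<in> ?G1" if "a \<in> S t" for a t using that sup1 by (auto simp: S_def)
  have wide: "\<exists>a\<in>S t. \<forall>C\<in>Cs1 a. limpt (Nacc C \<inter> D) a" if t: "t \<in> Theta" and D: "Club D" for t D
  proof -
    obtain a where a: "a \<in> ?G" "cofp a (ord_seg lam t)"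
      "\<forall>C\<in>Cs0 a. limpt (Nacc (extend (clubfill E) C) \<inter> D) a" using E t D by blast
    have "\<forall>C\<in>Cs1 a. limpt (Nacc C \<inter> D) a" using a(1,3) by (simp add: Cs1_def)
    then show ?thesis using a(1,2) unfolding S_def by blast
  qed
  \<comment> \<open>Any choice will do, since at suitable points of \<open>S t\<close> all clubs in
    \<open>Cs1 a\<close> guess.\<close>
  define T1 where "T1 a = (SOME C. C \<in> Cs1 a)" for a
  have T1: "T1 a \<in> Cs1 a" if "a \<in> ?G1" for a
  proof -
    have "Cs1 a \<noteq> {}" using coh1(1) that by (simp add: coherent_def)
    then show ?thesis unfolding T1_def by (rule some_in_eq[THEN iffD2])
  qed
  have club1: "club C a" if "a \<in> ?G1" "C \<in> Cs1 a" for a C using coh1(1) that by (simp add: coherent_def)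
  have "\<exists>P. conservative P \<and>
    (\<forall>a C E. club C a \<longrightarrow> a \<in> F \<longrightarrow> limpt (Nacc C \<inter> E) a \<longrightarrow> limpt (Nacc (P C) \<inter> E) a) \<and>
    (\<forall>t\<in>Theta. \<forall>z\<in>F. \<forall>A :: 'l \<Rightarrow> 'k set. (\<forall>j\<in>Field (ord_seg lam t). unbounded (A j)) \<longrightarrow>
      (\<exists>a\<in>S t. minel (P (T1 a)) = z \<and> (\<forall>j\<in>Field (ord_seg lam t). limpt (Nacc (P (T1 a)) \<inter> A j) a)))"
  proof (rule ex_guessing_transformation[OF Theta_small _ pow])
    show "\<forall>i\<in>Theta. Cinfinite (ord_seg lam i) \<and> ord_seg lam i <o lam \<and> Field (ord_seg lam i) \<subseteq> Field lam"
    proof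
      fix i assume i: "i \<in> Theta"
      have "underS lam i \<subseteq> Field lam" by (auto simp: underS_def Field_def)
      then show "Cinfinite (ord_seg lam i) \<and> ord_seg lam i <o lam \<and> Field (ord_seg lam i) \<subseteq> Field lam"
        using t1[OF i] t2[OF i] by simp
    qed
    show "\<forall>i\<in>Theta. \<exists>D. (\<forall>X. X \<subseteq> Field lam \<and> |X| =o ord_seg lam i \<longrightarrow> (\<exists>Y\<in>D. Y \<subseteq> X)) \<and>
        (\<forall>Y\<in>D. |Y| =o ord_seg lam i) \<and> |D| \<le>o lam"
      by (rule ballI, rule density_family[OF lam_card]) (simp add: Theta_def)
    show "\<forall>i\<in>Theta. \<forall>a\<in>S i. a \<in> F \<and> cofp a (ord_seg lam i)" using SG1 G1F unfolding S_def by blast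
    show "\<forall>i\<in>Theta. \<forall>a\<in>S i. club (T1 a) a"
    proof (intro ballI)
      fix i a assume "a \<in> S i"
      then have "a \<in> ?G1" by (rule SG1)
      then show "club (T1 a) a" using T1 by (intro club1)
    qed
    show "\<forall>i\<in>Theta. \<forall>g. (\<forall>x\<in>F. g x \<in> F) \<longrightarrow> (\<exists>a\<in>S i. limpt (Nacc (T1 a) \<inter> Cl g) a)"
    proof (intro ballI allI impI)
      fix i g assume "i \<in> Theta" "\<forall>x\<in>F. g x \<in> F"
      then obtain a where a: "a \<in> S i" "\<forall>C\<in>Cs1 a. limpt (Nacc C \<inter> Cl g) a" using wide[OF _ Club_Cl] by blast
      then show "\<exists>a\<in>S i. limpt (Nacc (T1 a) \<inter> Cl g) a" using T1[OF SG1] by blast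
    qed
  qed
  then obtain P where P: "conservative P \<and>
    (\<forall>a C E. club C a \<longrightarrow> a \<in> F \<longrightarrow> limpt (Nacc C \<inter> E) a \<longrightarrow> limpt (Nacc (P C) \<inter> E) a) \<and>
    (\<forall>t\<in>Theta. \<forall>z\<in>F. \<forall>A :: 'l \<Rightarrow> 'k set. (\<forall>j\<in>Field (ord_seg lam t). unbounded (A j)) \<longrightarrow>
      (\<exists>a\<in>S t. minel (P (T1 a)) = z \<and> (\<forall>j\<in>Field (ord_seg lam t). limpt (Nacc (P (T1 a)) \<inter> A j) a)))" ..
  note consP = P[THEN conjunct1]
  note presP = P[THEN conjunct2, THEN conjunct1, rule_format]
  note hitP = P[THEN conjunct2, THEN conjunct2]
  define Cs2 where "Cs2 = (\<lambda>a. if a \<in> ?G1 then P ` Cs1 a else Cs1 a)"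
  have sq2: "square_seq k xi mu chi Cs2" and sup2: "?G1 \<subseteq> support k Cs2"
    unfolding Cs2_def by (rule square_seq_conservative[OF sq1 mu consP])+
  have coh2: "coherent Cs2 (support k Cs2)" by (rule square_seq_coherent(1)[OF sq2 mu])
  have Cs2: "Cs2 a = P ` Cs1 a" if "a \<in> ?G1" for a using that by (simp add: Cs2_def)
  have club2: "club C a" if "a \<in> ?G1" "C \<in> Cs2 a" for a C using coh2 that sup2 by (auto simp: coherent_def)
  \<comment> \<open>On points that entered the support only with the second change the transversal
    is arbitrary.\<close>
  define T where "T a = (if a \<in> ?G1 then P (T1 a) else SOME C. C \<in> Cs2 a)" for a
  have "transversal k Cs2 T"
    unfolding transversal_def
  proof
    fix a assume a: "a \<in> support k Cs2"
    show "T a \<in> Cs2 a"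
    proof (cases "a \<in> ?G1")
      case True then show ?thesis using T1[OF True] by (simp add: T_def Cs2)
    next
      case False
      have "Cs2 a \<noteq> {}" using coh2 a by (simp add: coherent_def)
      then have "(SOME C. C \<in> Cs2 a) \<in> Cs2 a" by (rule some_in_eq[THEN iffD2])
      then show ?thesis using False by (simp add: T_def)
    qed
  qed
  moreover have point: "a \<in> cof_points k (ord_seg lam t) \<inter> support k Cs2" if "a \<in> S t" for a t
  proof -
    have "a \<in> ?G1" by (rule SG1[OF that])
    moreover from this have "a \<in> F" using G1F by blast
    ultimately show ?thesis using cofp_cof_points[of a "ord_seg lam t"] that sup2 by (auto simp: S_def)
  qed
  have sup_eq: "k.supr (nacc k C \<inter> X) = a" if "a \<in> ?G1" "C \<in> Cs2 a" "limpt (Nacc C \<inter> X) a" for a C X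
  proof -
    have aF: "a \<in> F" using that(1) G1F by blast
    have C: "club C a" by (rule club2[OF that(1,2)])
    have "Nacc C \<inter> X \<subseteq> below a" using clubD(1)[OF C] by (auto simp: Nacc_def)
    from supr_k(1)[OF this aF that(3)] show ?thesis unfolding nacc_k[OF club_subset_F[OF C aF]] .
  qed
  have "\<exists>a \<in> cof_points k (ord_seg lam t) \<inter> support k Cs2. \<forall>C\<in>Cs2 a. k.supr (nacc k C \<inter> E) = a"
    if t: "t \<in> Theta" and E: "club_in k (Field k) E" for t E
  proof -
    obtain a where a: "a \<in> S t" "\<forall>C\<in>Cs1 a. limpt (Nacc C \<inter> E) a"
      using wide[OF t] E unfolding club_in_Field by blast
    have aG: "a \<in> ?G1" and aF: "a \<in> F" using SG1[OF a(1)] G1F by blast+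
    have "k.supr (nacc k C \<inter> E) = a" if C: "C \<in> Cs2 a" for C
    proof -
      obtain C1 where C1: "C1 \<in> Cs1 a" "C = P C1" using C Cs2[OF aG] by auto
      have "limpt (Nacc C \<inter> E) a" unfolding C1(2)
        by (rule presP[OF club1[OF aG C1(1)] aF]) (use a(2) C1(1) in blast)
      then show ?thesis by (rule sup_eq[OF aG C])
    qed
    then show ?thesis using point[OF a(1)] by blast
  qed
  moreover have "\<exists>a \<in> cof_points k (ord_seg lam t) \<inter> support k Cs2. k.minim (T a) = z \<and>
          (\<forall>i\<in>underS lam t. k.supr (nacc k (T a) \<inter> A i) = a)"
    if t: "t \<in> Theta" and z: "z \<in> Field k" and A: "\<forall>i\<in>underS lam t. cofinal_in k (Field k) (A i)"
    for t z and A :: "'l \<Rightarrow> 'k set"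
  proof -
    have zF: "z \<in> F" using z by (simp add: Field_k)
    have "\<forall>i\<in>Field (ord_seg lam t). unbounded (A i)"
      using A t2(2)[OF t] by (simp add: cofinal_in_Field)
    from hitP[THEN bspec, OF t, THEN bspec, OF zF, THEN spec, THEN mp, OF this] obtain a where a: "a \<in> S t" "minel (P (T1 a)) = z"
      "\<forall>j\<in>Field (ord_seg lam t). limpt (Nacc (P (T1 a)) \<inter> A j) a" by blast
    have aG: "a \<in> ?G1" and aF: "a \<in> F" using SG1[OF a(1)] G1F by blast+
    have Ta: "T a = P (T1 a)" using aG by (simp add: T_def)
    have TC: "T a \<in> Cs2 a" using T1[OF aG] by (simp add: Ta Cs2[OF aG])
    have cl: "club (T a) a" by (rule club2[OF aG TC])
    have "k.minim (T a) = z"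
      using minim_k[OF club_subset_F[OF cl aF]] limpt_ne[OF clubD(2)[OF cl]] a(2) Ta by auto
    moreover have "k.supr (nacc k (T a) \<inter> A i) = a" if "i \<in> underS lam t" for i
      by (rule sup_eq[OF aG TC]) (use a(3) that t2(2)[OF t] Ta in simp)
    ultimately show ?thesis using point[OF a(1)] by blast
  qed
  ultimately show ?thesis using sq2 Theta_cof by (intro exI[of _ Cs2] exI[of _ T] exI[of _ Theta]) blast
qed

end

section \<open>The instance for \<open>cardSuc lam\<close>\<close>

theorem theorem2p19:
  fixes lam :: "'l rel" and xi :: "'x rel" and chi :: "'c rel" and mu :: "'m rel"
  assumes lam: "Card_order lam" "natLeq <o lam"
    and xi: "Well_order xi" "xi \<le>o cardSuc lam"
    and chi: "Cinfinite chi" "regularCard chi" "chi <o cardSuc lam"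
    and mu: "Card_order mu" "mu \<le>o lam"
    and square: "\<exists>Cs. square_seq (cardSuc lam) xi mu chi Cs"
    and gch: "ctwo ^c lam =o cardSuc lam"
    and dense: "cofinal_in lam (reg lam) {t \<in> reg lam. density lam (ord_seg lam t) =o lam}"
  shows "\<exists>Cs T Theta.
    square_seq (cardSuc lam) xi mu chi Cs \<and>
    transversal (cardSuc lam) Cs T \<and>
    cofinal_in lam (reg lam) Theta \<and>
    (\<forall>t\<in>Theta.
      (\<forall>E. club_in (cardSuc lam) (Field (cardSuc lam)) E \<longrightarrow>
        (\<exists>a \<in> cof_points (cardSuc lam) (ord_seg lam t) \<inter> support (cardSuc lam) Cs.
          \<forall>C\<in>Cs a. wo_rel.supr (cardSuc lam) (nacc (cardSuc lam) C \<inter> E) = a)) \<and>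
      (\<forall>z\<in>Field (cardSuc lam). \<forall>A :: 'l \<Rightarrow> 'l set set.
        (\<forall>i\<in>underS lam t. cofinal_in (cardSuc lam) (Field (cardSuc lam)) (A i)) \<longrightarrow>
        (\<exists>a \<in> cof_points (cardSuc lam) (ord_seg lam t) \<inter> support (cardSuc lam) Cs.
          wo_rel.minim (cardSuc lam) (T a) = z \<and>
          (\<forall>i\<in>underS lam t.
            wo_rel.supr (cardSuc lam) (nacc (cardSuc lam) (T a) \<inter> A i) = a))))"
proof -
  let ?k = "cardSuc lam"
  have cinf: "Cinfinite lam"
    using lam natLeq_Cinfinite cinfinite_mono ordLess_imp_ordLeq by blast
  have kc: "Card_order ?k" and kinf: "Cinfinite ?k" and kreg: "regularCard ?k"
    using cardSuc_Card_order[OF lam(1)] Cinfinite_cardSuc[OF cinf] regularCard_cardSuc[OF cinf] by blast+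
  have kwo: "Well_order ?k" using kc card_order_on_well_order_on by blast
  obtain le lt where wo: "class.wellorder le lt"
    and lt: "\<And>a b. a \<in> Field ?k \<Longrightarrow> lt b a \<longleftrightarrow> b \<in> underS ?k a"
    using ex_wellorder_extending[OF kwo] by blast
  interpret W: wellorder le lt by (rule wo)
  interpret K: succ_card_rel le lt "Field ?k" lam ?k
  proof
    show "b \<in> Field ?k" if "a \<in> Field ?k" "lt b a" for a b
      using that(2) unfolding lt[OF that(1)] by (auto simp: underS_def Field_def)
    show "|{b. lt b a}| \<le>o lam" if a: "a \<in> Field ?k" for a
    proof -
      have "{b. lt b a} = underS ?k a" using lt[OF a] by blast
      then have "|{b. lt b a}| <o ?k" using card_of_underS[OF kc a] by simp
      then show ?thesis using cardSuc_ordLeq_ordLess[OF lam(1) card_of_Card_order] by blast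
    qed
    \<comment> \<open>By regularity of the successor \<open>X\<close> is not cofinal; a point
      \<open>b\<close> beyond one that is not exceeded by \<open>X\<close> makes the bound
      strict.\<close>
    show "\<exists>b\<in>Field ?k. \<forall>x\<in>X. lt x b" if X: "X \<subseteq> Field ?k" "|X| \<le>o lam" for X
    proof -
      have "|X| <o ?k" using X(2) cardSuc_ordLeq_ordLess[OF lam(1) card_of_Card_order] by blast
      then have "\<not> |X| =o ?k" using not_ordLess_ordIso by blast
      then have "\<not> cofinal X ?k" using kreg X(1) unfolding regularCard_def by blast
      then obtain a where a: "a \<in> Field ?k" "\<forall>b\<in>X. \<not> (a \<noteq> b \<and> (a, b) \<in> ?k)"
        unfolding cofinal_def by blast
      obtain b where b: "b \<in> Field ?k" "a \<noteq> b" "(a, b) \<in> ?k"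
        using infinite_Card_order_limit[OF kc _ a(1)] kinf unfolding cinfinite_def by blast
      have lab: "lt a b" unfolding lt[OF b(1)] using b by (simp add: underS_def)
      have "lt x b" if x: "x \<in> X" for x
      proof -
        have "\<not> lt a x" using a(2) x X(1) lt[of x a] by (auto simp: underS_def)
        then show ?thesis using lab W.le_less_trans[of x a b] W.not_less by blast
      qed
      then show ?thesis using b(1) by blast
    qed
    show "underS ?k a = {b. lt b a}" if "a \<in> Field ?k" for a using lt[OF that] by blast
  qed (use lam kwo in simp_all)
  have "|Pow (Field lam)| \<le>o |Field ?k|"
  proof -
    have "|Pow (Field lam)| =o |Func (Field lam) (UNIV :: bool set)|" by (rule card_of_Pow_Func)
    also have "|Func (Field lam) (UNIV :: bool set)| = ctwo ^c lam"
      by (simp add: cexp_def ctwo_def Field_card_of)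
    also have "ctwo ^c lam =o ?k" by (rule gch)
    also have "?k =o |Field ?k|" using card_of_Field_ordIso[OF kc] by (rule ordIso_symmetric)
    finally show ?thesis by (rule ordIso_imp_ordLeq)
  qed
  moreover have "chi \<le>o lam" using chi cardSuc_ordLeq_ordLess[OF lam(1)] by blast
  moreover obtain Cs where "square_seq ?k xi mu chi Cs" using square ..
  ultimately show ?thesis
    using K.guessing_square_seq[OF _ mu(2) chi(1,2) _ _ dense] by blast
qed

end
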